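(* In the $K$-tier network model described in the context with $W=0$ (interference-limited), let $\mathcal O_k^{int}=\mathbb P\{P_k\|\mathbf h\|^2X_k^{-\alpha_k}/I_o<\beta\}$ for target $\beta>0$. Then $$\mathcal O_k^{int}=1-\frac{\lambda_k}{\mathcal T_k}\sum_{i=0}^{M_k-1}\sum_{m=0}^{M_k-1}\int_0^{R_k^2}\frac{\pi^{i+1}}{i!}\exp\Big(-\pi g_{k,0}(x)-\pi\sum_{j=1}^K\lambda_j\Omega_{j,k}^{\delta_j}x^{\delta_{j,k}}\Big)\mathbf Q^i_{M_k}(x)(m+1,1)\,dx.$$ If moreover $\alpha_j=\alpha$ for all $j$, then $$\mathcal O_k^{int}=1-\frac{\lambda_k}{\mathcal T_k}\sum_{i=0}^{M_k-1}\frac{\|\mathbf\Theta^i_{M_k}\|_1}{\mathcal Z_k^{i+1}}\Big(1-\sum_{l=0}^{i}\frac{(\pi\mathcal Z_kR_k^2)^l}{l!}e^{-\pi\mathcal Z_kR_k^2}\Big),$$ where $\|\mathbf A\|_1=\max_{q}\sum_p|A_{pq}|$ is the maximum absolute column sum.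
   Context: Network model: $\mathcal K=\{1,\dots,K\}$. In $\mathbb R^2$, tier-$k$ BSs form a homogeneous PPP of intensity $\lambda_k>0$ and users a homogeneous PPP of intensity $\lambda_u>0$, all independent. Tier-$k$ BSs have transmit power $P_k>0$, $M_k\in\mathbb N$ antennas, bias $B_k>0$, path-loss exponent $\alpha_k>2$. $\Omega_k=P_kM_kB_k$, $\delta_k=2/\alpha_k$, $\mathcal V_{j,k}=\mathcal V_j/\mathcal V_k$ for $\mathcal V\in\{P,M,B,\Omega,\delta\}$. Access threshold $\epsilon>0$, $R_k=(\Omega_k/\epsilon)^{1/\alpha_k}$. Association: with $D_k$ the distance from a typical user to its nearest tier-$k$ BS, $\hat\rho_k=\Omega_kD_k^{-\alpha_k}$ if $D_k\le R_k$, else $0$; the user is associated with tier $k$ iff $\hat\rho_k>\hat\rho_j$ for all $j\ne k$, with probability $\mathcal T_k=\pi\lambda_k\int_0^{R_k^2}\exp(-\pi\sum_j\lambda_j\Omega_{j,k}^{\delta_j}r^{\delta_{j,k}})dr$. Activation probability of tier $j$: $\mathcal A_j=1-\exp\big(-\pi\lambda_u\int_0^{R_j^2}\exp(-\pi\sum_l\lambda_l\Omega_{l,j}^{\delta_l}r^{\delta_{l,j}})dr\big)$; active tier-$j$ BSs are modeled as a homogeneous PPP of intensity $\mathcal A_j\lambda_j$. SINR model: conditional on association with tier $k$, the serving distance $X_k$ has density $\frac{2\pi\lambda_k}{\mathcal T_k}x\exp(-\pi\sum_j\lambda_j\Omega_{j,k}^{\delta_j}x^{2\delta_{j,k}})$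 on $(0,R_k]$; given $X_k$, interferers of tier $j$ are the points of independent homogeneous PPPs of intensity $\mathcal A_j\lambda_j$ outside the disk around the user of radius $\Omega_{j,k}^{1/\alpha_j}X_k^{\alpha_k/\alpha_j}$; the signal gain $\|\mathbf h\|^2\sim\mathrm{Gamma}(M_k,1)$ (maximum ratio transmission), an interferer of tier $j$ at distance $r$ contributes $P_jVr^{-\alpha_j}$ with $V\sim\mathrm{Exp}(1)$, all fading independent of each other and of the point processes; $I_o$ is the total interference. Auxiliary quantities: $\tau_{j,k}=\beta/(M_{j,k}B_{j,k})$; $\varphi_{j,k}(0)=\frac{\delta_j\tau_{j,k}{}_2F_1(1,1-\delta_j;2-\delta_j;-\tau_{j,k})}{1-\delta_j}$, $\varphi_{j,k}(n)=\frac{\delta_j\tau_{j,k}^n{}_2F_1(n+1,n-\delta_j;n+1-\delta_j;-\tau_{j,k})}{n-\delta_j}$ for $n\ge1$; $g_{k,n}(x)=\sum_j\mathcal A_j\lambda_j\Omega_{j,k}^{\delta_j}\varphi_{j,k}(n)x^{\delta_{j,k}}$; $\mathbf Q_{M_k}(x)$ is the $M_k\times M_k$ lower triangular Toeplitz matrix with zero diagonal and $(p,q)$ entry $g_{k,p-q}(x)$ for $p>q$; $\mathbf Q^i_{M_k}(x)(p,q)$ is the $(p,q)$ entry of its $i$-th power. For equal exponents $\alpha_j=\alpha$ ($\delta_j=\delta$): $\Lambda=\sum_j\lambda_j\Omega_j^\delta$, $\theta_{k,n}=\sum_j\mathcal A_j\lambda_j\Omega_{j,k}^\delta\varphi_{j,k}(n)$,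 $\mathbf\Theta_{M_k}$ is the $M_k\times M_k$ lower triangular Toeplitz matrix with zero diagonal and $(p,q)$ entry $\theta_{k,p-q}$ for $p>q$, and $\mathcal Z_k=\theta_{k,0}+\Lambda/\Omega_k^\delta$. *)

theory Defs
  imports "HOL-Probability.Probability" "Jordan_Normal_Form.Matrix"
begin

text \<open>Euler integral representation of the Gauss hypergeometric function 2F1(a,b;c;z),
  valid (and equal to the analytic continuation of the Gauss series) for c > b > 0 and
  real z < 1.  All uses below satisfy these conditions (z = -tau < 0).\<close>
definition hyp2f1 :: "real \<Rightarrow> real \<Rightarrow> real \<Rightarrow> real \<Rightarrow> real" where
  "hyp2f1 a b c z = Gamma c / (Gamma b * Gamma (c - b)) *
     integral {0..1} (\<lambda>t. t powr (b - 1) * (1 - t) powr (c - b - 1) * (1 - z * t) powr (- a))"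

definition pp_space :: "'b measure \<Rightarrow> 'b set measure" where
  "pp_space S = sigma (Pow (space S))
     {{F \<in> Pow (space S). finite (F \<inter> B) \<and> card (F \<inter> B) = n} | B n. B \<in> sets S}"

definition poisson_pp :: "'a measure \<Rightarrow> 'b measure \<Rightarrow> ('a \<Rightarrow> 'b set) \<Rightarrow> bool" where
  "poisson_pp M \<mu> \<Phi> \<longleftrightarrow> prob_space M \<and>
     (\<forall>\<omega>\<in>space M. \<Phi> \<omega> \<subseteq> space \<mu>) \<and>
     (\<forall>B\<in>sets \<mu>. emeasure \<mu> B < \<infinity> \<longrightarrow>
        (\<forall>n::nat. {\<omega>\<in>space M. finite (\<Phi> \<omega> \<inter> B) \<and> card (\<Phi> \<omega> \<inter> B) = n} \<in> sets M \<and>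
           measure M {\<omega>\<in>space M. finite (\<Phi> \<omega> \<inter> B) \<and> card (\<Phi> \<omega> \<inter> B) = n}
             = exp (- measure \<mu> B) * measure \<mu> B ^ n / fact n)) \<and>
     (\<forall>(I::nat set) B. finite I \<longrightarrow> (\<forall>i\<in>I. B i \<in> sets \<mu> \<and> emeasure \<mu> (B i) < \<infinity>) \<longrightarrow>
        disjoint_family_on B I \<longrightarrow>
        prob_space.indep_vars M (\<lambda>_. count_space UNIV) (\<lambda>i \<omega>. card (\<Phi> \<omega> \<inter> B i)) I)"

text \<open>Intensity measure of a homogeneous PPP in the plane (real \<times> real) of intensity lam,
  each point carrying an independent Exp(1) mark (independent marking theorem).\<close>
definition marked_intensity :: "real \<Rightarrow> ((real \<times> real) \<times> real) measure" where
  "marked_intensity lam = density lborel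
     (\<lambda>z. ennreal (lam * (if snd z \<ge> 0 then exp (- snd z) else 0)))"

text \<open>Om j = Omega_j = P_j M_j B_j; alpha j = path-loss exponent; delta_j = 2 / alpha_j.\<close>

definition assoc_int :: "nat \<Rightarrow> (nat \<Rightarrow> real) \<Rightarrow> (nat \<Rightarrow> real) \<Rightarrow> (nat \<Rightarrow> real) \<Rightarrow> nat \<Rightarrow> real \<Rightarrow> real" where
  "assoc_int K lam Om \<alpha> k r =
     exp (- pi * (\<Sum>j=1..K. lam j * (Om j / Om k) powr (2 / \<alpha> j) * r powr ((2 / \<alpha> j) / (2 / \<alpha> k))))"

definition radius :: "(nat \<Rightarrow> real) \<Rightarrow> (nat \<Rightarrow> real) \<Rightarrow> real \<Rightarrow> nat \<Rightarrow> real" where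
  "radius Om \<alpha> \<epsilon> k = (Om k / \<epsilon>) powr (1 / \<alpha> k)"

definition assocT :: "nat \<Rightarrow> (nat \<Rightarrow> real) \<Rightarrow> (nat \<Rightarrow> real) \<Rightarrow> (nat \<Rightarrow> real) \<Rightarrow> real \<Rightarrow> nat \<Rightarrow> real" where
  "assocT K lam Om \<alpha> \<epsilon> k = pi * lam k * integral {0..(radius Om \<alpha> \<epsilon> k)\<^sup>2} (assoc_int K lam Om \<alpha> k)"

definition activ :: "nat \<Rightarrow> (nat \<Rightarrow> real) \<Rightarrow> real \<Rightarrow> (nat \<Rightarrow> real) \<Rightarrow> (nat \<Rightarrow> real) \<Rightarrow> real \<Rightarrow> nat \<Rightarrow> real" where
  "activ K lam lu Om \<alpha> \<epsilon> j =
     1 - exp (- pi * lu * integral {0..(radius Om \<alpha> \<epsilon> j)\<^sup>2} (assoc_int K lam Om \<alpha> j))"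

definition varphi :: "real \<Rightarrow> real \<Rightarrow> nat \<Rightarrow> real" where
  "varphi \<delta> \<tau> n = (if n = 0
     then \<delta> * \<tau> * hyp2f1 1 (1 - \<delta>) (2 - \<delta>) (- \<tau>) / (1 - \<delta>)
     else \<delta> * \<tau> ^ n * hyp2f1 (real n + 1) (real n - \<delta>) (real n + 1 - \<delta>) (- \<tau>) / (real n - \<delta>))"

definition tau :: "(nat \<Rightarrow> nat) \<Rightarrow> (nat \<Rightarrow> real) \<Rightarrow> real \<Rightarrow> nat \<Rightarrow> nat \<Rightarrow> real" where
  "tau Mn Bs \<beta> j k = \<beta> / ((real (Mn j) / real (Mn k)) * (Bs j / Bs k))"

text \<open>g_{k,n}(x); A j = activation probability of tier j.\<close>
definition gfun :: "nat \<Rightarrow> (nat \<Rightarrow> real) \<Rightarrow> (nat \<Rightarrow> real) \<Rightarrow> (nat \<Rightarrow> real) \<Rightarrow> (nat \<Rightarrow> real)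
    \<Rightarrow> (nat \<Rightarrow> nat) \<Rightarrow> (nat \<Rightarrow> real) \<Rightarrow> real \<Rightarrow> nat \<Rightarrow> nat \<Rightarrow> real \<Rightarrow> real" where
  "gfun K lam A Om \<alpha> Mn Bs \<beta> k n x =
     (\<Sum>j=1..K. A j * lam j * (Om j / Om k) powr (2 / \<alpha> j)
        * varphi (2 / \<alpha> j) (tau Mn Bs \<beta> j k) n * x powr ((2 / \<alpha> j) / (2 / \<alpha> k)))"

text \<open>Lower triangular Toeplitz matrix with zero diagonal, size m, entries c (p - q) for p > q
  (0-based indices; entry (p,q) here is entry (p+1,q+1) in 1-based notation).\<close>
definition toeplitz_lt :: "nat \<Rightarrow> (nat \<Rightarrow> real) \<Rightarrow> real mat" where
  "toeplitz_lt m c = mat m m (\<lambda>(p, q). if q < p then c (p - q) else 0)"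

definition mat_norm1 :: "real mat \<Rightarrow> real" where
  "mat_norm1 A = Max {(\<Sum>p<dim_row A. \<bar>A $$ (p, q)\<bar>) | q. q < dim_col A}"

definition theta :: "nat \<Rightarrow> (nat \<Rightarrow> real) \<Rightarrow> (nat \<Rightarrow> real) \<Rightarrow> (nat \<Rightarrow> real) \<Rightarrow> real
    \<Rightarrow> (nat \<Rightarrow> nat) \<Rightarrow> (nat \<Rightarrow> real) \<Rightarrow> real \<Rightarrow> nat \<Rightarrow> nat \<Rightarrow> real" where
  "theta K lam A Om \<alpha> Mn Bs \<beta> k n =
     (\<Sum>j=1..K. A j * lam j * (Om j / Om k) powr (2 / \<alpha>) * varphi (2 / \<alpha>) (tau Mn Bs \<beta> j k) n)"

definition bigLambda :: "nat \<Rightarrow> (nat \<Rightarrow> real) \<Rightarrow> (nat \<Rightarrow> real) \<Rightarrow> real \<Rightarrow> real" where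
  "bigLambda K lam Om \<alpha> = (\<Sum>j=1..K. lam j * Om j powr (2 / \<alpha>))"

definition Zk :: "nat \<Rightarrow> (nat \<Rightarrow> real) \<Rightarrow> (nat \<Rightarrow> real) \<Rightarrow> (nat \<Rightarrow> real) \<Rightarrow> real
    \<Rightarrow> (nat \<Rightarrow> nat) \<Rightarrow> (nat \<Rightarrow> real) \<Rightarrow> real \<Rightarrow> nat \<Rightarrow> real" where
  "Zk K lam A Om \<alpha> Mn Bs \<beta> k =
     theta K lam A Om \<alpha> Mn Bs \<beta> k 0 + bigLambda K lam Om \<alpha> / Om k powr (2 / \<alpha>)"

text \<open>Total interference at the typical user (at the origin): tier-j interferers are the points
  (y, v) of Phi j (location y, fading mark v) outside the disk of radius
  Omega_{j,k}^{1/alpha_j} x^{alpha_k/alpha_j}, where x is the serving distance.\<close>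
definition interference :: "nat \<Rightarrow> (nat \<Rightarrow> real) \<Rightarrow> (nat \<Rightarrow> real) \<Rightarrow> (nat \<Rightarrow> real) \<Rightarrow> nat
    \<Rightarrow> (nat \<Rightarrow> ((real \<times> real) \<times> real) set) \<Rightarrow> real \<Rightarrow> real" where
  "interference K P Om \<alpha> k \<Phi> x =
     (\<Sum>j=1..K. infsum (\<lambda>(y, v). P j * v * norm y powr (- \<alpha> j))
        {(y, v) \<in> \<Phi> j. norm y > (Om j / Om k) powr (1 / \<alpha> j) * x powr (\<alpha> k / \<alpha> j)})"

end

theory Submission
  imports Defs "HOL-Complex_Analysis.Cauchy_Integral_Formula"
begin

text \<open>
  Condition on the serving distance \<open>x\<close> and let \<open>J\<close> be the interference multiplied by
  \<open>\<beta> x\<^sup>\<alpha> / P\<^sub>k\<close>. The Gamma tail turns the coverage probability into the sum over \<open>m < M\<^sub>k\<close> of the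
  expected Poisson weights \<open>a\<^sub>m = E (e\<^sup>-\<^sup>J J\<^sup>m / m!)\<close>, whose generating function is
  \<open>\<Sum> a\<^sub>m t\<^sup>m = E e\<^sup>-\<^sup>(\<^sup>1\<^sup>-\<^sup>t\<^sup>)\<^sup>J\<close>. By the Laplace functional of the Poisson processes this equals
  \<open>exp (- c\<^sub>0 + \<Sum> c\<^sub>n t\<^sup>n)\<close>, where \<open>c\<^sub>n\<close> is the intensity integral of the \<open>n\<close>-th Poisson weight of a
  single interferer; in polar coordinates \<open>c\<^sub>n\<close> becomes an Euler integral, namely \<open>\<pi> g\<^sub>k\<^sub>,\<^sub>n(x\<^sup>2)\<close>.
  Comparing coefficients in \<open>t\<close> expresses \<open>a\<^sub>m\<close> through powers of the Toeplitz matrix, so the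
  Laplace transform is never differentiated. For equal exponents
  \<open>g\<^sub>k\<^sub>,\<^sub>n\<close> is linear and the remaining integrals are Erlang distribution functions.
\<close>

section \<open>Counting integrals over point sets\<close>

text \<open>The weight of order 0 is exceptional: far interferers have a weight close to 1 and the
  exterior of the disk has infinite intensity, so the integral of that weight diverges. Hence
  \<open>c 0\<close> is the integral of 1 minus the weight, which is why \<open>varphi\<close>
  treats order 0 separately. Convergence for distant interferers is where
  \<open>\<alpha> j > 2\<close> enters. Default values are the second obstacle: a divergent
  \<open>infsum\<close> is 0 and a quotient by 0 is 0, and both would distort the outage event. Sums
  over points are therefore counting integrals with values up to \<open>\<infinity>\<close>, with
  \<open>expneg\<close> equal to 0 there; only afterwards is the interference shown to be almost
  surely finite and nonzero. The Poisson hypothesis speaks of counts of sets only, so the Laplace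
  functional is built up from step functions. The radius of the disk depends on the random serving
  distance, so independence can be used only once the interference is known to be jointly measurable
  in distance and configuration.\<close>

definition expneg :: "ennreal \<Rightarrow> ennreal" where
  "expneg x = (if x = \<infinity> then 0 else ennreal (exp (- enn2real x)))"

lemma expneg_ennreal [simp]: "0 \<le> x \<Longrightarrow> expneg (ennreal x) = ennreal (exp (- x))"
  by (simp add: expneg_def)

lemma expneg_0 [simp]: "expneg 0 = 1"
  by (simp add: expneg_def)

lemma expneg_top [simp]: "expneg \<infinity> = 0" "expneg Orderings.top = 0"
  by (simp_all add: expneg_def)

lemma expneg_le_1: "expneg x \<le> 1"
  by (cases x) (auto simp: expneg_def simp flip: ennreal_1)

lemma expneg_add: "expneg (x + y) = expneg x * expneg y"
proof (cases "x = \<infinity> \<or> y = \<infinity>")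
  case False
  then obtain a b where "x = ennreal a" "y = ennreal b" "0 \<le> a" "0 \<le> b"
    by (metis ennreal_cases infinity_ennreal_def)
  then show ?thesis
    by (simp add: exp_add ennreal_mult flip: ennreal_plus) (simp add: exp_minus exp_diff field_simps flip: ennreal_mult)
qed auto

lemma expneg_sum: "finite I \<Longrightarrow> expneg (\<Sum>i\<in>I. f i) = (\<Prod>i\<in>I. expneg (f i))"
  by (induction rule: finite_induct) (auto simp: expneg_add)

lemma borel_measurable_expneg [measurable]: "expneg \<in> borel_measurable borel"
  unfolding expneg_def by measurable

lemma expneg_antimono: "x \<le> y \<Longrightarrow> expneg y \<le> expneg x"
  by (cases x; cases y) (auto simp: expneg_def top_unique)

text \<open>Monotone limits suffice, since the step approximations used later increase. The limit
  \<open>\<infinity>\<close> is a separate case because \<open>enn2real\<close> is not continuous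
  there.\<close>

lemma tendsto_expneg_incseq:
  assumes "incseq f"
  shows "(\<lambda>n. expneg (f n)) \<longlonglongrightarrow> expneg (SUP n. f n)"
proof (cases "(SUP n. f n) = \<infinity>")
  case False
  have fin: "f n \<noteq> \<infinity>" for n
    using False by (metis SUP_upper UNIV_I infinity_ennreal_def top.extremum_uniqueI)
  have "f \<longlonglongrightarrow> (SUP n. f n)"
    using assms by (rule LIMSEQ_SUP)
  then have "(\<lambda>n. enn2real (f n)) \<longlonglongrightarrow> enn2real (SUP n. f n)"
    using ennreal_enn2real[of "SUP n. f n"] False
    by (intro tendsto_enn2real) (metis infinity_ennreal_def less_top, simp)
  then have "(\<lambda>n. ennreal (exp (- enn2real (f n)))) \<longlonglongrightarrow> ennreal (exp (- enn2real (SUP n. f n)))"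
    by (intro tendsto_ennrealI tendsto_exp tendsto_minus)
  then show ?thesis
    unfolding expneg_def if_not_P[OF False] if_not_P[OF fin] .
next
  case True
  have "decseq (\<lambda>n. expneg (f n))"
    using assms by (auto simp: monotone_def intro!: expneg_antimono)
  then have lim: "(\<lambda>n. expneg (f n)) \<longlonglongrightarrow> (INF n. expneg (f n))"
    by (rule LIMSEQ_INF)
  have "(INF n. expneg (f n)) \<le> ennreal e" if "e > 0" for e
  proof -
    \<comment> \<open>\<open>exp (- x)\<close> drops to \<open>e\<close> at \<open>- ln e\<close>;
      the \<open>max\<close> keeps the threshold nonnegative when \<open>e > 1\<close>.\<close>
    have "ennreal (max 0 (- ln e)) < (SUP n. f n)"
      unfolding True by simp
    then obtain n where n: "ennreal (max 0 (- ln e)) < f n"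
      by (auto simp: less_SUP_iff)
    have "expneg (f n) \<le> expneg (ennreal (max 0 (- ln e)))"
      using n by (intro expneg_antimono) simp
    also have "\<dots> \<le> ennreal e"
      using that by (auto simp: max_def ln_ge_zero_iff intro!: ennreal_leI)
    finally show ?thesis
      by (meson INF_lower UNIV_I order_trans)
  qed
  then have "(INF n. expneg (f n)) = 0"
    using ennreal_le_epsilon[of 0 "INF n. expneg (f n)"] by simp
  with lim show ?thesis unfolding True by simp
qed

section \<open>Measurability of counting integrals on the configuration space\<close>

lemma space_pp_space [simp]: "space (pp_space S) = Pow (space S)"
  unfolding pp_space_def by (rule space_measure_of) auto

lemma sets_pp_space_count:
  "B \<in> sets S \<Longrightarrow> {F \<in> Pow (space S). finite (F \<inter> B) \<and> card (F \<inter> B) = n} \<in> sets (pp_space S)"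
  unfolding pp_space_def by (subst sets_measure_of) (auto intro!: sigma_sets.Basic)

lemma nn_integral_count_space_indicator_card:
  "(\<integral>\<^sup>+z. indicator B z \<partial>count_space F) = (if finite (F \<inter> B) then of_nat (card (F \<inter> B)) else \<infinity>)"
proof -
  have "(\<integral>\<^sup>+z. indicator B z \<partial>count_space F) = (\<integral>\<^sup>+z. indicator (F \<inter> B) z \<partial>count_space F)"
    by (intro nn_integral_cong) (auto split: split_indicator)
  also have "\<dots> = emeasure (count_space F) (F \<inter> B)"
    by (intro nn_integral_indicator) auto
  finally show ?thesis
    by (simp add: emeasure_count_space)
qed

lemma measurable_count_pp_space:
  assumes "B \<in> sets S"
  shows "(\<lambda>F. \<integral>\<^sup>+z. indicator B z \<partial>count_space F) \<in> borel_measurable (pp_space S)"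
proof -
  define E where "E n = {F \<in> Pow (space S). finite (F \<inter> B) \<and> card (F \<inter> B) = n}" for n
  have [measurable]: "E n \<in> sets (pp_space S)" for n
    unfolding E_def using assms by (rule sets_pp_space_count)
  \<comment> \<open>Outside all \<open>E n\<close> the set meets \<open>B\<close> in infinitely many
    points. There \<open>card\<close> would be 0 but the counting integral is
    \<open>\<infinity>\<close>, hence the extra term.\<close>
  have "(\<lambda>F. (\<Sum>n. of_nat n * indicator (E n) F) + \<infinity> * indicator (Pow (space S) - (\<Union>n. E n)) F :: ennreal)
          \<in> borel_measurable (pp_space S)"
    unfolding space_pp_space[symmetric]
    by measurable
  also have "?this \<longleftrightarrow> ?thesis"
  proof (intro measurable_cong)
    fix F assume F: "F \<in> space (pp_space S)"
    show "(\<Sum>n. of_nat n * indicator (E n) F) + \<infinity> * indicator (Pow (space S) - (\<Union>n. E n)) F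
        = (\<integral>\<^sup>+z. indicator B z \<partial>count_space F)"
    proof (cases "finite (F \<inter> B)")
      case True
      then have iff: "F \<in> E n \<longleftrightarrow> n = card (F \<inter> B)" for n
        using F by (auto simp: E_def)
      then have "(\<Sum>n. of_nat n * indicator (E n) F) = (\<Sum>n\<in>{card (F \<inter> B)}. of_nat n * indicator (E n) F :: ennreal)"
        by (intro suminf_finite) auto
      moreover have "F \<in> (\<Union>n. E n)" "F \<in> E (card (F \<inter> B))"
        using iff by blast+
      ultimately show ?thesis
        using True unfolding nn_integral_count_space_indicator_card by simp
    next
      case False
      then have "F \<notin> E n" for n
        by (auto simp: E_def)
      then show ?thesis
        using False F unfolding nn_integral_count_space_indicator_card by simp
    qed
  qed
  finally show ?thesis .
qed

text \<open>Counts generate the sigma-algebra, and a monotone class argument carries measurability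
  to all nonnegative functions. Configurations that are not locally finite do no harm, because the
  integral may be \<open>\<infinity>\<close>.\<close>

lemma measurable_nn_integral_pp_space:
  fixes f :: "'b \<Rightarrow> ennreal"
  assumes "f \<in> borel_measurable S"
  shows "(\<lambda>F. \<integral>\<^sup>+z. f z \<partial>count_space F) \<in> borel_measurable (pp_space S)"
  using assms
proof (induction rule: borel_measurable_induct)
  case (cong f g)
  then have "(\<lambda>F. \<integral>\<^sup>+z. f z \<partial>count_space F) \<in> borel_measurable (pp_space S) \<longleftrightarrow>
     (\<lambda>F. \<integral>\<^sup>+z. g z \<partial>count_space F) \<in> borel_measurable (pp_space S)"
    by (intro measurable_cong nn_integral_cong) auto
  with cong show ?case by simp
next
  case (set A)
  then show ?case by (rule measurable_count_pp_space)
next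
  case (mult u c)
  then show ?case by (simp add: nn_integral_cmult)
next
  case (add u v)
  then show ?case by (simp add: nn_integral_add)
next
  case (seq U)
  have "(SUP i. U i) = (\<lambda>z. SUP i. U i z)"
    by (intro ext) (rule SUP_apply)
  then have "(\<integral>\<^sup>+z. (SUP i. U i) z \<partial>count_space F) = (SUP i. \<integral>\<^sup>+z. U i z \<partial>count_space F)" for F
    using seq by (simp add: nn_integral_monotone_convergence_SUP)
  with seq show ?case by (simp cong: measurable_cong)
qed

text \<open>Unconditional, because both sides are 0 when \<open>f\<close> is not summable.\<close>

lemma infsum_eq_lebesgue_integral_count_space:
  fixes f :: "'b \<Rightarrow> real"
  shows "infsum f F = (\<integral>z. f z \<partial>count_space F)"
proof -
  have iff: "f summable_on F \<longleftrightarrow> integrable (count_space F) f"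
    by (subst summable_on_iff_abs_summable_on_real, subst abs_summable_equivalent)
       (simp add: Infinite_Set_Sum.abs_summable_on_def)
  show ?thesis
  proof (cases "f summable_on F")
    case True
    then show ?thesis
      using infsetsum_infsum[of f F] iff
      by (simp add: infsetsum_def Infinite_Set_Sum.abs_summable_on_def)
  next
    case False
    then show ?thesis
      using iff by (simp add: infsum_not_exists not_integrable_integral_eq)
  qed
qed

text \<open>Reduces the real-valued sum to two counting integrals of known measurability; the
  finiteness test reproduces the default 0 of \<open>infsum\<close>.\<close>

lemma infsum_eq_enn2real_diff:
  fixes f :: "'b \<Rightarrow> real"
  defines "p \<equiv> \<lambda>F. \<integral>\<^sup>+z. ennreal (f z) \<partial>count_space F"
    and "n \<equiv> \<lambda>F. \<integral>\<^sup>+z. ennreal (- f z) \<partial>count_space F"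
  shows "infsum f F = (if p F < \<infinity> \<and> n F < \<infinity> then enn2real (p F) - enn2real (n F) else 0)"
proof (cases "p F < \<infinity> \<and> n F < \<infinity>")
  case True
  then have "integrable (count_space F) f"
    by (auto simp: real_integrable_def p_def n_def)
  then show ?thesis
    using True by (simp add: infsum_eq_lebesgue_integral_count_space real_lebesgue_integral_def p_def n_def)
next
  case False
  then have "\<not> integrable (count_space F) f"
    by (auto simp: real_integrable_def p_def n_def less_top)
  then show ?thesis
    using False by (auto simp: infsum_eq_lebesgue_integral_count_space not_integrable_integral_eq)
qed

section \<open>Poisson point processes\<close>

lemma poisson_pp_prob_space: "poisson_pp M \<mu> \<Phi> \<Longrightarrow> prob_space M"
  by (simp add: poisson_pp_def)

text \<open>Each event in \<open>poisson_pp\<close> demands a finite intersection as well. The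
  Poisson probabilities add up to 1, so these events exhaust the space almost surely, and a function
  of the count is integrated against the Poisson law.\<close>

lemma poisson_pp_count:
  assumes pp: "poisson_pp M \<mu> \<Phi>" and B: "B \<in> sets \<mu>" "emeasure \<mu> B < \<infinity>"
  shows AE_finite_poisson_pp: "AE \<omega> in M. finite (\<Phi> \<omega> \<inter> B)"
    and nn_integral_poisson_pp_count: "(\<integral>\<^sup>+\<omega>. h (card (\<Phi> \<omega> \<inter> B)) \<partial>M) =
      (\<Sum>n. h n * ennreal (exp (- measure \<mu> B) * measure \<mu> B ^ n / fact n))"
proof -
  interpret prob_space M using pp by (rule poisson_pp_prob_space)
  define E where "E n = {\<omega>\<in>space M. finite (\<Phi> \<omega> \<inter> B) \<and> card (\<Phi> \<omega> \<inter> B) = n}" for n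
  have E[measurable]: "E n \<in> events"
    and prob_E: "prob (E n) = exp (- measure \<mu> B) * measure \<mu> B ^ n / fact n" for n
    using pp B unfolding poisson_pp_def E_def by blast+
  have "disjoint_family E"
    by (auto simp: disjoint_family_on_def E_def)
  then have "(\<lambda>n. prob (E n)) sums prob (\<Union>n. E n)"
    by (intro finite_measure_UNION) auto
  moreover have "(\<lambda>n. prob (E n)) sums (exp (- measure \<mu> B) * exp (measure \<mu> B))"
    using sums_mult[OF exp_converges[of "measure \<mu> B"], of "exp (- measure \<mu> B)"]
    by (simp add: prob_E field_simps)
  ultimately have "prob (\<Union>n. E n) = 1"
    by (simp add: sums_iff exp_minus)
  then have AE_E: "AE \<omega> in M. \<omega> \<in> (\<Union>n. E n)"
    by (subst prob_eq_1[symmetric]) auto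
  then show AE_fin: "AE \<omega> in M. finite (\<Phi> \<omega> \<inter> B)"
    by eventually_elim (auto simp: E_def)
  have "AE \<omega> in M. h (card (\<Phi> \<omega> \<inter> B)) = (\<Sum>n. h n * indicator (E n) \<omega>)"
    using AE_E
  proof eventually_elim
    case (elim \<omega>)
    then have iff: "\<omega> \<in> E n \<longleftrightarrow> n = card (\<Phi> \<omega> \<inter> B)" for n
      by (auto simp: E_def)
    then have "(\<Sum>n. h n * indicator (E n) \<omega>) = (\<Sum>n\<in>{card (\<Phi> \<omega> \<inter> B)}. h n * indicator (E n) \<omega>)"
      by (intro suminf_finite) auto
    moreover have "\<omega> \<in> E (card (\<Phi> \<omega> \<inter> B))"
      using iff by blast
    ultimately show ?case by simp
  qed
  then have "(\<integral>\<^sup>+\<omega>. h (card (\<Phi> \<omega> \<inter> B)) \<partial>M) = (\<integral>\<^sup>+\<omega>. (\<Sum>n. h n * indicator (E n) \<omega>) \<partial>M)"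
    by (rule nn_integral_cong_AE)
  also have "\<dots> = (\<Sum>n. \<integral>\<^sup>+\<omega>. h n * indicator (E n) \<omega> \<partial>M)"
    by (intro nn_integral_suminf) measurable
  also have "\<dots> = (\<Sum>n. h n * ennreal (exp (- measure \<mu> B) * measure \<mu> B ^ n / fact n))"
    by (simp add: nn_integral_cmult_indicator emeasure_eq_measure prob_E)
  finally show "(\<integral>\<^sup>+\<omega>. h (card (\<Phi> \<omega> \<inter> B)) \<partial>M) = \<dots>" .
qed

lemma poisson_pp_mean_count:
  assumes pp: "poisson_pp M \<mu> \<Phi>" and B: "B \<in> sets \<mu>" "emeasure \<mu> B < \<infinity>"
  shows "(\<integral>\<^sup>+\<omega>. of_nat (card (\<Phi> \<omega> \<inter> B)) \<partial>M) = emeasure \<mu> B"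
proof -
  define m where "m = measure \<mu> B"
  have "(\<lambda>n. m * exp (- m) * (m ^ n /\<^sub>R fact n)) sums (m * exp (- m) * exp m)"
    by (intro sums_mult exp_converges)
  moreover have "m * exp (- m) * (m ^ n /\<^sub>R fact n) = real (Suc n) * (exp (- m) * m ^ Suc n / fact (Suc n))" for n
    by (simp add: field_simps del: of_nat_Suc)
  moreover have "m * exp (- m) * exp m = m"
    by (simp add: exp_minus)
  ultimately have "(\<lambda>n. real (Suc n) * (exp (- m) * m ^ Suc n / fact (Suc n))) sums m"
    by (simp only:)
  then have "(\<lambda>n. real n * (exp (- m) * m ^ n / fact n)) sums m"
    by (subst (asm) sums_Suc_iff) simp
  moreover have "0 \<le> m" by (simp add: m_def)
  ultimately have "(\<Sum>n. ennreal (real n * (exp (- m) * m ^ n / fact n))) = ennreal m"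
    by (intro suminf_ennreal_eq) auto
  moreover have "emeasure \<mu> B = ennreal m"
    using B by (simp add: m_def emeasure_eq_ennreal_measure)
  ultimately show ?thesis
    using nn_integral_poisson_pp_count[OF pp B, of of_nat] \<open>0 \<le> m\<close>
    by (simp add: m_def[symmetric] ennreal_of_nat_eq_real_of_nat flip: ennreal_mult)
qed

lemma poisson_pp_laplace_count:
  assumes pp: "poisson_pp M \<mu> \<Phi>" and B: "B \<in> sets \<mu>" "emeasure \<mu> B < \<infinity>" and b: "0 \<le> (b::real)"
  shows "(\<integral>\<^sup>+\<omega>. ennreal (exp (- b * real (card (\<Phi> \<omega> \<inter> B)))) \<partial>M)
    = ennreal (exp (- ((1 - exp (- b)) * measure \<mu> B)))"
proof -
  define m where "m = measure \<mu> B"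
  have "(\<lambda>n. exp (- m) * ((exp (- b) * m) ^ n /\<^sub>R fact n)) sums (exp (- m) * exp (exp (- b) * m))"
    by (intro sums_mult exp_converges)
  moreover have "exp (- m) * ((exp (- b) * m) ^ n /\<^sub>R fact n)
      = exp (- b * real n) * (exp (- m) * m ^ n / fact n)" for n
    by (simp add: field_simps power_mult_distrib flip: exp_of_nat_mult)
  moreover have "exp (- m) * exp (exp (- b) * m) = exp (- ((1 - exp (- b)) * m))"
    by (simp add: algebra_simps flip: exp_add)
  ultimately have "(\<lambda>n. exp (- b * real n) * (exp (- m) * m ^ n / fact n)) sums exp (- ((1 - exp (- b)) * m))"
    by (simp only:)
  moreover have "0 \<le> m" by (simp add: m_def)
  ultimately have "(\<Sum>n. ennreal (exp (- b * real n) * (exp (- m) * m ^ n / fact n))) = ennreal (exp (- ((1 - exp (- b)) * m)))"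
    by (intro suminf_ennreal_eq) auto
  then show ?thesis
    using nn_integral_poisson_pp_count[OF pp B, of "\<lambda>n. ennreal (exp (- b * real n))"] \<open>0 \<le> m\<close>
    by (simp add: m_def[symmetric] flip: ennreal_mult)
qed

section \<open>Laplace functional and Campbell's formula\<close>

lemma nn_integral_count_space_step:
  "(\<integral>\<^sup>+z. (\<Sum>i<n. ennreal (b i) * indicator (B i) z) \<partial>count_space F) =
     (\<Sum>i<(n::nat). ennreal (b i) * (\<integral>\<^sup>+z. indicator (B i) z \<partial>count_space F))"
  by (subst nn_integral_sum, simp, intro sum.cong refl nn_integral_cmult, simp)

text \<open>Disjointness and finite measure are the conditions under which \<open>poisson_pp\<close>
  supplies independent Poisson counts.\<close>

definition fin_step :: "'b measure \<Rightarrow> ('b \<Rightarrow> ennreal) \<Rightarrow> bool" where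
  "fin_step \<mu> f \<longleftrightarrow> (\<exists>(n::nat) b B. f = (\<lambda>z. \<Sum>i<n. ennreal (b i) * indicator (B i) z) \<and>
     (\<forall>i<n. 0 \<le> b i \<and> B i \<in> sets \<mu> \<and> emeasure \<mu> (B i) < \<infinity>) \<and> disjoint_family_on B {..<n})"

text \<open>Counts of disjoint sets are independent, so the expectation of the product of
  exponentials factorises into Laplace transforms of Poisson variables.\<close>

lemma poisson_pp_step:
  assumes pp: "poisson_pp M \<mu> \<Phi>" and f: "fin_step \<mu> f"
  shows poisson_pp_laplace_step: "(\<integral>\<^sup>+\<omega>. expneg (\<integral>\<^sup>+z. f z \<partial>count_space (\<Phi> \<omega>)) \<partial>M) = expneg (\<integral>\<^sup>+z. 1 - expneg (f z) \<partial>\<mu>)"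
    and poisson_pp_campbell_step: "(\<integral>\<^sup>+\<omega>. (\<integral>\<^sup>+z. f z \<partial>count_space (\<Phi> \<omega>)) \<partial>M) = (\<integral>\<^sup>+z. f z \<partial>\<mu>)"
proof -
  interpret prob_space M using pp by (rule poisson_pp_prob_space)
  obtain n b B where f_eq: "f = (\<lambda>z. \<Sum>i<n. ennreal (b i) * indicator (B i) z)"
    and b: "\<And>i. i < n \<Longrightarrow> 0 \<le> b i"
    and B: "\<And>i. i < n \<Longrightarrow> B i \<in> sets \<mu>" "\<And>i. i < n \<Longrightarrow> emeasure \<mu> (B i) < \<infinity>"
    and disj: "disjoint_family_on B {..<n::nat}"
    using f unfolding fin_step_def by blast
  define N where "N i \<omega> = card (\<Phi> \<omega> \<inter> B i)" for i \<omega>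
  have indep: "indep_vars (\<lambda>_. count_space UNIV) N {..<n}"
    using pp B disj unfolding poisson_pp_def N_def by auto
  then have N[measurable]: "i < n \<Longrightarrow> N i \<in> measurable M (count_space UNIV)" for i
    by (auto simp: indep_vars_def)
  have AE_fin: "AE \<omega> in M. \<forall>i\<in>{..<n}. finite (\<Phi> \<omega> \<inter> B i)"
    using AE_finite_poisson_pp[OF pp B] by (subst AE_finite_all) auto
  have AE_eq: "AE \<omega> in M. (\<integral>\<^sup>+z. f z \<partial>count_space (\<Phi> \<omega>)) = (\<Sum>i<n. ennreal (b i * real (N i \<omega>)))"
    using AE_fin
  proof eventually_elim
    case (elim \<omega>)
    then show ?case
      unfolding f_eq nn_integral_count_space_step nn_integral_count_space_indicator_card N_def
      by (intro sum.cong) (auto simp: b ennreal_mult' ennreal_of_nat_eq_real_of_nat)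
  qed
  have m: "emeasure \<mu> (B i) = ennreal (measure \<mu> (B i))" if "i < n" for i
    using B(2)[OF that] by (simp add: emeasure_eq_ennreal_measure)

  have "(\<integral>\<^sup>+\<omega>. expneg (\<integral>\<^sup>+z. f z \<partial>count_space (\<Phi> \<omega>)) \<partial>M)
      = (\<integral>\<^sup>+\<omega>. (\<Prod>i<n. ennreal (exp (- b i * real (N i \<omega>)))) \<partial>M)"
    using AE_eq by (intro nn_integral_cong_AE, eventually_elim) (auto simp: expneg_sum b intro!: prod.cong)
  also have "\<dots> = (\<Prod>i<n. \<integral>\<^sup>+\<omega>. ennreal (exp (- b i * real (N i \<omega>))) \<partial>M)"
    by (intro indep_vars_nn_integral indep_vars_compose2[OF indep]) auto
  also have "\<dots> = (\<Prod>i<n. ennreal (exp (- ((1 - exp (- b i)) * measure \<mu> (B i)))))"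
    unfolding N_def by (intro prod.cong poisson_pp_laplace_count[OF pp] refl) (use B b in auto)
  also have "\<dots> = (\<Prod>i<n. expneg (ennreal (1 - exp (- b i)) * emeasure \<mu> (B i)))"
    by (intro prod.cong refl) (simp add: m b flip: ennreal_mult)
  also have "\<dots> = expneg (\<Sum>i<n. ennreal (1 - exp (- b i)) * emeasure \<mu> (B i))"
    by (simp add: expneg_sum)
  also have "(\<Sum>i<n. ennreal (1 - exp (- b i)) * emeasure \<mu> (B i))
      = (\<integral>\<^sup>+z. (\<Sum>i<n. ennreal (1 - exp (- b i)) * indicator (B i) z) \<partial>\<mu>)"
    using B by (subst nn_integral_sum) (auto intro!: sum.cong simp: nn_integral_cmult_indicator)
  \<comment> \<open>By disjointness at most one \<open>B i\<close> contains \<open>z\<close>, so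
    \<open>1 - expneg\<close> may be applied term by term.\<close>
  also have "(\<lambda>z. \<Sum>i<n. ennreal (1 - exp (- b i)) * indicator (B i) z) = (\<lambda>z. 1 - expneg (f z))"
  proof
    fix z
    show "(\<Sum>i<n. ennreal (1 - exp (- b i)) * indicator (B i) z) = 1 - expneg (f z)"
    proof (cases "\<exists>i<n. z \<in> B i")
      case True
      then obtain i where i: "i < n" "z \<in> B i" by blast
      have single: "(\<Sum>j<n. ennreal (c j) * indicator (B j) z) = ennreal (c i)" for c
      proof -
        have "(\<Sum>j<n. ennreal (c j) * indicator (B j) z) = (\<Sum>j\<in>{i}. ennreal (c j) * indicator (B j) z)"
          using i disj by (intro sum.mono_neutral_right) (auto simp: disjoint_family_on_def split: split_indicator)
        then show ?thesis using i by simp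
      qed
      show ?thesis
        unfolding f_eq single using b[OF i(1)] by (simp add: ennreal_minus flip: ennreal_1)
    next
      case False
      then have "(\<Sum>j<n. ennreal (d j) * indicator (B j) z) = 0" for d
        by (intro sum.neutral) auto
      then show ?thesis unfolding f_eq by simp
    qed
  qed
  finally show "(\<integral>\<^sup>+\<omega>. expneg (\<integral>\<^sup>+z. f z \<partial>count_space (\<Phi> \<omega>)) \<partial>M) = expneg (\<integral>\<^sup>+z. 1 - expneg (f z) \<partial>\<mu>)" .

  have "(\<integral>\<^sup>+\<omega>. (\<integral>\<^sup>+z. f z \<partial>count_space (\<Phi> \<omega>)) \<partial>M) = (\<integral>\<^sup>+\<omega>. (\<Sum>i<n. ennreal (b i) * of_nat (N i \<omega>)) \<partial>M)"
    using AE_eq by (intro nn_integral_cong_AE, eventually_elim)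
      (auto simp: b ennreal_mult' ennreal_of_nat_eq_real_of_nat intro!: sum.cong)
  also have "\<dots> = (\<Sum>i<n. ennreal (b i) * (\<integral>\<^sup>+\<omega>. of_nat (N i \<omega>) \<partial>M))"
    by (subst nn_integral_sum) (auto intro!: sum.cong nn_integral_cmult)
  also have "\<dots> = (\<Sum>i<n. ennreal (b i) * emeasure \<mu> (B i))"
    unfolding N_def by (intro sum.cong refl arg_cong2[where f="(*)"] poisson_pp_mean_count[OF pp]) (use B in auto)
  also have "\<dots> = (\<integral>\<^sup>+z. f z \<partial>\<mu>)"
    using B unfolding f_eq by (subst nn_integral_sum) (auto intro!: sum.cong simp: nn_integral_cmult_indicator)
  finally show "(\<integral>\<^sup>+\<omega>. (\<integral>\<^sup>+z. f z \<partial>count_space (\<Phi> \<omega>)) \<partial>M) = (\<integral>\<^sup>+z. f z \<partial>\<mu>)" .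
qed

text \<open>The level sets of \<open>u\<close> are the disjoint sets. Cutting with \<open>A\<close>
  is needed because a level set may have infinite measure.\<close>

lemma fin_step_simple_function:
  assumes u: "simple_function \<mu> u" "\<And>z. u z < Orderings.top" and A: "A \<in> sets \<mu>" "emeasure \<mu> A < \<infinity>"
  shows "fin_step \<mu> (\<lambda>z. u z * indicator A z)"
proof -
  have "finite (u ` space \<mu>)"
    using u by (simp add: simple_function_def)
  then obtain h where h: "bij_betw h {0..<card (u ` space \<mu>)} (u ` space \<mu>)"
    using ex_bij_betw_nat_finite by blast
  define n where "n = card (u ` space \<mu>)"
  define B where "B i = (u -` {h i} \<inter> space \<mu>) \<inter> A" for i
  have inj: "inj_on h {..<n}" and im: "h ` {..<n} = u ` space \<mu>"
    using h by (auto simp: bij_betw_def n_def atLeast0LessThan)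
  have B: "B i \<in> sets \<mu>" if "i < n" for i
    unfolding B_def using that u im A by (intro sets.Int simple_functionD) auto
  moreover have "emeasure \<mu> (B i) < \<infinity>" if "i < n" for i
    using A emeasure_mono[of "B i" A \<mu>] by (auto simp: B_def)
  moreover have "disjoint_family_on B {..<n}"
    using inj by (auto simp: disjoint_family_on_def B_def inj_on_def)
  moreover have "u z * indicator A z = (\<Sum>i<n. ennreal (enn2real (h i)) * indicator (B i) z)" for z
  proof (cases "z \<in> A")
    case True
    then have z: "z \<in> space \<mu>" using A sets.sets_into_space by blast
    then obtain i where i: "i < n" "h i = u z" using im by (metis imageE imageI lessThan_iff)
    have "(\<Sum>j<n. ennreal (enn2real (h j)) * indicator (B j) z) = (\<Sum>j\<in>{i}. ennreal (enn2real (h j)) * indicator (B j) z)"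
      using i inj by (intro sum.mono_neutral_right) (auto simp: B_def inj_on_def split: split_indicator)
    also have "\<dots> = u z * indicator A z"
      using i True z u(2)[of z] by (simp add: B_def)
    finally show ?thesis by simp
  next
    case False
    then show ?thesis by (simp add: B_def)
  qed
  ultimately show ?thesis
    unfolding fin_step_def by (intro exI[of _ n] exI[of _ "\<lambda>i. enn2real (h i)"] exI[of _ B]) (auto simp: fun_eq_iff)
qed

lemma fin_step_measurable: "fin_step \<mu> f \<Longrightarrow> f \<in> borel_measurable \<mu>"
  unfolding fin_step_def
  by (elim exE conjE, hypsubst, intro borel_measurable_sum borel_measurable_times_ennreal) auto

lemma fin_step_approx:
  fixes f :: "'b::topological_space \<Rightarrow> ennreal"
  assumes "sigma_finite_measure \<mu>" and sets: "sets \<mu> = sets borel" and f: "f \<in> borel_measurable borel"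
  obtains F where "\<And>i::nat. fin_step \<mu> (F i)" "incseq F" "\<And>z. (SUP i. F i z) = f z"
proof -
  interpret sigma_finite_measure \<mu> by fact
  obtain A :: "nat \<Rightarrow> 'b set" where A: "range A \<subseteq> sets \<mu>" "(\<Union>i. A i) = space \<mu>" "\<And>i. emeasure \<mu> (A i) \<noteq> \<infinity>" "incseq A"
    by (rule sigma_finite_incseq) blast
  have sp: "space \<mu> = UNIV" using sets_eq_imp_space_eq[OF sets] by simp
  have "f \<in> borel_measurable \<mu>" using f measurable_cong_sets[OF sets refl] by blast
  then obtain u where u: "\<And>i. simple_function \<mu> (u i)" "incseq u" "\<And>i x. u i x < Orderings.top" "\<And>x. (SUP i. u i x) = f x"
    by (rule borel_measurable_implies_simple_function_sequence') blast
  have ind: "incseq (\<lambda>i. indicator (A i) z :: ennreal)" for z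
    using A(4) by (auto simp: incseq_def le_fun_def split: split_indicator)
  show ?thesis
  proof (rule that[of "\<lambda>i z. u i z * indicator (A i) z"])
    fix i show "fin_step \<mu> (\<lambda>z. u i z * indicator (A i) z)"
      using A u by (intro fin_step_simple_function) (auto simp: less_top)
  next
    show "incseq (\<lambda>i z. u i z * indicator (A i) z)"
      using u(2) ind by (auto simp: incseq_def le_fun_def intro!: mult_mono)
  next
    fix z
    obtain k where k: "z \<in> A k" using A(2) sp by blast
    have inc: "incseq (\<lambda>i. u i z)" using u(2) by (auto simp: incseq_def le_fun_def)
    have "(SUP i. u i z * indicator (A i) z) \<ge> (SUP i. u i z)"
    proof (rule SUP_least)
      fix i
      \<comment> \<open>The index \<open>max i k\<close> meets both demands: the simple function
        there is at least \<open>u i\<close>, and the exhausting set already contains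
        \<open>z\<close>.\<close>
      have "z \<in> A (max i k)"
        using k incseqD[OF A(4), of k "max i k"] by auto
      then have "u i z \<le> u (max i k) z * indicator (A (max i k)) z"
        using incseqD[OF inc, of i "max i k"] by simp
      then show "u i z \<le> (SUP i. u i z * indicator (A i) z)"
        by (rule SUP_upper2[rotated]) simp
    qed
    moreover have "(SUP i. u i z * indicator (A i) z) \<le> (SUP i. u i z)"
      by (intro SUP_mono) (auto split: split_indicator)
    ultimately show "(SUP i. u i z * indicator (A i) z) = f z"
      using u(4) by (metis order_antisym)
  qed
qed

text \<open>Limit along increasing step functions. The integrals inside \<open>expneg\<close>
  increase, so the left side decreases and is handled by dominated convergence with bound 1; on the
  right \<open>1 - expneg\<close> increases and monotone convergence applies.\<close>

lemma
  fixes f :: "'b::topological_space \<Rightarrow> ennreal"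
  assumes pp: "poisson_pp M \<mu> \<Phi>" and "sigma_finite_measure \<mu>" and sets: "sets \<mu> = sets borel"
    and \<Phi>: "\<Phi> \<in> measurable M (pp_space borel)" and f: "f \<in> borel_measurable borel"
  shows poisson_pp_laplace: "(\<integral>\<^sup>+\<omega>. expneg (\<integral>\<^sup>+z. f z \<partial>count_space (\<Phi> \<omega>)) \<partial>M) = expneg (\<integral>\<^sup>+z. 1 - expneg (f z) \<partial>\<mu>)"
    and poisson_pp_campbell: "(\<integral>\<^sup>+\<omega>. (\<integral>\<^sup>+z. f z \<partial>count_space (\<Phi> \<omega>)) \<partial>M) = (\<integral>\<^sup>+z. f z \<partial>\<mu>)"
proof -
  interpret prob_space M using pp by (rule poisson_pp_prob_space)
  obtain F where F: "\<And>i::nat. fin_step \<mu> (F i)" "incseq F" "\<And>z. (SUP i. F i z) = f z"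
    using fin_step_approx[OF assms(2) sets f] by blast
  have incF: "incseq (\<lambda>i. F i z)" for z using F(2) by (auto simp: incseq_def le_fun_def)
  have [measurable]: "F i \<in> borel_measurable borel" for i
    using fin_step_measurable[OF F(1)] measurable_cong_sets[OF sets refl] by blast
  have [measurable]: "F i \<in> borel_measurable \<mu>" for i
    using fin_step_measurable[OF F(1)] .
  have meas: "(\<lambda>\<omega>. \<integral>\<^sup>+z. F i z \<partial>count_space (\<Phi> \<omega>)) \<in> borel_measurable M" for i
    by (rule measurable_compose[OF \<Phi> measurable_nn_integral_pp_space]) measurable
  have meas': "(\<lambda>\<omega>. \<integral>\<^sup>+z. f z \<partial>count_space (\<Phi> \<omega>)) \<in> borel_measurable M"
    by (rule measurable_compose[OF \<Phi> measurable_nn_integral_pp_space[OF f]])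
  define J where "J i \<omega> = (\<integral>\<^sup>+z. F i z \<partial>count_space (\<Phi> \<omega>))" for i \<omega>
  have incJ: "incseq (\<lambda>i. J i \<omega>)" for \<omega>
    unfolding J_def using F(2) by (auto simp: incseq_def le_fun_def intro!: nn_integral_mono)
  have SUPJ: "(SUP i. J i \<omega>) = (\<integral>\<^sup>+z. f z \<partial>count_space (\<Phi> \<omega>))" for \<omega>
    unfolding J_def F(3)[symmetric] using F(2) by (subst nn_integral_monotone_convergence_SUP) auto

  have "(\<lambda>i. \<integral>\<^sup>+\<omega>. expneg (J i \<omega>) \<partial>M) \<longlonglongrightarrow> (\<integral>\<^sup>+\<omega>. expneg (\<integral>\<^sup>+z. f z \<partial>count_space (\<Phi> \<omega>)) \<partial>M)"
  proof (rule nn_integral_dominated_convergence[where w="\<lambda>_. 1"])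
    show "AE \<omega> in M. (\<lambda>i. expneg (J i \<omega>)) \<longlonglongrightarrow> expneg (\<integral>\<^sup>+z. f z \<partial>count_space (\<Phi> \<omega>))"
      using tendsto_expneg_incseq[OF incJ] by (simp add: SUPJ)
  qed (use meas meas' in \<open>auto simp: J_def expneg_le_1 emeasure_space_1 intro!: measurable_compose[OF _ borel_measurable_expneg]\<close>)
  moreover have "(\<lambda>i. \<integral>\<^sup>+\<omega>. expneg (J i \<omega>) \<partial>M) \<longlonglongrightarrow> expneg (\<integral>\<^sup>+z. 1 - expneg (f z) \<partial>\<mu>)"
  proof -
    have inc: "incseq (\<lambda>i z. 1 - expneg (F i z))"
      using F(2) by (auto simp: incseq_def le_fun_def intro!: ennreal_mono_minus expneg_antimono)
    have lim: "(\<lambda>i. 1 - expneg (F i z)) \<longlonglongrightarrow> 1 - expneg (f z)" for z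
      using tendsto_expneg_incseq[OF incF[of z]] unfolding F(3)
      using expneg_le_1[of "f z"] by (intro tendsto_diff_ennreal tendsto_const) (auto simp: top_unique)
    have incI: "incseq (\<lambda>i. \<integral>\<^sup>+z. 1 - expneg (F i z) \<partial>\<mu>)"
      using inc by (auto simp: incseq_def le_fun_def intro!: nn_integral_mono)
    have "(\<lambda>i. \<integral>\<^sup>+z. 1 - expneg (F i z) \<partial>\<mu>) \<longlonglongrightarrow> (\<integral>\<^sup>+z. 1 - expneg (f z) \<partial>\<mu>)"
      by (rule nn_integral_LIMSEQ[OF inc _ lim]) measurable
    then have "(SUP i. \<integral>\<^sup>+z. 1 - expneg (F i z) \<partial>\<mu>) = (\<integral>\<^sup>+z. 1 - expneg (f z) \<partial>\<mu>)"
      using LIMSEQ_SUP[OF incI] by (rule LIMSEQ_unique[rotated])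
    then show ?thesis
      using tendsto_expneg_incseq[OF incI] unfolding J_def poisson_pp_laplace_step[OF pp F(1)] by simp
  qed
  ultimately show "(\<integral>\<^sup>+\<omega>. expneg (\<integral>\<^sup>+z. f z \<partial>count_space (\<Phi> \<omega>)) \<partial>M) = expneg (\<integral>\<^sup>+z. 1 - expneg (f z) \<partial>\<mu>)"
    by (rule LIMSEQ_unique)

  have "(\<integral>\<^sup>+\<omega>. (\<integral>\<^sup>+z. f z \<partial>count_space (\<Phi> \<omega>)) \<partial>M) = (SUP i. \<integral>\<^sup>+\<omega>. J i \<omega> \<partial>M)"
    unfolding SUPJ[symmetric] using incJ meas
    by (intro nn_integral_monotone_convergence_SUP) (auto simp: incseq_def le_fun_def J_def)
  also have "\<dots> = (SUP i. \<integral>\<^sup>+z. F i z \<partial>\<mu>)"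
    unfolding J_def poisson_pp_campbell_step[OF pp F(1)] ..
  also have "\<dots> = (\<integral>\<^sup>+z. f z \<partial>\<mu>)"
    unfolding F(3)[symmetric] using F(2) by (intro nn_integral_monotone_convergence_SUP[symmetric]) auto
  finally show "(\<integral>\<^sup>+\<omega>. (\<integral>\<^sup>+z. f z \<partial>count_space (\<Phi> \<omega>)) \<partial>M) = (\<integral>\<^sup>+z. f z \<partial>\<mu>)" .
qed

section \<open>Mixed Poisson weights and generating functions\<close>

text \<open>The weight at \<open>m\<close> of the Poisson law with mean \<open>x\<close>; the value
  0 at \<open>\<infinity>\<close> is its limit.\<close>

definition poisw :: "nat \<Rightarrow> ennreal \<Rightarrow> ennreal" where
  "poisw m x = (if x = \<infinity> then 0 else ennreal (exp (- enn2real x) * enn2real x ^ m / fact m))"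

lemma poisw_ennreal: "0 \<le> x \<Longrightarrow> poisw m (ennreal x) = ennreal (exp (- x) * x ^ m / fact m)"
  by (simp add: poisw_def)

lemma borel_measurable_poisw [measurable]: "poisw m \<in> borel_measurable borel"
  unfolding poisw_def by measurable

lemma poisw_0: "poisw 0 = expneg"
  by (auto simp: poisw_def expneg_def)

text \<open>Generating function of the Poisson law. The condition \<open>t < 1\<close> keeps
  \<open>ennreal (1 - t) * \<infinity>\<close> infinite, in agreement with all weights being 0
  there.\<close>

lemma suminf_poisw:
  assumes t: "0 \<le> t" "t < 1"
  shows "(\<Sum>m. ennreal (t ^ m) * poisw m x) = expneg (ennreal (1 - t) * x)"
proof (cases x)
  case (real r)
  have "(\<lambda>m. exp (- r) * ((t * r) ^ m /\<^sub>R fact m)) sums (exp (- r) * exp (t * r))"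
    by (intro sums_mult exp_converges)
  moreover have "exp (- r) * ((t * r) ^ m /\<^sub>R fact m) = t ^ m * (exp (- r) * r ^ m / fact m)" for m
    by (simp add: field_simps power_mult_distrib)
  moreover have "exp (- r) * exp (t * r) = exp (- ((1 - t) * r))"
    by (simp add: algebra_simps flip: exp_add)
  ultimately have "(\<lambda>m. t ^ m * (exp (- r) * r ^ m / fact m)) sums exp (- ((1 - t) * r))"
    by (simp only:)
  then have "(\<Sum>m. ennreal (t ^ m * (exp (- r) * r ^ m / fact m))) = ennreal (exp (- ((1 - t) * r)))"
    using t real by (intro suminf_ennreal_eq) auto
  moreover have "ennreal (t ^ m) * poisw m x = ennreal (t ^ m * (exp (- r) * r ^ m / fact m))" for m
    unfolding real using t real by (simp add: poisw_ennreal flip: ennreal_mult)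
  moreover have "expneg (ennreal (1 - t) * x) = ennreal (exp (- ((1 - t) * r)))"
    unfolding real using t real by (simp flip: ennreal_mult)
  ultimately show ?thesis by simp
next
  case top
  then show ?thesis using t by (simp add: poisw_def ennreal_mult_top)
qed

text \<open>The coefficient of \<open>t ^ m\<close> in the i-th power of the series with terms
  \<open>c n * t ^ n\<close> for \<open>n \<ge> 1\<close>. The bound \<open>q < m\<close> is strict,
  so \<open>c 0\<close> never enters.\<close>

primrec conv_coeff :: "(nat \<Rightarrow> real) \<Rightarrow> nat \<Rightarrow> nat \<Rightarrow> real" where
  "conv_coeff c 0 = (\<lambda>m. if m = 0 then 1 else 0)"
| "conv_coeff c (Suc i) = (\<lambda>m. \<Sum>q<m. c (m - q) * conv_coeff c i q)"

lemma conv_coeff_nonneg: "(\<And>n. 0 < n \<Longrightarrow> 0 \<le> c n) \<Longrightarrow> 0 \<le> conv_coeff c i m"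
  by (induction i arbitrary: m) (auto intro!: sum_nonneg)

lemma conv_coeff_eq_0: "m < i \<Longrightarrow> conv_coeff c i m = 0"
  by (induction i arbitrary: m) (auto intro!: sum.neutral)

lemma conv_coeff_cmult: "conv_coeff (\<lambda>n. a * c n) i m = a ^ i * conv_coeff c i m"
  by (induction i arbitrary: m) (auto simp: sum_distrib_left ac_simps)

lemma conv_coeff_sums:
  assumes c: "\<And>n. 0 \<le> c n" and t: "0 \<le> t"
    and C: "(\<lambda>n. c (Suc n) * t ^ Suc n) sums C"
  shows "(\<lambda>m. conv_coeff c i m * t ^ m) sums (C ^ i)"
proof (induction i)
  case 0
  have "(\<lambda>m. conv_coeff c 0 m * t ^ m) sums (\<Sum>m\<in>{0}. conv_coeff c 0 m * t ^ m)"
    by (intro sums_finite) auto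
  then show ?case by simp
next
  case (Suc i)
  \<comment> \<open>Clearing the constant term turns the strict sum of the recursion into a full
    Cauchy product.\<close>
  define c' where "c' n = (if n = 0 then 0 else c n)" for n
  have C': "(\<lambda>n. c' n * t ^ n) sums C"
    using C sums_Suc_iff[of "\<lambda>n. c' n * t ^ n" C] by (simp add: c'_def)
  have "(\<lambda>m. \<Sum>q\<le>m. (conv_coeff c i q * t ^ q) * (c' (m - q) * t ^ (m - q))) sums
     ((\<Sum>m. conv_coeff c i m * t ^ m) * (\<Sum>m. c' m * t ^ m))"
  proof (rule Cauchy_product_sums)
    show "summable (\<lambda>k. norm (conv_coeff c i k * t ^ k))"
      using Suc t conv_coeff_nonneg[of c i] c by (simp add: sums_iff abs_mult)
    show "summable (\<lambda>k. norm (c' k * t ^ k))"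
      using C' t c by (simp add: sums_iff c'_def abs_mult if_distrib cong: if_cong)
  qed
  also have "((\<Sum>m. conv_coeff c i m * t ^ m) * (\<Sum>m. c' m * t ^ m)) = C ^ Suc i"
    using Suc C' by (simp add: sums_iff)
  also have "(\<lambda>m. \<Sum>q\<le>m. (conv_coeff c i q * t ^ q) * (c' (m - q) * t ^ (m - q))) = (\<lambda>m. conv_coeff c (Suc i) m * t ^ m)"
  proof
    fix m
    have "(\<Sum>q\<le>m. (conv_coeff c i q * t ^ q) * (c' (m - q) * t ^ (m - q))) = (\<Sum>q\<le>m. c' (m - q) * conv_coeff c i q * t ^ m)"
      by (intro sum.cong refl) (auto simp: ac_simps simp flip: power_add)
    also have "\<dots> = (\<Sum>q<m. c' (m - q) * conv_coeff c i q * t ^ m)"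
      by (intro sum.mono_neutral_right) (auto simp: c'_def)
    also have "\<dots> = conv_coeff c (Suc i) m * t ^ m"
      by (simp add: c'_def sum_distrib_right)
    finally show "(\<Sum>q\<le>m. (conv_coeff c i q * t ^ q) * (c' (m - q) * t ^ (m - q))) = conv_coeff c (Suc i) m * t ^ m" .
  qed
  finally show ?case .
qed

text \<open>The coefficient of \<open>t ^ m\<close> in the exponential of the same series. The i-th
  power starts at degree \<open>i\<close>, so stopping at \<open>i = m\<close> loses
  nothing.\<close>

definition exp_coeff :: "(nat \<Rightarrow> real) \<Rightarrow> nat \<Rightarrow> real" where
  "exp_coeff c m = (\<Sum>i\<le>m. conv_coeff c i m / fact i)"

lemma exp_coeff_nonneg: "(\<And>n. 0 \<le> c n) \<Longrightarrow> 0 \<le> exp_coeff c m"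
  unfolding exp_coeff_def by (intro sum_nonneg divide_nonneg_nonneg conv_coeff_nonneg) auto

lemma suminf_ennreal_swap:
  fixes f :: "nat \<Rightarrow> nat \<Rightarrow> ennreal"
  shows "(\<Sum>i. \<Sum>m. f i m) = (\<Sum>m. \<Sum>i. f i m)"
  using nn_integral_suminf[of f "count_space UNIV"] by (simp add: nn_integral_count_space_nat)

text \<open>All terms are nonnegative, so the sums over powers and over degrees may be exchanged in
  \<open>ennreal\<close> without a convergence condition.\<close>

lemma suminf_exp_coeff:
  assumes c: "\<And>n. 0 \<le> c n" and t: "0 \<le> t"
    and C: "(\<lambda>n. c (Suc n) * t ^ Suc n) sums C"
  shows "(\<Sum>m. ennreal (exp_coeff c m * t ^ m)) = ennreal (exp C)"
proof -
  have C0: "0 \<le> C"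
    using C c t by (intro sums_le[OF _ sums_zero C]) auto
  have nn: "0 \<le> conv_coeff c i m" for i m
    using c by (intro conv_coeff_nonneg)
  have "(\<Sum>m. ennreal (exp_coeff c m * t ^ m)) = (\<Sum>m. \<Sum>i. ennreal (conv_coeff c i m * t ^ m / fact i))"
  proof (intro suminf_cong)
    fix m
    have "(\<Sum>i. ennreal (conv_coeff c i m * t ^ m / fact i)) = (\<Sum>i\<le>m. ennreal (conv_coeff c i m * t ^ m / fact i))"
      by (intro suminf_finite) (auto simp: conv_coeff_eq_0)
    also have "\<dots> = ennreal (\<Sum>i\<le>m. conv_coeff c i m * t ^ m / fact i)"
      using nn t by (intro sum_ennreal) auto
    also have "(\<Sum>i\<le>m. conv_coeff c i m * t ^ m / fact i) = exp_coeff c m * t ^ m"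
      by (simp add: exp_coeff_def sum_distrib_right)
    finally show "ennreal (exp_coeff c m * t ^ m) = (\<Sum>i. ennreal (conv_coeff c i m * t ^ m / fact i))" ..
  qed
  also have "\<dots> = (\<Sum>i. \<Sum>m. ennreal (conv_coeff c i m * t ^ m / fact i))"
    by (rule suminf_ennreal_swap[symmetric])
  also have "\<dots> = (\<Sum>i. ennreal (C ^ i / fact i))"
  proof (intro suminf_cong suminf_ennreal_eq)
    fix i show "(\<lambda>m. conv_coeff c i m * t ^ m / fact i) sums (C ^ i / fact i)"
      using conv_coeff_sums[OF assms] by (intro sums_divide)
  qed (use nn t in auto)
  also have "\<dots> = ennreal (exp C)"
    using exp_converges[of C] C0 by (intro suminf_ennreal_eq) (auto simp: field_simps)
  finally show ?thesis .
qed

text \<open>Equality is assumed only to the right of 0, but finiteness there gives absolute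
  convergence for all \<open>t\<close> of modulus below 1. If a coefficient differed, 0 would be an
  isolated zero of the difference, which vanishing on \<open>[0, 1)\<close> excludes.\<close>

lemma power_series_unique:
  fixes a b :: "nat \<Rightarrow> real"
  assumes nonneg: "\<And>m. 0 \<le> a m" "\<And>m. 0 \<le> b m"
    and fin: "\<And>t. 0 \<le> t \<Longrightarrow> t < 1 \<Longrightarrow> (\<Sum>m. ennreal (a m * t ^ m)) < \<infinity>"
    and eq: "\<And>t. 0 \<le> t \<Longrightarrow> t < 1 \<Longrightarrow> (\<Sum>m. ennreal (a m * t ^ m)) = (\<Sum>m. ennreal (b m * t ^ m))"
  shows "a m = b m"
proof -
  have sm: "summable (\<lambda>m. d m * t ^ m)" if d: "d = a \<or> d = b" and t: "\<bar>t\<bar> < 1" for d t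
  proof (rule summable_norm_cancel)
    have "(\<Sum>m. ennreal (d m * \<bar>t\<bar> ^ m)) < \<infinity>"
      using fin[of "\<bar>t\<bar>"] eq[of "\<bar>t\<bar>"] t d by auto
    then have "summable (\<lambda>m. d m * \<bar>t\<bar> ^ m)"
      using nonneg d by (intro summable_suminf_not_top) auto
    then show "summable (\<lambda>m. norm (d m * t ^ m))"
      using nonneg d by (auto simp: abs_mult power_abs)
  qed
  define f where "f t = (\<Sum>m. (a m - b m) * t ^ m)" for t
  have f0: "f t = 0" if "0 \<le> t" "t < 1" for t
  proof -
    have "ennreal (\<Sum>m. a m * t ^ m) = ennreal (\<Sum>m. b m * t ^ m)"
      using eq[OF that] sm[of a t] sm[of b t] that nonneg by (simp add: suminf_ennreal2)
    moreover have "0 \<le> (\<Sum>m. a m * t ^ m)" "0 \<le> (\<Sum>m. b m * t ^ m)"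
      using sm[of a t] sm[of b t] that nonneg by (auto intro!: suminf_nonneg)
    ultimately have "(\<Sum>m. a m * t ^ m) = (\<Sum>m. b m * t ^ m)" by simp
    then show ?thesis
      using suminf_diff[of "\<lambda>m. a m * t ^ m" "\<lambda>m. b m * t ^ m"] sm[of a t] sm[of b t] that
      by (simp add: f_def left_diff_distrib)
  qed
  have sums: "(\<lambda>m. (a m - b m) * (t - 0) ^ m) sums f t" if "norm (t - 0) < 1" for t
    using summable_diff[OF sm[of a t] sm[of b t]] that
    by (simp add: f_def left_diff_distrib summable_sums)
  show ?thesis
  \<comment> \<open>Isolation of zeros is invoked for a nonzero coefficient of positive index, so
    the constant term is read off at 0 instead.\<close>
  proof (cases "m = 0")
    case True
    then show ?thesis
      using f0[of 0] powser_zero[of "\<lambda>m. a m - b m"] by (simp add: f_def)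
  next
    case False
    show ?thesis
    proof (rule ccontr)
      assume "a m \<noteq> b m"
      then obtain s where s: "0 < s" "\<And>z. z \<in> cball 0 s - {0} \<Longrightarrow> f z \<noteq> 0"
        using powser_0_nonzero[of 1 0 "\<lambda>m. a m - b m" f m] sums f0[of 0] False by auto
      have "f (min s (1/2)) \<noteq> 0"
        using s by (intro s(2)) auto
      then show False
        using f0[of "min s (1/2)"] s by auto
    qed
  qed
qed

text \<open>Comparing coefficients of power series in \<open>t\<close> replaces differentiating the
  Laplace transform \<open>m\<close> times.\<close>
lemma nn_integral_poisw_from_laplace:
  assumes "prob_space M" and J: "J \<in> borel_measurable M"
    and c: "\<And>n. 0 \<le> c n"
    and lap: "\<And>t. 0 \<le> t \<Longrightarrow> t < 1 \<Longrightarrow> \<exists>C. (\<lambda>n. c (Suc n) * t ^ Suc n) sums C \<and>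
       (\<integral>\<^sup>+\<omega>. expneg (ennreal (1 - t) * J \<omega>) \<partial>M) = ennreal (exp (C - c 0))"
  shows "(\<integral>\<^sup>+\<omega>. poisw m (J \<omega>) \<partial>M) = ennreal (exp (- c 0) * exp_coeff c m)"
proof -
  interpret prob_space M by fact
  note J[measurable]
  define a where "a m = (\<integral>\<^sup>+\<omega>. poisw m (J \<omega>) \<partial>M)" for m
  have gen: "(\<Sum>m. ennreal (t ^ m) * a m) = (\<Sum>m. ennreal (exp (- c 0) * exp_coeff c m * t ^ m))"
    "(\<Sum>m. ennreal (t ^ m) * a m) < \<infinity>" if t: "0 \<le> t" "t < 1" for t
  proof -
    obtain C where C: "(\<lambda>n. c (Suc n) * t ^ Suc n) sums C"
       "(\<integral>\<^sup>+\<omega>. expneg (ennreal (1 - t) * J \<omega>) \<partial>M) = ennreal (exp (C - c 0))"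
      using lap[OF t] by blast
    have "(\<Sum>m. ennreal (t ^ m) * a m) = (\<Sum>m. \<integral>\<^sup>+\<omega>. ennreal (t ^ m) * poisw m (J \<omega>) \<partial>M)"
      unfolding a_def by (intro suminf_cong nn_integral_cmult[symmetric]) measurable
    also have "\<dots> = (\<integral>\<^sup>+\<omega>. (\<Sum>m. ennreal (t ^ m) * poisw m (J \<omega>)) \<partial>M)"
      by (intro nn_integral_suminf[symmetric]) measurable
    also have "\<dots> = ennreal (exp (C - c 0))"
      unfolding suminf_poisw[OF t] C(2) ..
    finally have 1: "(\<Sum>m. ennreal (t ^ m) * a m) = ennreal (exp (C - c 0))" .
    have "ennreal (exp (C - c 0)) = ennreal (exp (- c 0)) * ennreal (exp C)"
      by (simp add: exp_diff exp_minus field_simps flip: ennreal_mult)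
    also have "\<dots> = (\<Sum>m. ennreal (exp (- c 0)) * ennreal (exp_coeff c m * t ^ m))"
      unfolding suminf_exp_coeff[OF c t(1) C(1), symmetric] by (rule ennreal_suminf_cmult[symmetric])
    also have "\<dots> = (\<Sum>m. ennreal (exp (- c 0) * exp_coeff c m * t ^ m))"
      using exp_coeff_nonneg[of c] c t by (intro suminf_cong) (simp add: ac_simps flip: ennreal_mult)
    finally show "(\<Sum>m. ennreal (t ^ m) * a m) = (\<Sum>m. ennreal (exp (- c 0) * exp_coeff c m * t ^ m))"
      using 1 by simp
    show "(\<Sum>m. ennreal (t ^ m) * a m) < \<infinity>" using 1 by simp
  qed
  have fin: "a m < Orderings.top" for m
  proof -
    have "ennreal ((1/2) ^ m) * a m \<le> (\<Sum>m. ennreal ((1/2) ^ m) * a m)"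
      using sum_le_suminf[of "\<lambda>m. ennreal ((1/2) ^ m) * a m" "{m}"] by simp
    also have "\<dots> < Orderings.top" using gen(2)[of "1/2"] by simp
    finally show ?thesis
      by (auto simp: ennreal_mult_less_top ennreal_zero_less_one)
  qed
  have a_eq: "a m = ennreal (enn2real (a m))" for m
    using fin by simp
  have "ennreal (t ^ m) * a m = ennreal (enn2real (a m) * t ^ m)" if "0 \<le> t" for t m
    by (subst a_eq) (use that in \<open>simp add: mult.commute flip: ennreal_mult\<close>)
  then have "enn2real (a m) = exp (- c 0) * exp_coeff c m"
    using gen exp_coeff_nonneg[of c] c by (intro power_series_unique) auto
  then show ?thesis
    using a_eq[of m] by (simp add: a_def)
qed

section \<open>Powers of Toeplitz matrices\<close>

lemma toeplitz_lt_carrier [simp]: "toeplitz_lt m c \<in> carrier_mat m m"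
  by (simp add: toeplitz_lt_def)

lemma dim_toeplitz_lt [simp]: "dim_row (toeplitz_lt m c) = m" "dim_col (toeplitz_lt m c) = m"
  by (simp_all add: toeplitz_lt_def)

text \<open>Multiplying lower triangular Toeplitz matrices convolves their first columns, so a power
  of the matrix holds the truncated power of the series.\<close>

lemma toeplitz_lt_pow_index:
  assumes "p < N" "q < N"
  shows "(toeplitz_lt N c ^\<^sub>m i) $$ (p, q) = (if q \<le> p then conv_coeff c i (p - q) else 0)"
  using assms
proof (induction i arbitrary: p q)
  case 0
  then show ?case by (auto simp: toeplitz_lt_def)
next
  case (Suc i)
  have car: "toeplitz_lt N c ^\<^sub>m i \<in> carrier_mat N N" by (intro pow_carrier_mat) simp
  have "(toeplitz_lt N c ^\<^sub>m Suc i) $$ (p, q) = (\<Sum>r<N. (toeplitz_lt N c ^\<^sub>m i) $$ (p, r) * toeplitz_lt N c $$ (r, q))"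
    using car Suc.prems by (auto simp: scalar_prod_def atLeast0LessThan intro!: sum.cong)
  also have "\<dots> = (\<Sum>r<N. (if r \<le> p then conv_coeff c i (p - r) else 0) * (if q < r then c (r - q) else 0))"
    using Suc by (intro sum.cong refl arg_cong2[where f="(*)"]) (auto simp: toeplitz_lt_def)
  also have "\<dots> = (\<Sum>r\<in>{q<..p}. conv_coeff c i (p - r) * c (r - q))"
    using Suc.prems by (intro sum.mono_neutral_cong_right) auto
  also have "\<dots> = (if q \<le> p then conv_coeff c (Suc i) (p - q) else 0)"
  proof (cases "q \<le> p")
    case True
    then show ?thesis
      by (auto intro!: sum.reindex_bij_witness[of _ "\<lambda>u. p - u" "\<lambda>r. p - r"] simp: algebra_simps)
  qed auto
  finally show ?case .
qed

text \<open>Column \<open>q\<close> is the first column shifted down by \<open>q\<close> and cut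
  off. The entries are nonnegative, so column 0 has the largest sum; this turns the sum over
  \<open>m\<close> in the first outage formula into the norm in the second.\<close>

lemma mat_norm1_toeplitz_lt_pow:
  assumes "0 < N" and c: "\<And>n. 0 \<le> c n"
  shows "mat_norm1 (toeplitz_lt N c ^\<^sub>m i) = (\<Sum>m<N. conv_coeff c i m)"
proof -
  have car: "toeplitz_lt N c ^\<^sub>m i \<in> carrier_mat N N" by (intro pow_carrier_mat) simp
  have nn: "0 \<le> conv_coeff c i m" for m using c by (intro conv_coeff_nonneg)
  have col: "(\<Sum>p<N. \<bar>(toeplitz_lt N c ^\<^sub>m i) $$ (p, q)\<bar>) = (\<Sum>m<N - q. conv_coeff c i m)" if "q < N" for q
  proof -
    have "(\<Sum>p<N. \<bar>(toeplitz_lt N c ^\<^sub>m i) $$ (p, q)\<bar>) = (\<Sum>p<N. if q \<le> p then conv_coeff c i (p - q) else 0)"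
      using that nn by (intro sum.cong) (auto simp: toeplitz_lt_pow_index)
    also have "\<dots> = (\<Sum>p\<in>{q..<N}. conv_coeff c i (p - q))"
      by (intro sum.mono_neutral_cong_right) auto
    also have "\<dots> = (\<Sum>m<N - q. conv_coeff c i m)"
      by (intro sum.reindex_bij_witness[of _ "\<lambda>m. m + q" "\<lambda>p. p - q"]) auto
    finally show ?thesis .
  qed
  have "mat_norm1 (toeplitz_lt N c ^\<^sub>m i) = Max ((\<lambda>q. \<Sum>m<N - q. conv_coeff c i m) ` {..<N})"
    unfolding mat_norm1_def carrier_matD(1)[OF car] carrier_matD(2)[OF car] setcompr_eq_image
    by (intro arg_cong[where f=Max] image_cong) (auto simp: col)
  also have "\<dots> = (\<Sum>m<N. conv_coeff c i m)"
  proof (rule Max_eqI)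
    fix y assume "y \<in> (\<lambda>q. \<Sum>m<N - q. conv_coeff c i m) ` {..<N}"
    then show "y \<le> (\<Sum>m<N. conv_coeff c i m)"
      using nn by (auto intro!: sum_mono2)
  next
    show "(\<Sum>m<N. conv_coeff c i m) \<in> (\<lambda>q. \<Sum>m<N - q. conv_coeff c i m) ` {..<N}"
      using assms by (intro image_eqI[of _ _ 0]) auto
  qed auto
  finally show ?thesis .
qed

section \<open>Intensity integrals\<close>

lemma emeasure_annulus:
  fixes r s :: real
  assumes "0 < r" "r < s"
  shows "emeasure lborel {y :: real \<times> real. r < norm y \<and> norm y < s} = ennreal (pi * (s\<^sup>2 - r\<^sup>2))"
proof -
  have "{y :: real \<times> real. r < norm y \<and> norm y < s} = ball 0 s - cball 0 r"
    by (rule Set.set_eqI, unfold mem_Collect_eq Diff_iff mem_ball_0 mem_cball_0 not_le) blast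
  moreover have "emeasure lborel (ball 0 s - cball (0::real \<times> real) r)
      = emeasure lborel (ball (0::real \<times> real) s) - emeasure lborel (cball (0::real \<times> real) r)"
    using assms by (intro emeasure_Diff) (auto simp: emeasure_cball)
  ultimately show ?thesis
    using assms by (simp add: emeasure_ball emeasure_cball ennreal_minus right_diff_distrib unit_ball_vol_2 power2_eq_square)
qed

lemma nn_integral_powr_open_interval:
  fixes b \<delta> c :: real
  assumes b: "0 < b" "b < 1" and "0 < \<delta>" "0 \<le> c"
  shows "(\<integral>\<^sup>+q. ennreal (c * \<delta> * q powr (- \<delta> - 1)) * indicator {b<..<1} q \<partial>lborel)
    = ennreal (c * (b powr (- \<delta>) - 1))"
proof -
  have "(\<integral>\<^sup>+q. ennreal (c * \<delta> * q powr (- \<delta> - 1)) * indicator {b<..<1} q \<partial>lborel)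
      = (\<integral>\<^sup>+q. ennreal (c * \<delta> * q powr (- \<delta> - 1)) * indicator {b..1} q \<partial>lborel)"
    using AE_lborel_singleton[of b] AE_lborel_singleton[of 1]
    by (intro nn_integral_cong_AE, eventually_elim) (auto split: split_indicator)
  also have "\<dots> = ennreal ((- c * 1 powr (- \<delta>)) - (- c * b powr (- \<delta>)))"
  proof (rule nn_integral_FTC_Icc)
    fix q assume "q \<in> {b..1}"
    then show "((\<lambda>q. - c * q powr (- \<delta>)) has_real_derivative (c * \<delta> * q powr (- \<delta> - 1))) (at q)"
      using b by (auto intro!: derivative_eq_intros simp: field_simps)
  qed (use assms in auto)
  finally show ?thesis by (simp add: algebra_simps)
qed

text \<open>Two measures on the line agree once their tails \<open>{a<..}\<close> agree and are
  finite, and here the tails are areas of annuli. The density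
  \<open>s powr (- (2 / \<alpha>) - 1)\<close> is not integrable at 0; the cut at \<open>e\<close>
  makes the tails finite.\<close>

lemma nn_integral_radial_truncated:
  fixes r \<alpha> e :: real and \<phi> :: "real \<Rightarrow> ennreal"
  defines "q \<equiv> (\<lambda>y :: real \<times> real. (norm y / r) powr (- \<alpha>))"
  assumes r: "0 < r" and \<alpha>: "0 < \<alpha>" and e: "0 < e" "e < 1" and \<phi>[measurable]: "\<phi> \<in> borel_measurable borel"
  shows "(\<integral>\<^sup>+y. \<phi> (q y) * indicator {y. r < norm y \<and> e < q y} y \<partial>lborel) =
    (\<integral>\<^sup>+s. \<phi> s * ennreal (pi * r\<^sup>2 * (2 / \<alpha>) * s powr (- (2 / \<alpha>) - 1)) * indicator {e<..<1} s \<partial>lborel)"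
proof -
  have q[measurable]: "q \<in> borel_measurable borel" unfolding q_def by measurable
  define \<nu> where "\<nu> = distr (density lborel (indicator {y. r < norm y \<and> e < q y})) borel q"
  define D where "D s = ennreal (pi * r\<^sup>2 * (2 / \<alpha>) * s powr (- (2 / \<alpha>) - 1)) * indicator {e<..<1} s" for s
  have D[measurable]: "D \<in> borel_measurable borel" unfolding D_def by measurable
  have tail: "emeasure \<nu> {a<..} = (if max a e < 1 then ennreal (pi * r\<^sup>2 * (max a e powr (- (2 / \<alpha>)) - 1)) else 0)" for a
  proof -
    define b where "b = max a e"
    have b: "0 < b" using e by (simp add: b_def)
    have "emeasure \<nu> {a<..} = emeasure (density lborel (indicator {y. r < norm y \<and> e < q y})) (q -` {a<..})"
      unfolding \<nu>_def by (subst emeasure_distr) auto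
    also have "\<dots> = (\<integral>\<^sup>+y. indicator {y. r < norm y \<and> e < q y} y * indicator (q -` {a<..}) y \<partial>lborel)"
      using measurable_sets[OF q, of "{a<..}"] by (subst emeasure_density) auto
    also have "\<dots> = (\<integral>\<^sup>+y. indicator {y. r < norm y \<and> b < q y} y \<partial>lborel)"
      by (intro nn_integral_cong) (auto simp: b_def split: split_indicator)
    also have "\<dots> = emeasure lborel {y. r < norm y \<and> b < q y}"
      by (intro nn_integral_indicator) measurable
    finally have 1: "emeasure \<nu> {a<..} = emeasure lborel {y. r < norm y \<and> b < q y}" .
    \<comment> \<open>\<open>q\<close> decreases as the norm grows, so a lower bound on
      \<open>q\<close> is an upper bound on the norm.\<close>
    have iff: "b < q y \<longleftrightarrow> norm y < r * b powr (- (1 / \<alpha>))" if "r < norm y" for y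
    proof -
      have n: "0 < norm y / r" using that r by (simp del: zero_less_norm_iff)
      have "0 < q y" unfolding q_def powr_gt_zero using n by (metis less_irrefl)
      then have "b < q y \<longleftrightarrow> (q y) powr (- (1 / \<alpha>)) < b powr (- (1 / \<alpha>))"
        using b \<alpha> powr_less_mono2_neg[of "- (1 / \<alpha>)" b "q y"] powr_less_mono2_neg[of "- (1 / \<alpha>)" "q y" b]
        by (cases "b = q y"; cases "b < q y") auto
      also have "(q y) powr (- (1 / \<alpha>)) = norm y / r"
        using n r \<alpha> by (simp add: q_def powr_powr)
      finally show ?thesis using r by (simp add: field_simps)
    qed
    show ?thesis
    proof (cases "b < 1")
      case True
      have gt: "r < r * b powr (- (1 / \<alpha>))"
        using r \<alpha> True b powr_less_mono2[of "1 / \<alpha>" b 1] by (simp add: powr_minus one_less_inverse_iff)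
      have "{y. r < norm y \<and> b < q y} = {y. r < norm y \<and> norm y < r * b powr (- (1 / \<alpha>))}"
        using iff by auto
      then show ?thesis
        using 1 True b emeasure_annulus[OF r gt]
        by (simp add: b_def[symmetric] power_mult_distrib algebra_simps powr_powr flip: powr_realpow)
    next
      case False
      have "b powr (- (1 / \<alpha>)) \<le> 1"
        using False \<alpha> by (simp add: powr_minus inverse_le_1_iff ge_one_powr_ge_zero)
      then have "r * b powr (- (1 / \<alpha>)) \<le> r" using r by (simp add: mult_left_le)
      then have empty: "{y. r < norm y \<and> b < q y} = {}"
        using iff by force
      show ?thesis unfolding 1 empty b_def[symmetric] if_not_P[OF False] by simp
    qed
  qed
  have "\<nu> = density lborel D"
  proof (rule measure_eqI_lessThan)
    fix a
    show "emeasure \<nu> {a<..} < \<infinity>" by (simp add: tail)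
    have "emeasure (density lborel D) {a<..} = (\<integral>\<^sup>+s. ennreal (pi * r\<^sup>2 * (2 / \<alpha>) * s powr (- (2 / \<alpha>) - 1)) * indicator {max a e<..<1} s \<partial>lborel)"
      by (subst emeasure_density) (auto simp: D_def intro!: nn_integral_cong split: split_indicator)
    also have "\<dots> = emeasure \<nu> {a<..}"
    proof (cases "max a e < 1")
      case True
      then show ?thesis
        using e \<alpha> nn_integral_powr_open_interval[of "max a e" "2 / \<alpha>" "pi * r\<^sup>2"] by (simp add: tail)
    next
      case False
      then have empty: "{max a e<..<1} = {}" by auto
      show ?thesis unfolding empty tail if_not_P[OF False] by simp
    qed
    finally show "emeasure \<nu> {a<..} = emeasure (density lborel D) {a<..}" ..
  qed (auto simp: \<nu>_def)
  then have "(\<integral>\<^sup>+s. \<phi> s \<partial>\<nu>) = (\<integral>\<^sup>+s. \<phi> s \<partial>density lborel D)" by simp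
  also have "(\<integral>\<^sup>+s. \<phi> s \<partial>\<nu>) = (\<integral>\<^sup>+y. \<phi> (q y) * indicator {y. r < norm y \<and> e < q y} y \<partial>lborel)"
    unfolding \<nu>_def by (subst nn_integral_distr, measurable, subst nn_integral_density) (auto simp: mult.commute)
  also have "(\<integral>\<^sup>+s. \<phi> s \<partial>density lborel D) = (\<integral>\<^sup>+s. \<phi> s * ennreal (pi * r\<^sup>2 * (2 / \<alpha>) * s powr (- (2 / \<alpha>) - 1)) * indicator {e<..<1} s \<partial>lborel)"
    by (subst nn_integral_density) (auto simp: D_def ac_simps)
  finally show ?thesis .
qed

text \<open>Polar coordinates in the variable \<open>s = (|y|/r)\<^sup>-\<^sup>\<alpha>\<close>, which maps the exterior of the disk
  of radius \<open>r\<close> to the unit interval.\<close>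
lemma nn_integral_radial:
  fixes r \<alpha> :: real and \<phi> :: "real \<Rightarrow> ennreal"
  defines "q \<equiv> (\<lambda>y :: real \<times> real. (norm y / r) powr (- \<alpha>))"
  assumes r: "0 < r" and \<alpha>: "0 < \<alpha>" and \<phi>[measurable]: "\<phi> \<in> borel_measurable borel"
  shows "(\<integral>\<^sup>+y. \<phi> (q y) * indicator {y. r < norm y} y \<partial>lborel) =
    (\<integral>\<^sup>+s. \<phi> s * ennreal (pi * r\<^sup>2 * (2 / \<alpha>) * s powr (- (2 / \<alpha>) - 1)) * indicator {0<..<1} s \<partial>lborel)"
proof -
  have q[measurable]: "q \<in> borel_measurable borel" unfolding q_def by measurable
  define e :: "nat \<Rightarrow> real" where "e n = 1 / (real n + 2)" for n
  have e: "0 < e n" "e n < 1" for n by (auto simp: e_def)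
  have dec: "e m \<le> e n" if "n \<le> m" for m n using that by (auto simp: e_def field_simps)
  have small: "\<exists>n. e n < x" if x: "0 < x" for x
  proof -
    obtain n where "inverse (real (Suc n)) < x" using reals_Archimedean[OF x] by blast
    then have "e n < x" by (simp add: e_def field_simps) (smt (verit) mult_pos_pos x)
    then show ?thesis by blast
  qed
  have ind_SUP: "(SUP n. c * indicator (S n) x) = c * indicator T x" 
    if sub: "\<And>n. S n \<subseteq> T" and ex: "x \<in> T \<Longrightarrow> \<exists>n. x \<in> S n" for c :: ennreal and S and T :: "'z set" and x
  proof (cases "x \<in> T")
    case True
    then obtain n where "x \<in> S n" using ex by blast
    then have "c * indicator T x \<le> (SUP n. c * indicator (S n) x)"
      using True by (intro SUP_upper2[of n]) auto
    moreover have "(SUP n. c * indicator (S n) x) \<le> c * indicator T x"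
      using True by (intro SUP_least) (auto split: split_indicator)
    ultimately show ?thesis by (rule antisym[rotated])
  next
    case False
    then have "x \<notin> S n" for n using sub by blast
    with False show ?thesis by simp
  qed
  have "(\<integral>\<^sup>+y. \<phi> (q y) * indicator {y. r < norm y} y \<partial>lborel) =
      (\<integral>\<^sup>+y. (SUP n. \<phi> (q y) * indicator {y. r < norm y \<and> e n < q y} y) \<partial>lborel)"
  proof (intro nn_integral_cong ind_SUP[symmetric])
    fix y assume "y \<in> {y::real \<times> real. r < norm y}"
    then have "0 < q y" using r by (auto simp: q_def)
    then obtain n where "e n < q y" using small by blast
    then show "\<exists>n. y \<in> {y. r < norm y \<and> e n < q y}" using \<open>y \<in> _\<close> by blast
  qed auto
  also have "\<dots> = (SUP n. \<integral>\<^sup>+y. \<phi> (q y) * indicator {y. r < norm y \<and> e n < q y} y \<partial>lborel)"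
    using dec by (intro nn_integral_monotone_convergence_SUP)
      (auto simp: incseq_def le_fun_def split: split_indicator, (meson le_less_trans)?)
  also have "\<dots> = (SUP n. \<integral>\<^sup>+s. \<phi> s * ennreal (pi * r\<^sup>2 * (2 / \<alpha>) * s powr (- (2 / \<alpha>) - 1)) * indicator {e n<..<1} s \<partial>lborel)"
    unfolding q_def nn_integral_radial_truncated[OF r \<alpha> e \<phi>] ..
  also have "\<dots> = (\<integral>\<^sup>+s. (SUP n. \<phi> s * ennreal (pi * r\<^sup>2 * (2 / \<alpha>) * s powr (- (2 / \<alpha>) - 1)) * indicator {e n<..<1} s) \<partial>lborel)"
    using dec by (intro nn_integral_monotone_convergence_SUP[symmetric])
      (auto simp: incseq_def le_fun_def split: split_indicator, (meson le_less_trans)?)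
  also have "\<dots> = (\<integral>\<^sup>+s. \<phi> s * ennreal (pi * r\<^sup>2 * (2 / \<alpha>) * s powr (- (2 / \<alpha>) - 1)) * indicator {0<..<1} s \<partial>lborel)"
  proof (intro nn_integral_cong ind_SUP)
    fix s :: real assume "s \<in> {0<..<1}"
    then show "\<exists>n. s \<in> {e n<..<1}" using small[of s] by auto
  next
    fix n show "{e n<..<1} \<subseteq> {0<..<1}" using e[of n] by auto
  qed
  finally show ?thesis .
qed

text \<open>A Poisson law whose mean is exponentially distributed with mean \<open>w\<close> is
  geometric: the first formula gives its weights, the second the probability of a nonzero value, the
  third its mean.\<close>

lemma nn_integral_exp_mark:
  fixes w :: real
  assumes w: "0 \<le> w"
  shows nn_integral_exp_mark_poisw: "(\<integral>\<^sup>+v. poisw n (ennreal (w * v)) * (ennreal (exp (- v)) * indicator {0..} v) \<partial>lborel) = ennreal (w ^ n / (1 + w) ^ (n + 1))"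
    and nn_integral_exp_mark_expneg: "(\<integral>\<^sup>+v. (1 - expneg (ennreal (w * v))) * (ennreal (exp (- v)) * indicator {0..} v) \<partial>lborel) = ennreal (w / (1 + w))"
    and nn_integral_exp_mark_mean: "(\<integral>\<^sup>+v. ennreal (w * v) * (ennreal (exp (- v)) * indicator {0..} v) \<partial>lborel) = ennreal w"
proof -
  show P: "(\<integral>\<^sup>+v. poisw n (ennreal (w * v)) * (ennreal (exp (- v)) * indicator {0..} v) \<partial>lborel) = ennreal (w ^ n / (1 + w) ^ (n + 1))" for n
  proof -
    \<comment> \<open>\<open>erlang_density n\<close> has shape \<open>n + 1\<close>, so rate
      \<open>1 + w\<close> matches both the factor \<open>v ^ n\<close> and the product of the two
      exponentials.\<close>
    have "(\<integral>\<^sup>+v. poisw n (ennreal (w * v)) * (ennreal (exp (- v)) * indicator {0..} v) \<partial>lborel)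
        = (\<integral>\<^sup>+v. ennreal (w ^ n / (1 + w) ^ (n + 1)) * ennreal (erlang_density n (1 + w) v) \<partial>lborel)"
    proof (intro nn_integral_cong)
      fix v :: real
      show "poisw n (ennreal (w * v)) * (ennreal (exp (- v)) * indicator {0..} v) = ennreal (w ^ n / (1 + w) ^ (n + 1)) * ennreal (erlang_density n (1 + w) v)"
      proof (cases "0 \<le> v")
        case True
        have "exp (- v) * exp (- (v * w)) = exp (- (v * (1 + w)))"
          by (simp add: algebra_simps flip: exp_add)
        moreover have "1 + w \<noteq> 0" using w by simp
        ultimately show ?thesis
          using True w
          by (simp add: poisw_ennreal erlang_density_def power_mult_distrib mult_ac flip: ennreal_mult) (simp add: algebra_simps)
      qed (simp add: erlang_density_def)
    qed
    also have "\<dots> = ennreal (w ^ n / (1 + w) ^ (n + 1)) * (\<integral>\<^sup>+v. ennreal (erlang_density n (1 + w) v) \<partial>lborel)"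
      by (intro nn_integral_cmult) measurable
    also have "(\<integral>\<^sup>+v. ennreal (erlang_density n (1 + w) v) \<partial>lborel) = 1"
      using nn_integral_erlang_ith_moment[of "1 + w" n 0] w by simp
    finally show ?thesis by simp
  qed
  have E: "(\<integral>\<^sup>+v. ennreal (exp (- v)) * indicator {0..} v \<partial>lborel) = 1"
  proof -
    have "(\<integral>\<^sup>+v. ennreal (exp (- v)) * indicator {0..} v \<partial>lborel) = (\<integral>\<^sup>+v. ennreal (erlang_density 0 1 v * v ^ 0) \<partial>lborel)"
      by (intro nn_integral_cong) (auto simp: erlang_density_def split: split_indicator)
    then show ?thesis using nn_integral_erlang_ith_moment[of 1 0 0] by simp
  qed
  \<comment> \<open>The second integral is found from its sum with the known weight of order 0,
    because a finite summand can be cancelled in \<open>ennreal\<close>.\<close>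
  have "(\<integral>\<^sup>+v. (1 - expneg (ennreal (w * v))) * (ennreal (exp (- v)) * indicator {0..} v) \<partial>lborel)
     + (\<integral>\<^sup>+v. expneg (ennreal (w * v)) * (ennreal (exp (- v)) * indicator {0..} v) \<partial>lborel)
     = (\<integral>\<^sup>+v. (1 - expneg (ennreal (w * v))) * (ennreal (exp (- v)) * indicator {0..} v)
        + expneg (ennreal (w * v)) * (ennreal (exp (- v)) * indicator {0..} v) \<partial>lborel)"
    by (intro nn_integral_add[symmetric]) measurable
  also have "\<dots> = (\<integral>\<^sup>+v. ennreal (exp (- v)) * indicator {0..} v \<partial>lborel)"
    by (intro nn_integral_cong) (simp add: distrib_right[symmetric] diff_add_cancel_ennreal expneg_le_1)
  finally have "(\<integral>\<^sup>+v. (1 - expneg (ennreal (w * v))) * (ennreal (exp (- v)) * indicator {0..} v) \<partial>lborel) + ennreal (1 / (1 + w)) = 1"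
    using P[of 0] by (simp add: poisw_0 E)
  also have "1 = ennreal (w / (1 + w)) + ennreal (1 / (1 + w))"
    using w by (simp add: add_divide_distrib[symmetric] flip: ennreal_plus)
  finally show "(\<integral>\<^sup>+v. (1 - expneg (ennreal (w * v))) * (ennreal (exp (- v)) * indicator {0..} v) \<partial>lborel) = ennreal (w / (1 + w))"
    by (simp add: ennreal_add_left_cancel add.commute[of _ "ennreal (1 / (1 + w))"])
  have "(\<integral>\<^sup>+v. ennreal (w * v) * (ennreal (exp (- v)) * indicator {0..} v) \<partial>lborel) = (\<integral>\<^sup>+v. ennreal w * ennreal (erlang_density 0 1 v * v ^ 1) \<partial>lborel)"
    using w by (intro nn_integral_cong) (auto simp: erlang_density_def ac_simps split: split_indicator simp flip: ennreal_mult)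
  also have "\<dots> = ennreal w * (\<integral>\<^sup>+v. ennreal (erlang_density 0 1 v * v ^ 1) \<partial>lborel)"
    by (intro nn_integral_cmult) measurable
  also have "(\<integral>\<^sup>+v. ennreal (erlang_density 0 1 v * v ^ 1) \<partial>lborel) = 1"
    using nn_integral_erlang_ith_moment[of 1 0 1] by simp
  finally show "(\<integral>\<^sup>+v. ennreal (w * v) * (ennreal (exp (- v)) * indicator {0..} v) \<partial>lborel) = ennreal w"
    by simp
qed

section \<open>Euler integrals for the coefficients\<close>

lemma nn_integral_powr_unit:
  fixes b :: real
  assumes "0 < b"
  shows "(\<integral>\<^sup>+t. ennreal (t powr (b - 1)) * indicator {0<..<1} t \<partial>lborel) = ennreal (1 / b)"
proof -
  have "((\<lambda>t. t powr (b - 1)) has_integral (1 powr (b - 1 + 1) / (b - 1 + 1))) {0..1}"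
    using assms by (intro has_integral_powr_from_0) auto
  then have "((\<lambda>t. t powr (b - 1)) has_integral (1 / b)) {0<..<1}"
    by (simp add: has_integral_Icc_iff_Ioo)
  then have "(\<integral>\<^sup>+t. ennreal (t powr (b - 1)) * indicator {0<..<1} t \<partial>lborel) = ennreal (1 / b)"
    by (intro nn_integral_has_integral_lebesgue') (auto)
  then show ?thesis .
qed

text \<open>For \<open>c = b + 1\<close> the Gamma quotient equals \<open>b\<close> and the factor
  with \<open>1 - t\<close> has exponent 0. Domination by \<open>t powr (b - 1)\<close> shows that
  the remaining integral converges, so \<open>hyp2f1\<close> is not a default value.\<close>

lemma hyp2f1_euler:
  fixes a b c \<tau> :: real
  assumes b: "0 < b" and c: "c = b + 1" and a: "0 \<le> a" and \<tau>: "0 \<le> \<tau>"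
  shows "(\<integral>\<^sup>+t. ennreal (t powr (b - 1) * (1 + \<tau> * t) powr (- a)) * indicator {0<..<1} t \<partial>lborel)
      = ennreal (hyp2f1 a b c (- \<tau>) / b)"
    and "0 \<le> hyp2f1 a b c (- \<tau>)"
proof -
  define f where "f t = t powr (b - 1) * (1 + \<tau> * t) powr (- a) * indicator {0<..<1} t" for t
  define I where "I = (\<integral>\<^sup>+t. ennreal (f t) \<partial>lborel)"
  have I_eq: "I = (\<integral>\<^sup>+t. ennreal (t powr (b - 1) * (1 + \<tau> * t) powr (- a)) * indicator {0<..<1} t \<partial>lborel)"
    unfolding I_def by (intro nn_integral_cong) (auto simp: f_def split: split_indicator)
  have "I \<le> (\<integral>\<^sup>+t. ennreal (t powr (b - 1)) * indicator {0<..<1} t \<partial>lborel)"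
    unfolding I_def
  proof (intro nn_integral_mono)
    fix t :: real
    have "(1 + \<tau> * t) powr (- a) \<le> 1" if "0 < t"
      using that a \<tau> by (simp add: powr_minus inverse_le_1_iff ge_one_powr_ge_zero)
    then show "ennreal (f t) \<le> ennreal (t powr (b - 1)) * indicator {0<..<1} t"
      by (auto simp: f_def mult_left_le split: split_indicator intro!: ennreal_leI)
  qed
  also have "\<dots> = ennreal (1 / b)" using b by (rule nn_integral_powr_unit)
  finally have fin: "I < Orderings.top" using ennreal_less_top le_less_trans by blast
  define i where "i = enn2real I"
  have i: "I = ennreal i" "0 \<le> i" using fin by (auto simp: i_def)
  have "(f has_integral i) UNIV"
    by (rule nn_integral_has_integral) (use i in \<open>auto simp: I_def f_def[abs_def]\<close>)
  \<comment> \<open>At \<open>t = 1\<close> the factor \<open>0 powr 0\<close> is 0 and not 1, so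
    the identity is used on the open interval; the end points are negligible.\<close>
  moreover have "f = (\<lambda>t. if t \<in> {0<..<1} then t powr (b - 1) * (1 - t) powr (c - b - 1) * (1 - (- \<tau>) * t) powr (- a) else 0)"
    using c by (auto simp: f_def fun_eq_iff split: split_indicator)
  ultimately have "((\<lambda>t. t powr (b - 1) * (1 - t) powr (c - b - 1) * (1 - (- \<tau>) * t) powr (- a)) has_integral i) {0<..<1}"
    by (simp only: has_integral_restrict_UNIV)
  then have "integral {0..1} (\<lambda>t. t powr (b - 1) * (1 - t) powr (c - b - 1) * (1 - (- \<tau>) * t) powr (- a)) = i"
    by (intro integral_unique) (simp add: has_integral_Icc_iff_Ioo)
  moreover have "Gamma c / (Gamma b * Gamma (c - b)) = b"
  proof -
    have "b \<notin> \<int>\<^sub>\<le>\<^sub>0" using b by (auto simp: nonpos_Ints_def)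
    then have "Gamma c = b * Gamma b" using Gamma_plus1 c by blast
    then show ?thesis using Gamma_real_pos[OF b] c by simp
  qed
  ultimately have "hyp2f1 a b c (- \<tau>) = b * i"
    by (simp add: hyp2f1_def)
  then show "(\<integral>\<^sup>+t. ennreal (t powr (b - 1) * (1 + \<tau> * t) powr (- a)) * indicator {0<..<1} t \<partial>lborel)
      = ennreal (hyp2f1 a b c (- \<tau>) / b)" "0 \<le> hyp2f1 a b c (- \<tau>)"
    using I_eq i b by auto
qed

lemma varphi_nonneg:
  assumes "0 < \<delta>" "\<delta> < 1" "0 < \<tau>"
  shows "0 \<le> varphi \<delta> \<tau> n"
  using assms hyp2f1_euler(2)[of "1 - \<delta>" "2 - \<delta>" 1 \<tau>] hyp2f1_euler(2)[of "real n - \<delta>" "real n + 1 - \<delta>" "real n + 1" \<tau>]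
  by (cases n) (auto simp: varphi_def)

lemma nn_integral_varphi:
  fixes \<delta> \<tau> c :: real
  assumes \<delta>: "0 < \<delta>" "\<delta> < 1" and \<tau>: "0 < \<tau>" and c: "0 \<le> c"
  shows "(\<integral>\<^sup>+s. ennreal (if n = 0 then \<tau> * s / (1 + \<tau> * s) else (\<tau> * s) ^ n / (1 + \<tau> * s) ^ (n + 1))
            * ennreal (c * \<delta> * s powr (- \<delta> - 1)) * indicator {0<..<1} s \<partial>lborel) = ennreal (c * varphi \<delta> \<tau> n)"
proof -
  \<comment> \<open>For \<open>n = 0\<close> the integrand \<open>w / (1 + w)\<close> has a
    numerator of degree 1, so with \<open>m\<close> both branches of \<open>varphi\<close> follow
    one formula. Since \<open>m \<ge> 1 > \<delta>\<close>, the integral converges at 0.\<close>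
  define m where "m = (if n = 0 then 1 else n)"
  have m: "m \<ge> 1" by (simp add: m_def)
  have b: "0 < real m - \<delta>" using m \<delta> by linarith
  have vp: "varphi \<delta> \<tau> n = \<delta> * \<tau> ^ m * (hyp2f1 (real n + 1) (real m - \<delta>) (real m + 1 - \<delta>) (- \<tau>) / (real m - \<delta>))"
    by (auto simp: varphi_def m_def)
  have "(\<integral>\<^sup>+s. ennreal (if n = 0 then \<tau> * s / (1 + \<tau> * s) else (\<tau> * s) ^ n / (1 + \<tau> * s) ^ (n + 1))
            * ennreal (c * \<delta> * s powr (- \<delta> - 1)) * indicator {0<..<1} s \<partial>lborel)
    = (\<integral>\<^sup>+s. ennreal (c * \<delta> * \<tau> ^ m) * (ennreal (s powr ((real m - \<delta>) - 1) * (1 + \<tau> * s) powr (- (real n + 1))) * indicator {0<..<1} s) \<partial>lborel)"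
  proof (intro nn_integral_cong)
    fix s :: real
    show "ennreal (if n = 0 then \<tau> * s / (1 + \<tau> * s) else (\<tau> * s) ^ n / (1 + \<tau> * s) ^ (n + 1))
            * ennreal (c * \<delta> * s powr (- \<delta> - 1)) * indicator {0<..<1} s
      = ennreal (c * \<delta> * \<tau> ^ m) * (ennreal (s powr ((real m - \<delta>) - 1) * (1 + \<tau> * s) powr (- (real n + 1))) * indicator {0<..<1} s)"
    proof (cases "s \<in> {0<..<1}")
      case True
      then have s: "0 < s" by simp
      have pos: "0 < 1 + \<tau> * s" using s \<tau> by (simp add: add_pos_pos)
      have 1: "s powr ((real m - \<delta>) - 1) = s ^ m * s powr (- \<delta> - 1)"
        using s powr_add[of s "real m" "- \<delta> - 1"] by (simp add: powr_realpow algebra_simps)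
      have 2: "(1 + \<tau> * s) powr (- (real n + 1)) = 1 / (1 + \<tau> * s) ^ (n + 1)"
        using powr_realpow[OF pos, of "n + 1"]
        unfolding powr_minus divide_inverse mult_1_left by (simp add: add.commute)
      have 3: "(if n = 0 then \<tau> * s / (1 + \<tau> * s) else (\<tau> * s) ^ n / (1 + \<tau> * s) ^ (n + 1)) = (\<tau> * s) ^ m / (1 + \<tau> * s) ^ (n + 1)"
        by (simp add: m_def)
      show ?thesis
        unfolding 1 2 3 using True s pos \<tau> c \<delta>
        by (simp add: power_mult_distrib mult_ac flip: ennreal_mult)
    qed simp
  qed
  also have "\<dots> = ennreal (c * \<delta> * \<tau> ^ m) * (\<integral>\<^sup>+s. (ennreal (s powr ((real m - \<delta>) - 1) * (1 + \<tau> * s) powr (- (real n + 1))) * indicator {0<..<1} s) \<partial>lborel)"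
    by (intro nn_integral_cmult) measurable
  also have "\<dots> = ennreal (c * \<delta> * \<tau> ^ m) * ennreal (hyp2f1 (real n + 1) (real m - \<delta>) (real m + 1 - \<delta>) (- \<tau>) / (real m - \<delta>))"
    using b \<tau> by (subst hyp2f1_euler(1)) auto
  also have "\<dots> = ennreal (c * varphi \<delta> \<tau> n)"
    unfolding vp using b \<tau> c \<delta> hyp2f1_euler(2)[OF b, of "real m + 1 - \<delta>" "real n + 1" \<tau>]
    by (simp add: mult_ac flip: ennreal_mult)
  finally show ?thesis .
qed

section \<open>Intensity integrals of a single interferer\<close>

lemma borel_measurable_fst_snd [measurable]:
  "fst \<in> borel_measurable borel" "snd \<in> borel_measurable borel"
  by (auto intro!: borel_measurable_continuous_onI continuous_intros)

lemma sets_marked_intensity [simp]: "sets (marked_intensity a) = sets borel"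
  by (simp add: marked_intensity_def)

lemma sigma_finite_marked_intensity: "sigma_finite_measure (marked_intensity a)"
  unfolding marked_intensity_def
  by (subst sigma_finite_measure.sigma_finite_iff_density_finite[OF sigma_finite_lborel]) auto

text \<open>The contribution of a point at location \<open>y\<close> with mark \<open>v\<close>, normalised so that a unit mark
  on the boundary of the exclusion disk of radius \<open>r\<close> contributes \<open>\<tau>\<close>.\<close>
definition shot :: "real \<Rightarrow> real \<Rightarrow> real \<Rightarrow> (real \<times> real) \<times> real \<Rightarrow> ennreal" where
  "shot r \<alpha> \<tau> = (\<lambda>(y, v). ennreal (\<tau> * (norm y / r) powr (- \<alpha>) * v) * indicator {y. r < norm y} y)"

lemma borel_measurable_shot [measurable]: "shot r \<alpha> \<tau> \<in> borel_measurable borel"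
  unfolding shot_def case_prod_beta by measurable

text \<open>With a general \<open>\<psi>\<close>, a single passage through Fubini and polar
  coordinates serves the Poisson weights, the Laplace exponent, the mean and the indicator of a
  nonzero contribution. \<open>\<psi> 0 = 0\<close> removes the inside of the disk, where
  \<open>shot\<close> is 0.\<close>

lemma nn_integral_marked_intensity_shot:
  fixes r \<alpha> a \<tau> :: real and \<psi> :: "ennreal \<Rightarrow> ennreal"
  assumes r: "0 < r" and \<alpha>: "0 < \<alpha>" and a: "0 \<le> a" and \<psi>[measurable]: "\<psi> \<in> borel_measurable borel"
    and \<psi>0: "\<psi> 0 = 0"
  shows "(\<integral>\<^sup>+z. \<psi> (shot r \<alpha> \<tau> z) \<partial>marked_intensity a) = ennreal a *
    (\<integral>\<^sup>+s. (\<integral>\<^sup>+v. \<psi> (ennreal (\<tau> * s * v)) * (ennreal (exp (- v)) * indicator {0..} v) \<partial>lborel)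
       * ennreal (pi * r\<^sup>2 * (2 / \<alpha>) * s powr (- (2 / \<alpha>) - 1)) * indicator {0<..<1} s \<partial>lborel)"
proof -
  define q where "q y = (norm y / r) powr (- \<alpha>)" for y :: "real \<times> real"
  define \<phi> where "\<phi> s = (\<integral>\<^sup>+v. \<psi> (ennreal (\<tau> * s * v)) * (ennreal (exp (- v)) * indicator {0..} v) \<partial>lborel)" for s
  have [measurable]: "\<phi> \<in> borel_measurable borel" unfolding \<phi>_def by measurable
  have "(\<integral>\<^sup>+z. \<psi> (shot r \<alpha> \<tau> z) \<partial>marked_intensity a)
      = (\<integral>\<^sup>+z. ennreal (a * (if snd z \<ge> 0 then exp (- snd z) else 0)) * \<psi> (shot r \<alpha> \<tau> z) \<partial>lborel)"
    unfolding marked_intensity_def by (subst nn_integral_density) auto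
  also have "\<dots> = (\<integral>\<^sup>+z. ennreal (a * (if snd z \<ge> 0 then exp (- snd z) else 0)) * \<psi> (shot r \<alpha> \<tau> z) \<partial>(lborel \<Otimes>\<^sub>M lborel))"
    by (simp only: lborel_prod)
  also have "\<dots> = (\<integral>\<^sup>+y. \<integral>\<^sup>+v. ennreal (a * (if v \<ge> 0 then exp (- v) else 0)) * \<psi> (shot r \<alpha> \<tau> (y, v)) \<partial>lborel \<partial>lborel)"
  proof -
    have [measurable]: "shot r \<alpha> \<tau> \<in> borel_measurable (lborel \<Otimes>\<^sub>M lborel)"
      using borel_measurable_shot by (simp add: lborel_prod)
    show ?thesis by (subst lborel.nn_integral_fst[symmetric]) (auto simp only: snd_conv, measurable)
  qed
  also have "\<dots> = (\<integral>\<^sup>+y. ennreal a * (\<phi> (q y) * indicator {y. r < norm y} y) \<partial>lborel)"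
  proof (intro nn_integral_cong)
    fix y :: "real \<times> real"
    have "(\<integral>\<^sup>+v. ennreal (a * (if v \<ge> 0 then exp (- v) else 0)) * \<psi> (shot r \<alpha> \<tau> (y, v)) \<partial>lborel)
       = (\<integral>\<^sup>+v. (ennreal a * indicator {y. r < norm y} y) * (\<psi> (ennreal (\<tau> * q y * v)) * (ennreal (exp (- v)) * indicator {0..} v)) \<partial>lborel)"
      using a \<psi>0 by (intro nn_integral_cong) (auto simp: shot_def q_def mult_ac ennreal_mult split: split_indicator)
    also have "\<dots> = (ennreal a * indicator {y. r < norm y} y) * \<phi> (q y)"
      unfolding \<phi>_def by (intro nn_integral_cmult) measurable
    finally show "(\<integral>\<^sup>+v. ennreal (a * (if v \<ge> 0 then exp (- v) else 0)) * \<psi> (shot r \<alpha> \<tau> (y, v)) \<partial>lborel)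
        = ennreal a * (\<phi> (q y) * indicator {y. r < norm y} y)"
      by (simp add: mult_ac)
  qed
  also have "\<dots> = ennreal a * (\<integral>\<^sup>+y. \<phi> (q y) * indicator {y. r < norm y} y \<partial>lborel)"
    unfolding q_def by (intro nn_integral_cmult) measurable
  also have "(\<integral>\<^sup>+y. \<phi> (q y) * indicator {y. r < norm y} y \<partial>lborel) =
     (\<integral>\<^sup>+s. \<phi> s * ennreal (pi * r\<^sup>2 * (2 / \<alpha>) * s powr (- (2 / \<alpha>) - 1)) * indicator {0<..<1} s \<partial>lborel)"
    unfolding q_def by (rule nn_integral_radial[OF r \<alpha>]) measurable
  finally show ?thesis unfolding \<phi>_def .
qed

text \<open>The weight of order 0 equals 1 at a vanishing contribution and would have an infinite
  integral when \<open>a > 0\<close>; \<open>1 - expneg\<close> takes its place.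
  \<open>2 < \<alpha>\<close> tames the distant interferers, which correspond to \<open>s\<close>
  near 0.\<close>

lemma shot_intensity:
  fixes r \<alpha> a \<tau> :: real
  assumes r: "0 < r" and \<alpha>: "2 < \<alpha>" and a: "0 \<le> a" and \<tau>: "0 < \<tau>"
  shows shot_intensity_poisw: "0 < n \<Longrightarrow> (\<integral>\<^sup>+z. poisw n (shot r \<alpha> \<tau> z) \<partial>marked_intensity a) = ennreal (pi * (a * r\<^sup>2 * varphi (2 / \<alpha>) \<tau> n))"
    and shot_intensity_expneg: "(\<integral>\<^sup>+z. 1 - expneg (shot r \<alpha> \<tau> z) \<partial>marked_intensity a) = ennreal (pi * (a * r\<^sup>2 * varphi (2 / \<alpha>) \<tau> 0))"
    and shot_intensity_mean: "(\<integral>\<^sup>+z. shot r \<alpha> \<tau> z \<partial>marked_intensity a) < \<infinity>"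
proof -
  have \<delta>: "0 < 2 / \<alpha>" "2 / \<alpha> < 1" and \<alpha>0: "0 < \<alpha>" using \<alpha> by auto
  have cm: "(\<integral>\<^sup>+s. f s * ennreal (pi * r\<^sup>2 * (2 / \<alpha>) * s powr (- (2 / \<alpha>) - 1)) * indicator {0<..<1} s \<partial>lborel)
     = (\<integral>\<^sup>+s. g s * ennreal (pi * r\<^sup>2 * (2 / \<alpha>) * s powr (- (2 / \<alpha>) - 1)) * indicator {0<..<1} s \<partial>lborel)"
    if "\<And>s. 0 < s \<Longrightarrow> f s = g s" for f g :: "real \<Rightarrow> ennreal"
    using that by (intro nn_integral_cong) (auto split: split_indicator)
  have vp: "ennreal a * (\<integral>\<^sup>+s. ennreal (if n = 0 then \<tau> * s / (1 + \<tau> * s) else (\<tau> * s) ^ n / (1 + \<tau> * s) ^ (n + 1))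
            * ennreal (pi * r\<^sup>2 * (2 / \<alpha>) * s powr (- (2 / \<alpha>) - 1)) * indicator {0<..<1} s \<partial>lborel)
      = ennreal (pi * (a * r\<^sup>2 * varphi (2 / \<alpha>) \<tau> n))" for n
    using a varphi_nonneg[OF \<delta> \<tau>, of n] by (subst nn_integral_varphi[OF \<delta> \<tau>]) (auto simp: mult_ac simp flip: ennreal_mult)
  show "(\<integral>\<^sup>+z. poisw n (shot r \<alpha> \<tau> z) \<partial>marked_intensity a) = ennreal (pi * (a * r\<^sup>2 * varphi (2 / \<alpha>) \<tau> n))" if n: "0 < n"
  proof -
    have "(\<integral>\<^sup>+z. poisw n (shot r \<alpha> \<tau> z) \<partial>marked_intensity a) = ennreal a *
      (\<integral>\<^sup>+s. (\<integral>\<^sup>+v. poisw n (ennreal (\<tau> * s * v)) * (ennreal (exp (- v)) * indicator {0..} v) \<partial>lborel)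
       * ennreal (pi * r\<^sup>2 * (2 / \<alpha>) * s powr (- (2 / \<alpha>) - 1)) * indicator {0<..<1} s \<partial>lborel)"
      using n by (intro nn_integral_marked_intensity_shot r a \<alpha>0) (auto simp: poisw_def)
    also have "\<dots> = ennreal (pi * (a * r\<^sup>2 * varphi (2 / \<alpha>) \<tau> n))"
      using n \<tau> unfolding vp[of n, symmetric]
      by (intro arg_cong2[where f="(*)"] refl cm) (simp add: nn_integral_exp_mark_poisw)
    finally show ?thesis .
  qed
  have "(\<integral>\<^sup>+z. 1 - expneg (shot r \<alpha> \<tau> z) \<partial>marked_intensity a) = ennreal a *
      (\<integral>\<^sup>+s. (\<integral>\<^sup>+v. (1 - expneg (ennreal (\<tau> * s * v))) * (ennreal (exp (- v)) * indicator {0..} v) \<partial>lborel)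
       * ennreal (pi * r\<^sup>2 * (2 / \<alpha>) * s powr (- (2 / \<alpha>) - 1)) * indicator {0<..<1} s \<partial>lborel)"
    by (intro nn_integral_marked_intensity_shot[where \<psi>="\<lambda>x. 1 - expneg x"] r a \<alpha>0) auto
  also have "\<dots> = ennreal (pi * (a * r\<^sup>2 * varphi (2 / \<alpha>) \<tau> 0))"
    using \<tau> unfolding vp[of 0, symmetric]
    by (intro arg_cong2[where f="(*)"] refl cm) (simp add: nn_integral_exp_mark_expneg)
  finally show "(\<integral>\<^sup>+z. 1 - expneg (shot r \<alpha> \<tau> z) \<partial>marked_intensity a) = ennreal (pi * (a * r\<^sup>2 * varphi (2 / \<alpha>) \<tau> 0))" .
  have "(\<integral>\<^sup>+z. shot r \<alpha> \<tau> z \<partial>marked_intensity a) = ennreal a *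
      (\<integral>\<^sup>+s. (\<integral>\<^sup>+v. ennreal (\<tau> * s * v) * (ennreal (exp (- v)) * indicator {0..} v) \<partial>lborel)
       * ennreal (pi * r\<^sup>2 * (2 / \<alpha>) * s powr (- (2 / \<alpha>) - 1)) * indicator {0<..<1} s \<partial>lborel)"
    by (intro nn_integral_marked_intensity_shot[where \<psi>="\<lambda>x. x"] r a \<alpha>0) auto
  also have "\<dots> = ennreal a * (\<integral>\<^sup>+s. ennreal (\<tau> * s) * ennreal (pi * r\<^sup>2 * (2 / \<alpha>) * s powr (- (2 / \<alpha>) - 1)) * indicator {0<..<1} s \<partial>lborel)"
    using \<tau> by (intro arg_cong2[where f="(*)"] refl cm) (simp add: nn_integral_exp_mark_mean)
  also have "(\<integral>\<^sup>+s. ennreal (\<tau> * s) * ennreal (pi * r\<^sup>2 * (2 / \<alpha>) * s powr (- (2 / \<alpha>) - 1)) * indicator {0<..<1} s \<partial>lborel)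
    = (\<integral>\<^sup>+s. ennreal (\<tau> * (pi * r\<^sup>2 * (2 / \<alpha>))) * (ennreal (s powr ((1 - 2 / \<alpha>) - 1)) * indicator {0<..<1} s) \<partial>lborel)"
  proof (intro nn_integral_cong)
    fix s :: real
    have "s powr (1 - 2 / \<alpha> - 1) = s * s powr (- (2 / \<alpha>) - 1)" if "0 < s"
      using that powr_add[of s 1 "- (2 / \<alpha>) - 1"] by simp
    then show "ennreal (\<tau> * s) * ennreal (pi * r\<^sup>2 * (2 / \<alpha>) * s powr (- (2 / \<alpha>) - 1)) * indicator {0<..<1} s
      = ennreal (\<tau> * (pi * r\<^sup>2 * (2 / \<alpha>))) * (ennreal (s powr ((1 - 2 / \<alpha>) - 1)) * indicator {0<..<1} s)"
      using \<tau> \<delta> by (auto simp: mult_ac split: split_indicator simp flip: ennreal_mult)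
  qed
  also have "\<dots> = ennreal (\<tau> * (pi * r\<^sup>2 * (2 / \<alpha>))) * (\<integral>\<^sup>+s. (ennreal (s powr ((1 - 2 / \<alpha>) - 1)) * indicator {0<..<1} s) \<partial>lborel)"
    by (intro nn_integral_cmult) measurable
  also have "\<dots> = ennreal (\<tau> * (pi * r\<^sup>2 * (2 / \<alpha>))) * ennreal (1 / (1 - 2 / \<alpha>))"
    using \<delta> by (subst nn_integral_powr_unit) auto
  finally show "(\<integral>\<^sup>+z. shot r \<alpha> \<tau> z \<partial>marked_intensity a) < \<infinity>"
    by (simp add: ennreal_mult_less_top)
qed

section \<open>Shot noise\<close>

lemma shot_neq_top: "shot r \<alpha> \<tau> z \<noteq> \<infinity>"
  by (cases z; cases "r < norm (fst z)") (simp_all add: shot_def)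

text \<open>\<open>1 - expneg (\<infinity> * w)\<close> is the indicator of
  \<open>w \<noteq> 0\<close>, so the integral is the intensity of the contributing points, and the
  exterior of a disk has infinite area.\<close>

lemma shot_intensity_pos:
  fixes r \<alpha> a \<tau> :: real
  assumes r: "0 < r" and \<alpha>: "2 < \<alpha>" and a: "0 < a" and \<tau>: "0 < \<tau>"
  shows "(\<integral>\<^sup>+z. 1 - expneg (\<infinity> * shot r \<alpha> \<tau> z) \<partial>marked_intensity a) = \<infinity>"
proof -
  define c where "c = pi * r\<^sup>2"
  define \<delta> where "\<delta> = 2 / \<alpha>"
  have \<delta>: "0 < \<delta>" using \<alpha> by (simp add: \<delta>_def)
  have c: "0 < c" using r by (simp add: c_def)
  have mark: "(\<integral>\<^sup>+v. (1 - expneg (\<infinity> * ennreal (\<tau> * s * v))) * (ennreal (exp (- v)) * indicator {0..} v) \<partial>lborel) = 1"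
    if s: "0 < s" for s
  proof -
    \<comment> \<open>The zero parameter on the right makes the total mass of the mark density an
      instance of the weight formula.\<close>
    have "(\<integral>\<^sup>+v. (1 - expneg (\<infinity> * ennreal (\<tau> * s * v))) * (ennreal (exp (- v)) * indicator {0..} v) \<partial>lborel)
       = (\<integral>\<^sup>+v. poisw 0 (ennreal (0 * v)) * (ennreal (exp (- v)) * indicator {0..} v) \<partial>lborel)"
    proof (rule nn_integral_cong_AE, rule AE_mp[OF AE_lborel_singleton[of 0]], rule AE_I2, rule impI)
      fix v :: real assume v: "v \<noteq> 0"
      show "(1 - expneg (\<infinity> * ennreal (\<tau> * s * v))) * (ennreal (exp (- v)) * indicator {0..} v)
          = poisw 0 (ennreal (0 * v)) * (ennreal (exp (- v)) * indicator {0..} v)"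
      proof (cases "0 < v")
        case True
        then have "ennreal (\<tau> * s * v) \<noteq> 0" using s \<tau> by simp
        then have "expneg (\<infinity> * ennreal (\<tau> * s * v)) = 0" by (simp add: ennreal_top_mult)
        then show ?thesis by (simp add: poisw_0)
      next
        case False
        with v show ?thesis by auto
      qed
    qed
    also have "\<dots> = 1"
      by (subst nn_integral_exp_mark_poisw) auto
    finally show ?thesis .
  qed
  have "(\<integral>\<^sup>+z. 1 - expneg (\<infinity> * shot r \<alpha> \<tau> z) \<partial>marked_intensity a) = ennreal a *
      (\<integral>\<^sup>+s. (\<integral>\<^sup>+v. (1 - expneg (\<infinity> * ennreal (\<tau> * s * v))) * (ennreal (exp (- v)) * indicator {0..} v) \<partial>lborel)
       * ennreal (c * \<delta> * s powr (- \<delta> - 1)) * indicator {0<..<1} s \<partial>lborel)"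
    unfolding c_def \<delta>_def using \<alpha> a
    by (intro nn_integral_marked_intensity_shot[where \<psi>="\<lambda>x. 1 - expneg (\<infinity> * x)"] r) auto
  also have "\<dots> = ennreal a * (\<integral>\<^sup>+s. ennreal (c * \<delta> * s powr (- \<delta> - 1)) * indicator {0<..<1} s \<partial>lborel)"
  proof (rule arg_cong2[where f="(*)", OF refl nn_integral_cong])
    fix s :: real
    show "(\<integral>\<^sup>+v. (1 - expneg (\<infinity> * ennreal (\<tau> * s * v))) * (ennreal (exp (- v)) * indicator {0..} v) \<partial>lborel)
       * ennreal (c * \<delta> * s powr (- \<delta> - 1)) * indicator {0<..<1} s = ennreal (c * \<delta> * s powr (- \<delta> - 1)) * indicator {0<..<1} s"
    proof (cases "0 < s")
      case True
      show ?thesis unfolding mark[OF True] by simp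
    qed simp
  qed
  also have "(\<integral>\<^sup>+s. ennreal (c * \<delta> * s powr (- \<delta> - 1)) * indicator {0<..<1} s \<partial>lborel) = \<infinity>"
  proof (rule ccontr)
    assume "(\<integral>\<^sup>+s. ennreal (c * \<delta> * s powr (- \<delta> - 1)) * indicator {0<..<1} s \<partial>lborel) \<noteq> \<infinity>"
    then obtain B where B: "0 \<le> B" "(\<integral>\<^sup>+s. ennreal (c * \<delta> * s powr (- \<delta> - 1)) * indicator {0<..<1} s \<partial>lborel) = ennreal B"
      by (cases "\<integral>\<^sup>+s. ennreal (c * \<delta> * s powr (- \<delta> - 1)) * indicator {0<..<1} s \<partial>lborel" rule: ennreal_cases) simp_all
    \<comment> \<open>Chosen so that the integral over \<open>{b<..<1}\<close> is
      \<open>B + c\<close>, which exceeds the supposed value \<open>B\<close>.\<close>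
    define b where "b = (B / c + 2) powr (- (1 / \<delta>))"
    have "0 \<le> B / c" using B c by simp
    then have pos: "1 < B / c + 2" by linarith
    have b: "0 < b" "b < 1" using pos \<delta> by (auto simp: b_def powr_less_one)
    have "b powr (- \<delta>) = B / c + 2" using pos \<delta> by (simp add: b_def powr_powr)
    then have "ennreal (c * (B / c + 1)) = ennreal (c * (b powr (- \<delta>) - 1))" by (simp add: add.commute)
    also have "\<dots> = (\<integral>\<^sup>+q. ennreal (c * \<delta> * q powr (- \<delta> - 1)) * indicator {b<..<1} q \<partial>lborel)"
      using b \<delta> c by (subst nn_integral_powr_open_interval) auto
    also have "\<dots> \<le> ennreal B"
      unfolding B(2)[symmetric] using b by (intro nn_integral_mono) (auto split: split_indicator)
    finally have "c * (B / c + 1) \<le> B" using B by simp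
    then show False using c by (simp add: distrib_left)
  qed
  finally show ?thesis using a by (simp add: ennreal_mult_eq_top_iff)
qed

lemma suminf_ennreal_Suc:
  fixes f :: "nat \<Rightarrow> ennreal"
  shows "(\<Sum>n. f n) = f 0 + (\<Sum>n. f (Suc n))"
  using sums_Suc[OF summable_sums[OF summableI[of "\<lambda>n. f (Suc n)"]]] by (simp add: sums_iff add.commute)

text \<open>Let N be Poisson with mean \<open>w\<close>. On the event \<open>N \<ge> 1\<close> write
  1 as the sum of \<open>1 - t ^ N\<close> and \<open>t ^ N\<close>, and take expectations. The
  additive form survives integration, where a difference could meet
  \<open>\<infinity> - \<infinity>\<close>.\<close>

lemma expneg_thinning:
  assumes t: "0 \<le> t" "t < 1" and w: "w \<noteq> \<infinity>"
  shows "(1 - expneg (ennreal (1 - t) * w)) + (\<Sum>n. ennreal (t ^ Suc n) * poisw (Suc n) w) = 1 - expneg w"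
proof -
  define S where "S = (\<Sum>n. ennreal (t ^ Suc n) * poisw (Suc n) w)"
  have 1: "expneg w + S = expneg (ennreal (1 - t) * w)"
    using suminf_poisw[OF t, of w] unfolding S_def by (subst (asm) suminf_ennreal_Suc) (simp add: poisw_0)
  have le: "expneg w + S \<le> 1" using expneg_le_1 unfolding 1 .
  obtain e s where es: "expneg w = ennreal e" "S = ennreal s" "0 \<le> e" "0 \<le> s"
  proof -
    have "expneg w + S \<noteq> Orderings.top" using le by (auto simp: top_unique)
    then have "expneg w \<noteq> Orderings.top" "S \<noteq> Orderings.top" unfolding ennreal_add_eq_top by blast+
    then show thesis using that by (metis ennreal_cases)
  qed
  then have "e + s \<le> 1" using le by (simp flip: ennreal_plus ennreal_1)
  then show ?thesis
    unfolding S_def[symmetric] 1[symmetric] es using es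
    by (simp add: ennreal_minus flip: ennreal_plus ennreal_1)
qed

text \<open>Integrating the thinning identity over the intensity shows that the exponent and the
  series add up to the finite value \<open>c 0\<close>; finiteness then permits subtraction in the
  reals.\<close>

lemma shot_laplace_exponent:
  fixes r \<alpha> a \<tau> t :: real
  defines "c \<equiv> \<lambda>n. pi * (a * r\<^sup>2 * varphi (2 / \<alpha>) \<tau> n)"
  assumes r: "0 < r" and \<alpha>: "2 < \<alpha>" and a: "0 \<le> a" and \<tau>: "0 < \<tau>" and t: "0 \<le> t" "t < 1"
  obtains S where "(\<lambda>n. c (Suc n) * t ^ Suc n) sums S" "S \<le> c 0"
    "(\<integral>\<^sup>+z. 1 - expneg (ennreal (1 - t) * shot r \<alpha> \<tau> z) \<partial>marked_intensity a) = ennreal (c 0 - S)"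
proof -
  let ?\<mu> = "marked_intensity a"
  have c: "0 \<le> c n" for n
    using a \<alpha> \<tau> varphi_nonneg[of "2 / \<alpha>" \<tau> n] by (auto simp: c_def)
  have [measurable]: "f \<in> borel_measurable ?\<mu>" if "f \<in> borel_measurable borel" for f :: "_ \<Rightarrow> ennreal"
    using that measurable_cong_sets[OF sets_marked_intensity refl] by blast
  have m1: "(\<lambda>z. 1 - expneg (ennreal (1 - t) * shot r \<alpha> \<tau> z)) \<in> borel_measurable ?\<mu>"
    and m2: "(\<lambda>z. ennreal (t ^ Suc n) * poisw (Suc n) (shot r \<alpha> \<tau> z)) \<in> borel_measurable ?\<mu>"
    and m3: "(\<lambda>z. poisw (Suc n) (shot r \<alpha> \<tau> z)) \<in> borel_measurable ?\<mu>" for n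
    by (auto intro!: \<open>\<And>f. f \<in> borel_measurable borel \<Longrightarrow> f \<in> borel_measurable ?\<mu>\<close>)
  define D where "D = (\<integral>\<^sup>+z. 1 - expneg (ennreal (1 - t) * shot r \<alpha> \<tau> z) \<partial>?\<mu>)"
  have cn: "(\<integral>\<^sup>+z. poisw (Suc n) (shot r \<alpha> \<tau> z) \<partial>?\<mu>) = ennreal (c (Suc n))" for n
    unfolding c_def by (rule shot_intensity_poisw[OF r \<alpha> a \<tau> zero_less_Suc])
  have "D + (\<Sum>n. ennreal (c (Suc n) * t ^ Suc n))
      = D + (\<Sum>n. \<integral>\<^sup>+z. ennreal (t ^ Suc n) * poisw (Suc n) (shot r \<alpha> \<tau> z) \<partial>?\<mu>)"
    unfolding nn_integral_cmult[OF m3] cn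
    by (intro arg_cong2[where f="(+)"] refl suminf_cong)
       (subst mult.commute, rule ennreal_mult, use t c in auto)
  also have "\<dots> = D + (\<integral>\<^sup>+z. (\<Sum>n. ennreal (t ^ Suc n) * poisw (Suc n) (shot r \<alpha> \<tau> z)) \<partial>?\<mu>)"
    by (subst nn_integral_suminf[OF m2]) simp
  also have "\<dots> = (\<integral>\<^sup>+z. (1 - expneg (ennreal (1 - t) * shot r \<alpha> \<tau> z)) + (\<Sum>n. ennreal (t ^ Suc n) * poisw (Suc n) (shot r \<alpha> \<tau> z)) \<partial>?\<mu>)"
    unfolding D_def by (intro nn_integral_add[symmetric] m1 borel_measurable_suminf_order m2)
  also have "\<dots> = (\<integral>\<^sup>+z. 1 - expneg (shot r \<alpha> \<tau> z) \<partial>?\<mu>)"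
    by (intro nn_integral_cong expneg_thinning t shot_neq_top)
  also have "\<dots> = ennreal (c 0)"
    unfolding c_def by (rule shot_intensity_expneg[OF r \<alpha> a \<tau>])
  finally have eq: "D + (\<Sum>n. ennreal (c (Suc n) * t ^ Suc n)) = ennreal (c 0)" .
  then have "D + (\<Sum>n. ennreal (c (Suc n) * t ^ Suc n)) \<noteq> Orderings.top"
    by (simp only: ennreal_neq_top not_False_eq_True)
  then have fin: "(\<Sum>n. ennreal (c (Suc n) * t ^ Suc n)) \<noteq> Orderings.top" "D \<noteq> Orderings.top"
    unfolding ennreal_add_eq_top by blast+
  have nn: "0 \<le> c (Suc n) * t ^ Suc n" for n using c t by simp
  have sm: "summable (\<lambda>n. c (Suc n) * t ^ Suc n)"
    using fin nn by (intro summable_suminf_not_top)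
  define S where "S = (\<Sum>n. c (Suc n) * t ^ Suc n)"
  have S: "(\<lambda>n. c (Suc n) * t ^ Suc n) sums S" using sm by (simp add: S_def summable_sums)
  have S0: "0 \<le> S" unfolding S_def by (intro suminf_nonneg sm nn)
  have "(\<Sum>n. ennreal (c (Suc n) * t ^ Suc n)) = ennreal S"
    using S nn by (intro suminf_ennreal_eq)
  with eq have eq': "D + ennreal S = ennreal (c 0)" by simp
  obtain d where d: "0 \<le> d" "D = ennreal d" using fin(2) by (metis ennreal_cases)
  have "d + S = c 0"
    using eq' d S0 c[of 0] by (simp flip: ennreal_plus)
  then have "S \<le> c 0" "D = ennreal (c 0 - S)" using d by auto
  then show ?thesis using that S unfolding D_def by blast
qed

text \<open>A Gamma variable of shape \<open>N\<close> is the N-th arrival time of a unit-rate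
  Poisson process: it exceeds \<open>y\<close> when fewer than \<open>N\<close> points lie in
  \<open>[0, y]\<close>.\<close>

lemma nn_integral_gamma_tail:
  fixes y :: real
  assumes y: "0 \<le> y" and N: "0 < N"
  shows "(\<integral>\<^sup>+g. ennreal (if 0 < g then g ^ (N - 1) * exp (- g) / fact (N - 1) else 0) * indicator {y..} g \<partial>lborel)
    = (\<Sum>m<N. poisw m (ennreal y))"
proof -
  define I where "I = (\<integral>\<^sup>+g. ennreal (erlang_density (N - 1) 1 g) * indicator {y<..} g \<partial>lborel)"
  have "(\<integral>\<^sup>+g. ennreal (if 0 < g then g ^ (N - 1) * exp (- g) / fact (N - 1) else 0) * indicator {y..} g \<partial>lborel) = I"
    unfolding I_def using AE_lborel_singleton[of 0] AE_lborel_singleton[of y]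
    by (intro nn_integral_cong_AE, eventually_elim) (auto simp: erlang_density_def split: split_indicator)
  moreover have "(\<integral>\<^sup>+g. ennreal (erlang_density (N - 1) 1 g) * indicator {..y} g \<partial>lborel) + I = 1"
  proof -
    have "(\<integral>\<^sup>+g. ennreal (erlang_density (N - 1) 1 g) * indicator {..y} g \<partial>lborel) + I
        = (\<integral>\<^sup>+g. ennreal (erlang_density (N - 1) 1 g) * indicator {..y} g + ennreal (erlang_density (N - 1) 1 g) * indicator {y<..} g \<partial>lborel)"
      unfolding I_def by (intro nn_integral_add[symmetric]) auto
    also have "\<dots> = (\<integral>\<^sup>+g. ennreal (erlang_density (N - 1) 1 g * g ^ 0) \<partial>lborel)"
      by (intro nn_integral_cong) (auto split: split_indicator)
    also have "\<dots> = 1" using nn_integral_erlang_ith_moment[of 1 "N - 1" 0] by simp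
    finally show ?thesis .
  qed
  moreover define s where "s = (\<Sum>n\<le>N - 1. y ^ n * exp (- y) / fact n)"
  have "erlang_CDF (N - 1) 1 y = 1 - s" using y by (simp add: erlang_CDF_def s_def)
  moreover have "0 \<le> erlang_CDF (N - 1) 1 y" "0 \<le> s"
    using y by (auto simp: s_def intro!: sum_nonneg)
  ultimately have "ennreal (1 - s) + I = ennreal (1 - s) + ennreal s"
    using nn_integral_erlang_density[where l=1 and a=y and k="N - 1"] y by (simp flip: ennreal_plus)
  then have "I = ennreal s" by (simp add: ennreal_add_left_cancel)
  also have "s = (\<Sum>m<N. exp (- y) * y ^ m / fact m)"
    unfolding s_def using N by (intro sum.cong) auto
  also have "ennreal \<dots> = (\<Sum>m<N. poisw m (ennreal y))"
    using y by (simp add: poisw_ennreal)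
  finally show ?thesis
    using \<open>_ = I\<close> by simp
qed

section \<open>Measurability of the interference\<close>

text \<open>The threshold varies with \<open>x\<close> together with the configuration, so
  measurability for a fixed integrand does not apply directly. A supremum over the rational
  thresholds at or above \<open>\<rho> x\<close> reduces it to countably many fixed ones.\<close>

lemma measurable_nn_integral_pp_space_threshold:
  fixes h :: "'b::topological_space \<Rightarrow> ennreal" and g :: "'b \<Rightarrow> real" and \<rho> :: "'x \<Rightarrow> real"
  assumes [measurable]: "h \<in> borel_measurable borel" "g \<in> borel_measurable borel" "\<rho> \<in> borel_measurable N"
    "F \<in> measurable N (pp_space borel)"
  shows "(\<lambda>x. \<integral>\<^sup>+z. h z * indicator {z. \<rho> x < g z} z \<partial>count_space (F x)) \<in> borel_measurable N"
proof -
  define H where "H q x = (\<integral>\<^sup>+z. h z * indicator {z. q < g z} z \<partial>count_space (F x))" for q x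
  have [measurable]: "H q \<in> borel_measurable N" for q
    unfolding H_def by (rule measurable_compose[OF assms(4) measurable_nn_integral_pp_space]) measurable
  have eq: "(\<integral>\<^sup>+z. h z * indicator {z. \<rho> x < g z} z \<partial>count_space (F x))
      = (SUP q\<in>\<rat>. indicator {x. \<rho> x \<le> q} x * H q x)" for x
  proof (rule antisym)
    have "(\<integral>\<^sup>+z. h z * indicator {z. \<rho> x < g z} z \<partial>count_space (F x))
       = (\<integral>\<^sup>+z. (SUP n. h z * indicator {z. \<rho> x + 1 / real (Suc n) < g z} z) \<partial>count_space (F x))"
    proof (intro nn_integral_cong antisym)
      fix z
      show "h z * indicator {z. \<rho> x < g z} z \<le> (SUP n. h z * indicator {z. \<rho> x + 1 / real (Suc n) < g z} z)"
      proof (cases "\<rho> x < g z")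
        case True
        then obtain n where "inverse (real (Suc n)) < g z - \<rho> x"
          using reals_Archimedean[of "g z - \<rho> x"] by auto
        then show ?thesis
          using True by (intro SUP_upper2[of n]) (auto simp: inverse_eq_divide split: split_indicator)
      qed simp
      show "(SUP n. h z * indicator {z. \<rho> x + 1 / real (Suc n) < g z} z) \<le> h z * indicator {z. \<rho> x < g z} z"
      proof (intro SUP_least)
        fix n
        have "0 < 1 / real (Suc n)" by simp
        then have "\<rho> x < g z" if "\<rho> x + 1 / real (Suc n) < g z" using that by linarith
        then show "h z * indicator {z. \<rho> x + 1 / real (Suc n) < g z} z \<le> h z * indicator {z. \<rho> x < g z} z"
          by (auto split: split_indicator)
      qed
    qed
    also have "\<dots> = (SUP n. H (\<rho> x + 1 / real (Suc n)) x)"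
      unfolding H_def
    proof (intro nn_integral_monotone_convergence_SUP)
      show "incseq (\<lambda>n z. h z * indicator {z. \<rho> x + 1 / real (Suc n) < g z} z)"
      proof (intro incseq_SucI le_funI)
        fix n z
        have "1 / real (Suc (Suc n)) \<le> 1 / real (Suc n)" by (intro divide_left_mono) auto
        then show "h z * indicator {z. \<rho> x + 1 / real (Suc n) < g z} z \<le> h z * indicator {z. \<rho> x + 1 / real (Suc (Suc n)) < g z} z"
          by (auto split: split_indicator)
      qed
    qed auto
    also have "\<dots> \<le> (SUP q\<in>\<rat>. indicator {x. \<rho> x \<le> q} x * H q x)"
    proof (intro SUP_least)
      fix n
      obtain q where q: "q \<in> \<rat>" "\<rho> x < q" "q < \<rho> x + 1 / real (Suc n)"
        using Rats_dense_in_real[of "\<rho> x" "\<rho> x + 1 / real (Suc n)"] by auto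
      have "H (\<rho> x + 1 / real (Suc n)) x \<le> H q x"
        unfolding H_def using q by (intro nn_integral_mono) (auto split: split_indicator)
      then show "H (\<rho> x + 1 / real (Suc n)) x \<le> (SUP q\<in>\<rat>. indicator {x. \<rho> x \<le> q} x * H q x)"
        using q by (intro SUP_upper2[of q]) auto
    qed
    finally show "(\<integral>\<^sup>+z. h z * indicator {z. \<rho> x < g z} z \<partial>count_space (F x)) \<le> (SUP q\<in>\<rat>. indicator {x. \<rho> x \<le> q} x * H q x)" .
  next
    show "(SUP q\<in>\<rat>. indicator {x. \<rho> x \<le> q} x * H q x) \<le> (\<integral>\<^sup>+z. h z * indicator {z. \<rho> x < g z} z \<partial>count_space (F x))"
    proof (intro SUP_least)
      fix q
      have "H q x \<le> (\<integral>\<^sup>+z. h z * indicator {z. \<rho> x < g z} z \<partial>count_space (F x))" if "\<rho> x \<le> q"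
        unfolding H_def using that by (intro nn_integral_mono) (auto split: split_indicator)
      then show "indicator {x. \<rho> x \<le> q} x * H q x \<le> (\<integral>\<^sup>+z. h z * indicator {z. \<rho> x < g z} z \<partial>count_space (F x))"
        by (auto split: split_indicator)
    qed
  qed
  have "(\<lambda>x. SUP q\<in>\<rat>. indicator {x. \<rho> x \<le> q} x * H q x) \<in> borel_measurable N"
    by (intro borel_measurable_SUP countable_rat) (measurable)
  then show ?thesis unfolding eq .
qed

lemma nn_integral_count_space_restrict:
  "(\<integral>\<^sup>+z. f z \<partial>count_space {z\<in>F. Q z}) = (\<integral>\<^sup>+z. f z * indicator {z. Q z} z \<partial>count_space F)"
proof -
  have "(\<integral>\<^sup>+z. f z \<partial>count_space {z\<in>F. Q z}) = (\<integral>\<^sup>+z. f z * indicator {z\<in>F. Q z} z \<partial>count_space UNIV)"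
    by (cases "{z\<in>F. Q z} = UNIV") (auto simp: nn_integral_count_space_indicator)
  also have "\<dots> = (\<integral>\<^sup>+z. f z * indicator {z. Q z} z * indicator F z \<partial>count_space UNIV)"
    by (intro nn_integral_cong) (auto split: split_indicator)
  also have "\<dots> = (\<integral>\<^sup>+z. f z * indicator {z. Q z} z \<partial>count_space F)"
    by (cases "F = UNIV") (auto simp: nn_integral_count_space_indicator)
  finally show ?thesis .
qed

lemma measurable_infsum_pp_space_threshold:
  fixes h :: "'b::topological_space \<Rightarrow> real" and g :: "'b \<Rightarrow> real" and \<rho> :: "'x \<Rightarrow> real"
  assumes [measurable]: "h \<in> borel_measurable borel" "g \<in> borel_measurable borel" "\<rho> \<in> borel_measurable N"
    "F \<in> measurable N (pp_space borel)"
  shows "(\<lambda>x. infsum h {z \<in> F x. \<rho> x < g z}) \<in> borel_measurable N"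
proof -
  have [measurable]: "(\<lambda>x. \<integral>\<^sup>+z. ennreal (h z) * indicator {z. \<rho> x < g z} z \<partial>count_space (F x)) \<in> borel_measurable N"
    "(\<lambda>x. \<integral>\<^sup>+z. ennreal (- h z) * indicator {z. \<rho> x < g z} z \<partial>count_space (F x)) \<in> borel_measurable N"
    by (intro measurable_nn_integral_pp_space_threshold; measurable)+
  show ?thesis
    unfolding infsum_eq_enn2real_diff nn_integral_count_space_restrict by measurable
qed

lemma measurable_interference [measurable]:
  assumes [measurable]: "X \<in> borel_measurable N" "\<And>j. j \<in> {1..K} \<Longrightarrow> F j \<in> measurable N (pp_space borel)"
  shows "(\<lambda>x. interference K P Om \<alpha> k (\<lambda>j. F j x) (X x)) \<in> borel_measurable N"
  unfolding interference_def
proof (intro borel_measurable_sum)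
  fix j assume j: "j \<in> {1..K}"
  have "(\<lambda>x. infsum (\<lambda>z. P j * snd z * norm (fst z) powr (- \<alpha> j))
      {z \<in> F j x. (Om j / Om k) powr (1 / \<alpha> j) * X x powr (\<alpha> k / \<alpha> j) < norm (fst z)}) \<in> borel_measurable N"
    using j by (intro measurable_infsum_pp_space_threshold) measurable
  then show "(\<lambda>x. infsum (\<lambda>(y, v). P j * v * norm y powr (- \<alpha> j))
      {(y, v) \<in> F j x. (Om j / Om k) powr (1 / \<alpha> j) * X x powr (\<alpha> k / \<alpha> j) < norm y}) \<in> borel_measurable N"
    unfolding case_prod_beta prod.collapse .
qed

section \<open>Powers, Erlang integrals and product laws\<close>

lemma continuous_on_powr_const: "0 < c \<Longrightarrow> continuous_on {0..} (\<lambda>u::real. u powr c)"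
  by (intro continuous_on_powr' continuous_intros) auto

lemma integral_erlang:
  fixes l a :: real
  assumes "0 < l" "0 \<le> a"
  shows "integral {0..a} (\<lambda>u. l ^ Suc i * u ^ i * exp (- l * u) / fact i) = 1 - (\<Sum>n\<le>i. (l * a) ^ n / fact n * exp (- l * a))"
proof -
  have "(\<integral>\<^sup>+u. ennreal (erlang_density i l u * indicator {..a} u) \<partial>lborel) = ennreal (erlang_CDF i l a)"
    using nn_integral_erlang_density[OF assms(1), where a=a and k=i]
    by (simp add: ennreal_mult' ennreal_indicator[symmetric] assms less_imp_le del: ennreal_indicator)
  then have "((\<lambda>u. erlang_density i l u * indicator {..a} u) has_integral erlang_CDF i l a) UNIV"
    using assms by (intro nn_integral_has_integral) auto
  also have "(\<lambda>u. erlang_density i l u * indicator {..a} u) = (\<lambda>u. if u \<in> {0..a} then l ^ Suc i * u ^ i * exp (- l * u) / fact i else 0)"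
    by (auto simp: erlang_density_def fun_eq_iff split: split_indicator)
  finally have "((\<lambda>u. l ^ Suc i * u ^ i * exp (- l * u) / fact i) has_integral erlang_CDF i l a) {0..a}"
    by (simp only: has_integral_restrict_UNIV)
  then have "integral {0..a} (\<lambda>u. l ^ Suc i * u ^ i * exp (- l * u) / fact i) = erlang_CDF i l a"
    by (rule integral_unique)
  also have "\<dots> = 1 - (\<Sum>n\<le>i. (l * a) ^ n / fact n * exp (- l * a))"
    using assms by (simp add: erlang_CDF_def)
  finally show ?thesis .
qed

lemma (in prob_space) distr_pair_indep_set:
  assumes X[measurable]: "X \<in> measurable M S" and Y[measurable]: "Y \<in> measurable M T"
    and ind: "indep_set {X -` A \<inter> space M | A. A \<in> sets S} {Y -` A \<inter> space M | A. A \<in> sets T}"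
  shows "distr M (S \<Otimes>\<^sub>M T) (\<lambda>\<omega>. (X \<omega>, Y \<omega>)) = distr M S X \<Otimes>\<^sub>M distr M T Y"
proof (rule pair_measure_eqI[symmetric])
  interpret X: prob_space "distr M S X" by (rule prob_space_distr) fact
  interpret Y: prob_space "distr M T Y" by (rule prob_space_distr) fact
  show "sigma_finite_measure (distr M S X)" "sigma_finite_measure (distr M T Y)"
    by unfold_locales
  show "sets (distr M S X \<Otimes>\<^sub>M distr M T Y) = sets (distr M (S \<Otimes>\<^sub>M T) (\<lambda>\<omega>. (X \<omega>, Y \<omega>)))"
    by (simp cong: sets_pair_measure_cong)
  fix A B assume "A \<in> sets (distr M S X)" "B \<in> sets (distr M T Y)"
  then have A[measurable]: "A \<in> sets S" and B[measurable]: "B \<in> sets T" by auto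
  have "prob ((X -` A \<inter> space M) \<inter> (Y -` B \<inter> space M)) = prob (X -` A \<inter> space M) * prob (Y -` B \<inter> space M)"
    using A B by (intro indep_setD[OF ind]) auto
  moreover have "(\<lambda>\<omega>. (X \<omega>, Y \<omega>)) -` (A \<times> B) \<inter> space M = (X -` A \<inter> space M) \<inter> (Y -` B \<inter> space M)"
    by auto
  ultimately show "emeasure (distr M S X) A * emeasure (distr M T Y) B
      = emeasure (distr M (S \<Otimes>\<^sub>M T) (\<lambda>\<omega>. (X \<omega>, Y \<omega>))) (A \<times> B)"
    by (simp add: emeasure_distr emeasure_eq_measure ennreal_mult)
qed

section \<open>The network model\<close>

text \<open>The processes live on the whole plane and are independent of the serving distance;
  \<open>interference\<close> discards the points inside the disk. Since restrictions of Poisson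
  processes are Poisson, this realises the law of the interferers given the serving distance. The
  fading of an interferer is the last component of its point.\<close>

locale downlink_network = prob_space M for M :: "'w measure" +
  fixes K k :: nat and lam P Bs \<alpha> :: "nat \<Rightarrow> real" and Mn :: "nat \<Rightarrow> nat"
    and lu \<epsilon> \<beta> :: real and X G :: "'w \<Rightarrow> real"
    and \<Phi> :: "nat \<Rightarrow> 'w \<Rightarrow> ((real \<times> real) \<times> real) set"
    and Om A :: "nat \<Rightarrow> real" and T R :: real
  assumes Om_def: "Om = (\<lambda>j. P j * real (Mn j) * Bs j)"
    and A_def: "A = activ K lam lu Om \<alpha> \<epsilon>"
    and T_def: "T = assocT K lam Om \<alpha> \<epsilon> k"
    and R_def: "R = radius Om \<alpha> \<epsilon> k"
    and k: "k \<in> {1..K}"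
    and pos: "\<forall>j\<in>{1..K}. lam j > 0 \<and> P j > 0 \<and> Bs j > 0 \<and> \<alpha> j > 2 \<and> Mn j \<ge> 1"
    and lu: "lu > 0" and eps: "\<epsilon> > 0" and beta: "\<beta> > 0"
    and X: "distributed M lborel X (\<lambda>x. ennreal (if 0 < x \<and> x \<le> R then
              2 * pi * lam k / T * x * exp (- pi * (\<Sum>j=1..K. lam j * (Om j / Om k) powr (2 / \<alpha> j)
                 * x powr (2 * ((2 / \<alpha> j) / (2 / \<alpha> k))))) else 0))"
    and G: "distributed M lborel G (\<lambda>g. ennreal (if 0 < g then
              g ^ (Mn k - 1) * exp (- g) / fact (Mn k - 1) else 0))"
    and PPP: "\<forall>j\<in>{1..K}. poisson_pp M (marked_intensity (A j * lam j)) (\<Phi> j)"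
    and indep_\<Phi>: "indep_vars (\<lambda>_. pp_space (borel :: ((real \<times> real) \<times> real) measure)) \<Phi> {1..K}"
    and measurable_XG: "(\<lambda>\<omega>. (X \<omega>, G \<omega>)) \<in> measurable M (borel \<Otimes>\<^sub>M borel)"
    and measurable_\<Phi>s: "(\<lambda>\<omega>. restrict (\<lambda>j. \<Phi> j \<omega>) {1..K})
                 \<in> measurable M (PiM {1..K} (\<lambda>_. pp_space (borel :: ((real \<times> real) \<times> real) measure)))"
    and indep_XG_\<Phi>s: "indep_set
          {(\<lambda>\<omega>. (X \<omega>, G \<omega>)) -` S \<inter> space M | S. S \<in> sets (borel \<Otimes>\<^sub>M borel)}
          {(\<lambda>\<omega>. restrict (\<lambda>j. \<Phi> j \<omega>) {1..K}) -` S \<inter> space M | S.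
             S \<in> sets (PiM {1..K} (\<lambda>_. pp_space (borel :: ((real \<times> real) \<times> real) measure)))}"
    and indep_XG: "indep_var borel X borel G"
begin

definition rho :: "nat \<Rightarrow> real \<Rightarrow> real" where
  "rho j x = (Om j / Om k) powr (1 / \<alpha> j) * x powr (\<alpha> k / \<alpha> j)"

abbreviation ta :: "nat \<Rightarrow> real" where
  "ta j \<equiv> tau Mn Bs \<beta> j k"

definition shot_sum :: "nat \<Rightarrow> real \<Rightarrow> 'w \<Rightarrow> ennreal" where
  "shot_sum j x \<omega> = (\<integral>\<^sup>+z. shot (rho j x) (\<alpha> j) (ta j) z \<partial>count_space (\<Phi> j \<omega>))"

text \<open>The factor \<open>\<beta> * x powr \<alpha> k / P k\<close> is absorbed into
  \<open>ta\<close>, so that coverage will mean that the gain is at least \<open>total\<close>, with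
  no division left.\<close>

definition total :: "real \<Rightarrow> 'w \<Rightarrow> ennreal" where
  "total x \<omega> = (\<Sum>j=1..K. shot_sum j x \<omega>)"

abbreviation g :: "nat \<Rightarrow> real \<Rightarrow> real" where
  "g n u \<equiv> gfun K lam A Om \<alpha> Mn Bs \<beta> k n u"

abbreviation intf :: "real \<Rightarrow> 'w \<Rightarrow> real" where
  "intf x \<omega> \<equiv> interference K P Om \<alpha> k (\<lambda>j. \<Phi> j \<omega>) x"

section \<open>Positivity of the model quantities\<close>

lemma posD: assumes "j \<in> {1..K}"
  shows "lam j > 0" "P j > 0" "Bs j > 0" "\<alpha> j > 2" "\<alpha> j > 0" "Mn j > 0" "Om j > 0" "ta j > 0"
proof -
  show 1: "lam j > 0" "P j > 0" "Bs j > 0" "\<alpha> j > 2" "\<alpha> j > 0" "Mn j > 0"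
    using bspec[OF pos assms] by auto
  have 2: "Bs k > 0" "Mn k > 0" using bspec[OF pos k] by auto
  show "Om j > 0" using 1 by (simp add: Om_def)
  show "ta j > 0" using 1 2 beta by (simp add: tau_def)
qed

lemma radius_pos: "j \<in> {1..K} \<Longrightarrow> radius Om \<alpha> \<epsilon> j > 0"
  using posD[of j] eps by (simp add: radius_def)

lemma R_pos: "0 < R"
  unfolding R_def using k by (rule radius_pos)

lemma delta_ratio_pos: "j \<in> {1..K} \<Longrightarrow> l \<in> {1..K} \<Longrightarrow> 0 < (2 / \<alpha> j) / (2 / \<alpha> l)"
  using posD by simp

lemma continuous_on_assoc_int: "j \<in> {1..K} \<Longrightarrow> continuous_on {0..} (assoc_int K lam Om \<alpha> j)"
  unfolding assoc_int_def
  by (intro continuous_intros continuous_on_powr_const delta_ratio_pos) auto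

lemma integral_assoc_int_pos:
  assumes j: "j \<in> {1..K}"
  shows "0 < integral {0..(radius Om \<alpha> \<epsilon> j)\<^sup>2} (assoc_int K lam Om \<alpha> j)"
proof -
  let ?f = "assoc_int K lam Om \<alpha> j" and ?r = "(radius Om \<alpha> \<epsilon> j)\<^sup>2"
  have r: "0 < ?r" using radius_pos[OF j] by simp
  have cont: "continuous_on {0..?r} ?f"
    using continuous_on_assoc_int[OF j] by (rule continuous_on_subset) auto
  obtain u where u: "u \<in> {0..?r}" "\<And>v. v \<in> {0..?r} \<Longrightarrow> ?f u \<le> ?f v"
    using continuous_attains_inf[OF compact_Icc _ cont] r by auto
  have "0 < ?f u" by (simp add: assoc_int_def)
  then have "0 < ?f u * ?r" using r by simp
  also have "\<dots> = integral {0..?r} (\<lambda>_. ?f u)" using r by simp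
  also have "\<dots> \<le> integral {0..?r} ?f"
    using u by (intro integral_le integrable_continuous_interval cont) auto
  finally show ?thesis .
qed

text \<open>If no tier were active, the interference would vanish and a quotient by 0 would decide
  the outage. Positivity makes the intensity of contributing interferers infinite.\<close>

lemma A_pos: "j \<in> {1..K} \<Longrightarrow> 0 < A j"
  unfolding A_def activ_def using integral_assoc_int_pos[of j] lu by simp

lemma T_pos: "0 < T"
  unfolding T_def assocT_def using integral_assoc_int_pos[OF k] posD[OF k] by simp

lemma rho_pos: "j \<in> {1..K} \<Longrightarrow> 0 < x \<Longrightarrow> 0 < rho j x"
  unfolding rho_def using posD[of j] posD[OF k] by simp

lemma rho_square:
  assumes "j \<in> {1..K}" "0 < x"
  shows "(rho j x)\<^sup>2 = (Om j / Om k) powr (2 / \<alpha> j) * (x\<^sup>2) powr ((2 / \<alpha> j) / (2 / \<alpha> k))"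
proof -
  have "(x\<^sup>2) powr ((2 / \<alpha> j) / (2 / \<alpha> k)) = x powr (2 * (\<alpha> k / \<alpha> j))"
    using assms posD[of j] posD[OF k] by (simp add: powr_powr flip: powr_numeral)
  then show ?thesis
    using assms posD[of j] posD[OF k]
    by (simp add: rho_def power_mult_distrib powr_power mult.commute)
qed

lemma rho_powr:
  assumes "j \<in> {1..K}" "0 < x"
  shows "rho j x powr \<alpha> j = Om j / Om k * x powr \<alpha> k"
  using assms posD[of j] posD[OF k] by (simp add: rho_def powr_mult powr_powr)

text \<open>Apart from \<open>varphi\<close>, each summand of \<open>gfun\<close> is the intensity
  of active stations times the squared exclusion radius. The argument is the squared serving
  distance, the variable in which the outage formula integrates.\<close>

lemma pi_g_eq:
  assumes "0 < x"
  shows "pi * g n (x\<^sup>2) = (\<Sum>j=1..K. pi * (A j * lam j * (rho j x)\<^sup>2 * varphi (2 / \<alpha> j) (ta j) n))"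
  unfolding gfun_def sum_distrib_left using assms
  by (intro sum.cong refl) (simp add: rho_square mult_ac)

lemma varphi_pos: "j \<in> {1..K} \<Longrightarrow> 0 \<le> varphi (2 / \<alpha> j) (ta j) n"
  using posD[of j] by (intro varphi_nonneg) auto

lemma g_nonneg: "0 \<le> g n u"
  unfolding gfun_def using A_pos posD varphi_pos
  by (intro sum_nonneg mult_nonneg_nonneg) (auto intro: less_imp_le)

section \<open>Almost sure properties of the interference\<close>

lemma measurable_\<Phi> [measurable]: "j \<in> {1..K} \<Longrightarrow> \<Phi> j \<in> measurable M (pp_space borel)"
  using indep_\<Phi> by (auto simp: indep_vars_def)

lemma measurable_shot_sum [measurable]: "j \<in> {1..K} \<Longrightarrow> shot_sum j x \<in> borel_measurable M"
  unfolding shot_sum_def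
  by (rule measurable_compose[OF measurable_\<Phi> measurable_nn_integral_pp_space]) measurable

lemma measurable_total [measurable]: "total x \<in> borel_measurable M"
  unfolding total_def by (intro borel_measurable_sum measurable_shot_sum)

text \<open>The marked intensity gives no mass to negative marks, and Campbell's formula makes this
  an almost sure statement. It is what makes all summands of the interference nonnegative.\<close>

lemma AE_marks_nonneg:
  assumes j: "j \<in> {1..K}"
  shows "AE \<omega> in M. \<forall>z\<in>\<Phi> j \<omega>. 0 \<le> snd z"
proof -
  have pp: "poisson_pp M (marked_intensity (A j * lam j)) (\<Phi> j)" using PPP j by blast
  let ?B = "{z :: (real \<times> real) \<times> real. snd z < 0}"
  have B[measurable]: "?B \<in> sets borel" by measurable
  have "(\<integral>\<^sup>+\<omega>. (\<integral>\<^sup>+z. indicator ?B z \<partial>count_space (\<Phi> j \<omega>)) \<partial>M) = (\<integral>\<^sup>+z. indicator ?B z \<partial>marked_intensity (A j * lam j))"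
    by (rule poisson_pp_campbell[OF pp sigma_finite_marked_intensity sets_marked_intensity measurable_\<Phi>[OF j]]) measurable
  also have "\<dots> = (\<integral>\<^sup>+z. ennreal (A j * lam j * (if 0 \<le> snd z then exp (- snd z) else 0)) * indicator ?B z \<partial>lborel)"
    unfolding marked_intensity_def by (subst nn_integral_density) auto
  also have "\<dots> = (\<integral>\<^sup>+(z :: (real \<times> real) \<times> real). 0 \<partial>lborel)"
    by (intro nn_integral_cong) (auto split: split_indicator)
  finally have "(\<integral>\<^sup>+\<omega>. (\<integral>\<^sup>+z. indicator ?B z \<partial>count_space (\<Phi> j \<omega>)) \<partial>M) = 0" by simp
  moreover have "(\<lambda>\<omega>. \<integral>\<^sup>+z. indicator ?B z \<partial>count_space (\<Phi> j \<omega>)) \<in> borel_measurable M"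
    by (rule measurable_compose[OF measurable_\<Phi>[OF j] measurable_nn_integral_pp_space]) measurable
  ultimately have "AE \<omega> in M. (\<integral>\<^sup>+z. indicator ?B z \<partial>count_space (\<Phi> j \<omega>)) = 0"
    by (simp add: nn_integral_0_iff_AE)
  then show ?thesis
  proof eventually_elim
    case (elim \<omega>)
    then have "\<Phi> j \<omega> \<inter> ?B = {}"
      unfolding nn_integral_count_space_indicator_card by (auto split: if_splits)
    then show ?case by force
  qed
qed

lemma AE_shot_sum_finite:
  assumes j: "j \<in> {1..K}" and x: "0 < x"
  shows "AE \<omega> in M. shot_sum j x \<omega> \<noteq> \<infinity>"
proof (rule nn_integral_PInf_AE)
  have pp: "poisson_pp M (marked_intensity (A j * lam j)) (\<Phi> j)" using PPP j by blast
  have "(\<integral>\<^sup>+\<omega>. shot_sum j x \<omega> \<partial>M) = (\<integral>\<^sup>+z. shot (rho j x) (\<alpha> j) (ta j) z \<partial>marked_intensity (A j * lam j))"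
    unfolding shot_sum_def
    by (rule poisson_pp_campbell[OF pp sigma_finite_marked_intensity sets_marked_intensity measurable_\<Phi>[OF j]]) measurable
  also have "\<dots> < \<infinity>"
    using posD[OF j] A_pos[OF j] by (intro shot_intensity_mean rho_pos[OF j x]) auto
  finally show "(\<integral>\<^sup>+\<omega>. shot_sum j x \<omega> \<partial>M) \<noteq> \<infinity>" by simp
qed (use j in measurable)

text \<open>Vanishing interference would count as an outage, as \<open>x / 0 = 0\<close>. It has probability 0
  by the Laplace functional at infinity, because \<open>expneg (\<infinity> * J)\<close> is the indicator of \<open>J = 0\<close>.\<close>
lemma AE_shot_sum_pos:
  assumes j: "j \<in> {1..K}" and x: "0 < x"
  shows "AE \<omega> in M. shot_sum j x \<omega> \<noteq> 0"
proof -
  have pp: "poisson_pp M (marked_intensity (A j * lam j)) (\<Phi> j)" using PPP j by blast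
  have "(\<integral>\<^sup>+\<omega>. expneg (\<infinity> * shot_sum j x \<omega>) \<partial>M)
     = (\<integral>\<^sup>+\<omega>. expneg (\<integral>\<^sup>+z. \<infinity> * shot (rho j x) (\<alpha> j) (ta j) z \<partial>count_space (\<Phi> j \<omega>)) \<partial>M)"
    unfolding shot_sum_def by (subst nn_integral_cmult) auto
  also have "\<dots> = expneg (\<integral>\<^sup>+z. 1 - expneg (\<infinity> * shot (rho j x) (\<alpha> j) (ta j) z) \<partial>marked_intensity (A j * lam j))"
    by (rule poisson_pp_laplace[OF pp sigma_finite_marked_intensity sets_marked_intensity measurable_\<Phi>[OF j]]) measurable
  also have "\<dots> = 0"
    using posD[OF j] A_pos[OF j] by (subst shot_intensity_pos[OF rho_pos[OF j x]]) auto
  finally have "(\<integral>\<^sup>+\<omega>. expneg (\<infinity> * shot_sum j x \<omega>) \<partial>M) = 0" .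
  moreover have "(\<lambda>\<omega>. expneg (\<infinity> * shot_sum j x \<omega>)) \<in> borel_measurable M"
    using j by measurable
  ultimately have "AE \<omega> in M. expneg (\<infinity> * shot_sum j x \<omega>) = 0"
    by (simp add: nn_integral_0_iff_AE)
  then show ?thesis by eventually_elim auto
qed

text \<open>Origin of \<open>tau\<close>: on the rim of the disk
  \<open>Om j * rho j x powr (- \<alpha> j)\<close> equals
  \<open>Om k * x powr (- \<alpha> k)\<close>, and cancelling the transmit powers leaves
  \<open>\<beta>\<close> divided by the ratios of antenna numbers and biases.\<close>

lemma scale_shot:
  assumes j: "j \<in> {1..K}" and x: "0 < x"
  shows "ennreal (\<beta> * x powr \<alpha> k / P k) * (ennreal (P j * snd z * norm (fst z) powr (- \<alpha> j)) * indicator {z. rho j x < norm (fst z)} z)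
     = shot (rho j x) (\<alpha> j) (ta j) z"
proof (cases "rho j x < norm (fst z)")
  case True
  note p = posD[OF j] posD[OF k] rho_pos[OF j x]
  have n: "0 < norm (fst z)" using True p by linarith
  have "(norm (fst z) / rho j x) powr (- \<alpha> j) = norm (fst z) powr (- \<alpha> j) * (Om j / Om k * x powr \<alpha> k)"
    using n p rho_powr[OF j x] by (simp add: powr_divide powr_minus field_simps)
  moreover have "ta j * (Om j / Om k) = \<beta> * P j / P k"
    using p by (simp add: tau_def Om_def field_simps)
  ultimately have "ta j * (norm (fst z) / rho j x) powr (- \<alpha> j) = \<beta> * P j / P k * (x powr \<alpha> k * norm (fst z) powr (- \<alpha> j))"
    by (metis (no_types, opaque_lifting) mult.assoc mult.commute)
  then have "ta j * (norm (fst z) / rho j x) powr (- \<alpha> j) * snd z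
      = (\<beta> * x powr \<alpha> k / P k) * (P j * snd z * norm (fst z) powr (- \<alpha> j))"
    by simp
  moreover have "0 \<le> \<beta> * x powr \<alpha> k / P k" using p beta by simp
  ultimately show ?thesis
    using True by (simp add: shot_def case_prod_beta flip: ennreal_mult')
next
  case False
  then show ?thesis by (simp add: shot_def case_prod_beta)
qed

text \<open>\<open>infsum\<close> is compared with the counting integral through its positive and
  negative parts: \<open>marks\<close> kills the negative part and \<open>fin\<close> keeps the
  positive part finite.\<close>

lemma scaled_interference:
  assumes x: "0 < x" and marks: "\<And>j. j \<in> {1..K} \<Longrightarrow> \<forall>z\<in>\<Phi> j \<omega>. 0 \<le> snd z"
    and fin: "\<And>j. j \<in> {1..K} \<Longrightarrow> shot_sum j x \<omega> \<noteq> \<infinity>"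
  shows "\<beta> * x powr \<alpha> k / P k * intf x \<omega> = enn2real (total x \<omega>)"
proof -
  define s where "s = \<beta> * x powr \<alpha> k / P k"
  have s: "0 < s" using x beta posD[OF k] by (simp add: s_def)
  have summand: "s * infsum (\<lambda>(y, v). P j * v * norm y powr (- \<alpha> j))
        {(y, v) \<in> \<Phi> j \<omega>. norm y > (Om j / Om k) powr (1 / \<alpha> j) * x powr (\<alpha> k / \<alpha> j)} = enn2real (shot_sum j x \<omega>)"
    if j: "j \<in> {1..K}" for j
  proof -
    let ?h = "\<lambda>z. P j * snd z * norm (fst z) powr (- \<alpha> j)"
    let ?F = "{z \<in> \<Phi> j \<omega>. rho j x < norm (fst z)}"
    define p where "p = (\<integral>\<^sup>+z. ennreal (?h z) \<partial>count_space ?F)"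
    have "ennreal s * p = (\<integral>\<^sup>+z. ennreal s * (ennreal (?h z) * indicator {z. rho j x < norm (fst z)} z) \<partial>count_space (\<Phi> j \<omega>))"
      unfolding p_def nn_integral_count_space_restrict by (subst nn_integral_cmult) auto
    then have sp: "ennreal s * p = shot_sum j x \<omega>"
      unfolding s_def scale_shot[OF j x] shot_sum_def .
    have "p \<noteq> \<infinity>" using fin[OF j] s unfolding sp[symmetric] by (auto simp: ennreal_mult_eq_top_iff)
    moreover have "(\<integral>\<^sup>+z. ennreal (- ?h z) \<partial>count_space ?F) = 0"
    proof -
      have "(\<integral>\<^sup>+z. ennreal (- ?h z) \<partial>count_space ?F) = (\<integral>\<^sup>+z. 0 \<partial>count_space ?F)"
        using marks[OF j] posD[OF j] by (intro nn_integral_cong) (auto intro!: ennreal_neg)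
      then show ?thesis by simp
    qed
    ultimately have "infsum ?h ?F = enn2real p"
      unfolding infsum_eq_enn2real_diff p_def[symmetric] by (simp add: less_top)
    moreover have "s * enn2real p = enn2real (shot_sum j x \<omega>)"
      unfolding sp[symmetric] using s by (simp add: enn2real_mult)
    ultimately show ?thesis
      unfolding case_prod_beta prod.collapse rho_def by simp
  qed
  have "s * intf x \<omega> = (\<Sum>j=1..K. enn2real (shot_sum j x \<omega>))"
    unfolding interference_def sum_distrib_left by (intro sum.cong refl summand)
  also have "\<dots> = enn2real (total x \<omega>)"
    unfolding total_def using fin by (subst enn2real_sum) (auto simp: less_top)
  finally show ?thesis unfolding s_def .
qed

lemma AE_total:
  assumes x: "0 < x"
  shows "AE \<omega> in M. total x \<omega> \<noteq> \<infinity> \<and> total x \<omega> \<noteq> 0 \<and> \<beta> * x powr \<alpha> k / P k * intf x \<omega> = enn2real (total x \<omega>)"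
proof -
  have "AE \<omega> in M. \<forall>j\<in>{1..K}. (\<forall>z\<in>\<Phi> j \<omega>. 0 \<le> snd z) \<and> shot_sum j x \<omega> \<noteq> \<infinity> \<and> shot_sum j x \<omega> \<noteq> 0"
    using AE_marks_nonneg AE_shot_sum_finite[OF _ x] AE_shot_sum_pos[OF _ x]
    by (intro AE_finite_allI) (auto simp: AE_conj_iff)
  then show ?thesis
  proof eventually_elim
    case (elim \<omega>)
    then have "\<beta> * x powr \<alpha> k / P k * intf x \<omega> = enn2real (total x \<omega>)"
      using x by (intro scaled_interference) auto
    moreover have "total x \<omega> \<noteq> \<infinity>" using elim unfolding total_def by (simp add: sum_Pinfty)
    moreover have "total x \<omega> \<noteq> 0" using elim k unfolding total_def by (auto simp: sum_eq_0_iff)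
    ultimately show ?case by blast
  qed
qed

text \<open>Independence of the tiers multiplies their Laplace functionals, so the exponents add up
  over \<open>j\<close>, coefficient by coefficient.\<close>

lemma laplace_total:
  assumes x: "0 < x" and t: "0 \<le> t" "t < 1"
  shows "\<exists>C. (\<lambda>n. pi * g (Suc n) (x\<^sup>2) * t ^ Suc n) sums C \<and>
    (\<integral>\<^sup>+\<omega>. expneg (ennreal (1 - t) * total x \<omega>) \<partial>M) = ennreal (exp (C - pi * g 0 (x\<^sup>2)))"
proof -
  define c where "c j n = pi * (A j * lam j * (rho j x)\<^sup>2 * varphi (2 / \<alpha> j) (ta j) n)" for j n
  \<comment> \<open>Named so that a series value \<open>S j\<close> can be chosen for all tiers at
    once.\<close>
  define Q where "Q j S \<longleftrightarrow> (\<lambda>n. c j (Suc n) * t ^ Suc n) sums S \<and> S \<le> c j 0 \<and>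
     (\<integral>\<^sup>+z. 1 - expneg (ennreal (1 - t) * shot (rho j x) (\<alpha> j) (ta j) z) \<partial>marked_intensity (A j * lam j)) = ennreal (c j 0 - S)" for j S
  define S where "S j = (SOME s. Q j s)" for j
  have "Q j (S j)" if j: "j \<in> {1..K}" for j
  proof -
    have "0 \<le> A j * lam j" using A_pos[OF j] posD[OF j] by simp
    from shot_laplace_exponent[OF rho_pos[OF j x] posD(4)[OF j] this posD(8)[OF j] t]
    have "\<exists>s. Q j s" unfolding Q_def c_def by blast
    then show ?thesis unfolding S_def by (rule someI_ex)
  qed
  then have S: "\<And>j. j \<in> {1..K} \<Longrightarrow> (\<lambda>n. c j (Suc n) * t ^ Suc n) sums S j"
    "\<And>j. j \<in> {1..K} \<Longrightarrow> S j \<le> c j 0"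
    "\<And>j. j \<in> {1..K} \<Longrightarrow> (\<integral>\<^sup>+z. 1 - expneg (ennreal (1 - t) * shot (rho j x) (\<alpha> j) (ta j) z) \<partial>marked_intensity (A j * lam j)) = ennreal (c j 0 - S j)"
    unfolding Q_def by blast+
  have "(\<lambda>n. \<Sum>j=1..K. c j (Suc n) * t ^ Suc n) sums (\<Sum>j=1..K. S j)"
    using S(1) by (intro sums_sum) auto
  then have "(\<lambda>n. pi * g (Suc n) (x\<^sup>2) * t ^ Suc n) sums (\<Sum>j=1..K. S j)"
    unfolding pi_g_eq[OF x] c_def sum_distrib_right .
  moreover have "(\<integral>\<^sup>+\<omega>. expneg (ennreal (1 - t) * total x \<omega>) \<partial>M) = ennreal (exp ((\<Sum>j=1..K. S j) - pi * g 0 (x\<^sup>2)))"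
  proof -
    let ?Y = "\<lambda>j F. expneg (\<integral>\<^sup>+z. ennreal (1 - t) * shot (rho j x) (\<alpha> j) (ta j) z \<partial>count_space F)"
    have "(\<integral>\<^sup>+\<omega>. expneg (ennreal (1 - t) * total x \<omega>) \<partial>M) = (\<integral>\<^sup>+\<omega>. (\<Prod>j\<in>{1..K}. ?Y j (\<Phi> j \<omega>)) \<partial>M)"
      unfolding total_def shot_sum_def sum_distrib_left by (subst expneg_sum) (auto simp: nn_integral_cmult)
    also have "\<dots> = (\<Prod>j\<in>{1..K}. \<integral>\<^sup>+\<omega>. ?Y j (\<Phi> j \<omega>) \<partial>M)"
    proof (intro indep_vars_nn_integral indep_vars_compose2[OF indep_\<Phi>])
      fix j
      show "?Y j \<in> borel_measurable (pp_space borel)"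
        by (rule measurable_compose[OF measurable_nn_integral_pp_space borel_measurable_expneg]) measurable
    qed auto
    also have "\<dots> = (\<Prod>j\<in>{1..K}. expneg (ennreal (c j 0 - S j)))"
    proof (intro prod.cong refl)
      fix j assume j: "j \<in> {1..K}"
      have pp: "poisson_pp M (marked_intensity (A j * lam j)) (\<Phi> j)" using PPP j by blast
      show "(\<integral>\<^sup>+\<omega>. ?Y j (\<Phi> j \<omega>) \<partial>M) = expneg (ennreal (c j 0 - S j))"
        unfolding S(3)[OF j, symmetric]
        by (rule poisson_pp_laplace[OF pp sigma_finite_marked_intensity sets_marked_intensity measurable_\<Phi>[OF j]]) measurable
    qed
    also have "\<dots> = expneg (\<Sum>j\<in>{1..K}. ennreal (c j 0 - S j))"
      by (simp add: expneg_sum)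
    also have "(\<Sum>j\<in>{1..K}. ennreal (c j 0 - S j)) = ennreal (\<Sum>j\<in>{1..K}. c j 0 - S j)"
      using S(2) by (intro sum_ennreal) auto
    also have "expneg \<dots> = ennreal (exp (- (\<Sum>j\<in>{1..K}. c j 0 - S j)))"
      using S(2) by (intro expneg_ennreal sum_nonneg) auto
    also have "- (\<Sum>j\<in>{1..K}. c j 0 - S j) = (\<Sum>j=1..K. S j) - pi * g 0 (x\<^sup>2)"
      unfolding pi_g_eq[OF x] c_def by (simp add: sum_subtractf)
    finally show ?thesis .
  qed
  ultimately show ?thesis by blast
qed

lemma nn_integral_poisw_total:
  assumes x: "0 < x"
  shows "(\<integral>\<^sup>+\<omega>. poisw m (total x \<omega>) \<partial>M) = ennreal (exp (- pi * g 0 (x\<^sup>2)) * exp_coeff (\<lambda>n. pi * g n (x\<^sup>2)) m)"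
  using nn_integral_poisw_from_laplace[OF prob_space_axioms measurable_total, of "\<lambda>n. pi * g n (x\<^sup>2)" x m]
    laplace_total[OF x] g_nonneg by simp

section \<open>Coverage for a fixed serving distance\<close>

abbreviation gamma_dens :: "real \<Rightarrow> ennreal" where
  "gamma_dens \<equiv> (\<lambda>v. ennreal (if 0 < v then v ^ (Mn k - 1) * exp (- v) / fact (Mn k - 1) else 0))"

text \<open>Kept as the negated outage inequality, so that it is the exact complement even where the
  interference is 0.\<close>

abbreviation covered :: "real \<Rightarrow> real \<Rightarrow> real \<Rightarrow> bool" where
  "covered x v I \<equiv> \<not> P k * v * x powr (- \<alpha> k) / I < \<beta>"

text \<open>Almost surely \<open>total\<close> is positive and finite and the interference is
  positive, so the denominator can be cleared and the covered gains form the half-line that starts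
  at the value of \<open>total\<close>. The Gamma tail turns its probability into Poisson
  weights.\<close>

lemma conditional_coverage:
  assumes x: "0 < x"
  shows "(\<integral>\<^sup>+\<omega>. (\<integral>\<^sup>+v. gamma_dens v * indicator {v. covered x v (intf x \<omega>)} v \<partial>lborel) \<partial>M)
     = ennreal (\<Sum>m<Mn k. exp (- pi * g 0 (x\<^sup>2)) * exp_coeff (\<lambda>n. pi * g n (x\<^sup>2)) m)"
proof -
  note p = posD[OF k]
  have "AE \<omega> in M. (\<integral>\<^sup>+v. gamma_dens v * indicator {v. covered x v (intf x \<omega>)} v \<partial>lborel) = (\<Sum>m<Mn k. poisw m (total x \<omega>))"
    using AE_total[OF x]
  proof eventually_elim
    case (elim \<omega>)
    define y where "y = enn2real (total x \<omega>)"
    have tot: "total x \<omega> = ennreal y" using elim by (simp add: y_def less_top)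
    have y: "0 < y" using elim tot by (metis ennreal_eq_0_iff not_le)
    define s where "s = \<beta> * x powr \<alpha> k / P k"
    have s: "0 < s" using x beta p by (simp add: s_def)
    have I: "s * intf x \<omega> = y" using elim by (simp add: y_def s_def)
    then have Ipos: "0 < intf x \<omega>" using s y by (metis zero_less_mult_pos)
    have "covered x v (intf x \<omega>) \<longleftrightarrow> y \<le> v" for v
    proof -
      have "covered x v (intf x \<omega>) \<longleftrightarrow> \<beta> * intf x \<omega> \<le> P k * v * x powr (- \<alpha> k)"
        using Ipos by (simp add: not_less field_simps)
      also have "\<dots> \<longleftrightarrow> s * intf x \<omega> \<le> v"
        using p x by (simp add: s_def powr_minus field_simps)
      finally show ?thesis unfolding I .
    qed
    then have "{v. covered x v (intf x \<omega>)} = {y..}" by auto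
    then show ?case
      unfolding tot using nn_integral_gamma_tail[of y "Mn k"] y p by simp
  qed
  then have "(\<integral>\<^sup>+\<omega>. (\<integral>\<^sup>+v. gamma_dens v * indicator {v. covered x v (intf x \<omega>)} v \<partial>lborel) \<partial>M)
     = (\<integral>\<^sup>+\<omega>. (\<Sum>m<Mn k. poisw m (total x \<omega>)) \<partial>M)"
    by (rule nn_integral_cong_AE)
  also have "\<dots> = (\<Sum>m<Mn k. \<integral>\<^sup>+\<omega>. poisw m (total x \<omega>) \<partial>M)"
    by (intro nn_integral_sum) measurable
  also have "\<dots> = (\<Sum>m<Mn k. ennreal (exp (- pi * g 0 (x\<^sup>2)) * exp_coeff (\<lambda>n. pi * g n (x\<^sup>2)) m))"
    by (simp only: nn_integral_poisw_total[OF x])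
  also have "\<dots> = ennreal (\<Sum>m<Mn k. exp (- pi * g 0 (x\<^sup>2)) * exp_coeff (\<lambda>n. pi * g n (x\<^sup>2)) m)"
    using g_nonneg by (intro sum_ennreal mult_nonneg_nonneg exp_coeff_nonneg) auto
  finally show ?thesis .
qed

section \<open>Averaging over distance, gain and configuration\<close>

abbreviation "PP \<equiv> PiM {1..K} (\<lambda>_. pp_space (borel :: ((real \<times> real) \<times> real) measure))"

abbreviation \<Psi> :: "'w \<Rightarrow> nat \<Rightarrow> ((real \<times> real) \<times> real) set" where
  "\<Psi> \<omega> \<equiv> restrict (\<lambda>j. \<Phi> j \<omega>) {1..K}"

abbreviation "ic x \<phi> \<equiv> interference K P Om \<alpha> k \<phi> x"

lemma ic_restrict: "ic x (\<Psi> \<omega>) = intf x \<omega>"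
  unfolding interference_def by (intro sum.cong) auto

lemma measurable_ic [measurable]:
  assumes "f \<in> borel_measurable N" "h \<in> measurable N PP"
  shows "(\<lambda>p. ic (f p) (h p)) \<in> borel_measurable N"
  using assms(2) by (intro measurable_interference assms(1)) (rule measurable_compose[OF _ measurable_component_singleton])

abbreviation X_dens :: "real \<Rightarrow> real" where
  "X_dens \<equiv> (\<lambda>x. if 0 < x \<and> x \<le> R then
              2 * pi * lam k / T * x * exp (- pi * (\<Sum>j=1..K. lam j * (Om j / Om k) powr (2 / \<alpha> j)
                 * x powr (2 * ((2 / \<alpha> j) / (2 / \<alpha> k))))) else 0)"

lemma measurable_X [measurable]: "X \<in> borel_measurable M" and measurable_G [measurable]: "G \<in> borel_measurable M"
  using indep_XG unfolding indep_var_distribution_eq by auto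

lemma distr_X: "distr M borel X = density lborel (\<lambda>x. ennreal (X_dens x))"
  using X unfolding distributed_def by (metis distr_cong sets_lborel)

lemma distr_G: "distr M borel G = density lborel gamma_dens"
  using G unfolding distributed_def by (metis distr_cong sets_lborel)

text \<open>The joint law is a product of three factors. The gain is integrated innermost, so that
  its tail can be evaluated for each configuration, and the law of the configurations is pulled back
  to \<open>M\<close>, where the earlier expectations live.\<close>

lemma nn_integral_disintegrate:
  assumes f[measurable]: "f \<in> borel_measurable ((borel \<Otimes>\<^sub>M borel) \<Otimes>\<^sub>M PP)"
  shows "(\<integral>\<^sup>+\<omega>. f ((X \<omega>, G \<omega>), \<Psi> \<omega>) \<partial>M) =
    (\<integral>\<^sup>+x. ennreal (X_dens x) * (\<integral>\<^sup>+\<omega>. (\<integral>\<^sup>+v. gamma_dens v * f ((x, v), \<Psi> \<omega>) \<partial>lborel) \<partial>M) \<partial>lborel)"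
proof -
  define PX where "PX = distr M borel X"
  define PG where "PG = distr M borel G"
  define P\<Psi> where "P\<Psi> = distr M PP \<Psi>"
  have sets[measurable_cong]: "sets PX = sets borel" "sets PG = sets borel" "sets P\<Psi> = sets PP"
    by (simp_all add: PX_def PG_def P\<Psi>_def)
  interpret PX: prob_space PX unfolding PX_def by (rule prob_space_distr) measurable
  interpret PG: prob_space PG unfolding PG_def by (rule prob_space_distr) measurable
  interpret P\<Psi>: prob_space P\<Psi> unfolding P\<Psi>_def by (rule prob_space_distr[OF measurable_\<Phi>s])
  interpret G\<Psi>: pair_sigma_finite PG P\<Psi> ..
  have XG: "distr M (borel \<Otimes>\<^sub>M borel) (\<lambda>\<omega>. (X \<omega>, G \<omega>)) = PX \<Otimes>\<^sub>M PG"
    using indep_XG unfolding indep_var_distribution_eq PX_def PG_def by simp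
  have joint: "distr M ((borel \<Otimes>\<^sub>M borel) \<Otimes>\<^sub>M PP) (\<lambda>\<omega>. ((X \<omega>, G \<omega>), \<Psi> \<omega>)) = (PX \<Otimes>\<^sub>M PG) \<Otimes>\<^sub>M P\<Psi>"
    unfolding P\<Psi>_def XG[symmetric] by (rule distr_pair_indep_set[OF measurable_XG measurable_\<Phi>s indep_XG_\<Phi>s])
  have f': "f \<in> borel_measurable ((PX \<Otimes>\<^sub>M PG) \<Otimes>\<^sub>M P\<Psi>)" by measurable
  have "(\<integral>\<^sup>+\<omega>. f ((X \<omega>, G \<omega>), \<Psi> \<omega>) \<partial>M) = (\<integral>\<^sup>+p. f p \<partial>((PX \<Otimes>\<^sub>M PG) \<Otimes>\<^sub>M P\<Psi>))"
    unfolding joint[symmetric]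
    by (subst nn_integral_distr) (use measurable_XG measurable_\<Phi>s in measurable)
  also have "\<dots> = (\<integral>\<^sup>+q. (\<integral>\<^sup>+\<phi>. f (q, \<phi>) \<partial>P\<Psi>) \<partial>(PX \<Otimes>\<^sub>M PG))"
    by (rule P\<Psi>.nn_integral_fst[OF f', symmetric])
  also have "\<dots> = (\<integral>\<^sup>+x. (\<integral>\<^sup>+v. (\<integral>\<^sup>+\<phi>. f ((x, v), \<phi>) \<partial>P\<Psi>) \<partial>PG) \<partial>PX)"
    by (rule PG.nn_integral_fst[symmetric]) (rule P\<Psi>.borel_measurable_nn_integral_fst[OF f'])
  also have "\<dots> = (\<integral>\<^sup>+x. (\<integral>\<^sup>+\<phi>. (\<integral>\<^sup>+v. f ((x, v), \<phi>) \<partial>PG) \<partial>P\<Psi>) \<partial>PX)"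
    by (intro nn_integral_cong G\<Psi>.Fubini'[symmetric]) measurable
  also have "\<dots> = (\<integral>\<^sup>+x. (\<integral>\<^sup>+\<omega>. (\<integral>\<^sup>+v. f ((x, v), \<Psi> \<omega>) \<partial>PG) \<partial>M) \<partial>PX)"
    unfolding P\<Psi>_def by (intro nn_integral_cong nn_integral_distr measurable_\<Phi>s) measurable
  also have "\<dots> = (\<integral>\<^sup>+x. ennreal (X_dens x) * (\<integral>\<^sup>+\<omega>. (\<integral>\<^sup>+v. f ((x, v), \<Psi> \<omega>) \<partial>PG) \<partial>M) \<partial>lborel)"
  proof -
    \<comment> \<open>Measurability in \<open>x\<close> is obtained for the image law, where the
      product structure gives it, and then carried over to \<open>M\<close> by equality of the
      integrals.\<close>
    have "(\<lambda>x. \<integral>\<^sup>+\<phi>. (\<integral>\<^sup>+v. f ((x, v), \<phi>) \<partial>PG) \<partial>P\<Psi>) \<in> borel_measurable lborel"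
      by measurable
    moreover have "(\<integral>\<^sup>+\<phi>. (\<integral>\<^sup>+v. f ((x, v), \<phi>) \<partial>PG) \<partial>P\<Psi>) = (\<integral>\<^sup>+\<omega>. (\<integral>\<^sup>+v. f ((x, v), \<Psi> \<omega>) \<partial>PG) \<partial>M)" for x
      unfolding P\<Psi>_def by (intro nn_integral_distr measurable_\<Phi>s) measurable
    ultimately have "(\<lambda>x. \<integral>\<^sup>+\<omega>. (\<integral>\<^sup>+v. f ((x, v), \<Psi> \<omega>) \<partial>PG) \<partial>M) \<in> borel_measurable lborel" by simp
    then show ?thesis
      unfolding PX_def distr_X by (intro nn_integral_density) measurable
  qed
  also have "\<dots> = (\<integral>\<^sup>+x. ennreal (X_dens x) * (\<integral>\<^sup>+\<omega>. (\<integral>\<^sup>+v. gamma_dens v * f ((x, v), \<Psi> \<omega>) \<partial>lborel) \<partial>M) \<partial>lborel)"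
  proof (intro nn_integral_cong arg_cong2[where f="(*)"] refl)
    fix x \<omega> assume "\<omega> \<in> space M"
    then have "\<Psi> \<omega> \<in> space PP" using measurable_space[OF measurable_\<Phi>s] by blast
    then have "(\<lambda>v. f ((x, v), \<Psi> \<omega>)) \<in> borel_measurable lborel" by measurable
    then show "(\<integral>\<^sup>+v. f ((x, v), \<Psi> \<omega>) \<partial>PG) = (\<integral>\<^sup>+v. gamma_dens v * f ((x, v), \<Psi> \<omega>) \<partial>lborel)"
      unfolding PG_def distr_G by (intro nn_integral_density) measurable
  qed
  finally show ?thesis .
qed

lemma measurable_covered [measurable]:
  "{\<omega> \<in> space M. covered (X \<omega>) (G \<omega>) (intf (X \<omega>) \<omega>)} \<in> sets M"
proof -
  have [measurable]: "(\<lambda>\<omega>. intf (X \<omega>) \<omega>) \<in> borel_measurable M"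
    by (intro measurable_interference measurable_X measurable_\<Phi>)
  show ?thesis by measurable
qed

lemma emeasure_covered:
  "emeasure M {\<omega> \<in> space M. covered (X \<omega>) (G \<omega>) (intf (X \<omega>) \<omega>)} =
     (\<integral>\<^sup>+x. ennreal (X_dens x) * ennreal (\<Sum>m<Mn k. exp (- pi * g 0 (x\<^sup>2)) * exp_coeff (\<lambda>n. pi * g n (x\<^sup>2)) m) \<partial>lborel)"
proof -
  define f where "f = (\<lambda>((x, v), \<phi>). if covered x v (ic x \<phi>) then 1 else (0::ennreal))"
  have f: "f \<in> borel_measurable ((borel \<Otimes>\<^sub>M borel) \<Otimes>\<^sub>M PP)"
    unfolding f_def case_prod_beta by measurable
  have "emeasure M {\<omega> \<in> space M. covered (X \<omega>) (G \<omega>) (intf (X \<omega>) \<omega>)}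
     = (\<integral>\<^sup>+\<omega>. indicator {\<omega> \<in> space M. covered (X \<omega>) (G \<omega>) (intf (X \<omega>) \<omega>)} \<omega> \<partial>M)"
    by (intro nn_integral_indicator[symmetric] measurable_covered)
  also have "\<dots> = (\<integral>\<^sup>+\<omega>. f ((X \<omega>, G \<omega>), \<Psi> \<omega>) \<partial>M)"
    unfolding f_def prod.case ic_restrict by (intro nn_integral_cong) (auto split: split_indicator)
  also have "\<dots> = (\<integral>\<^sup>+x. ennreal (X_dens x) * (\<integral>\<^sup>+\<omega>. (\<integral>\<^sup>+v. gamma_dens v * f ((x, v), \<Psi> \<omega>) \<partial>lborel) \<partial>M) \<partial>lborel)"
    by (rule nn_integral_disintegrate[OF f])
  also have "\<dots> = (\<integral>\<^sup>+x. ennreal (X_dens x) * ennreal (\<Sum>m<Mn k. exp (- pi * g 0 (x\<^sup>2)) * exp_coeff (\<lambda>n. pi * g n (x\<^sup>2)) m) \<partial>lborel)"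
  proof (rule nn_integral_cong)
    fix x :: real
    show "ennreal (X_dens x) * (\<integral>\<^sup>+\<omega>. (\<integral>\<^sup>+v. gamma_dens v * f ((x, v), \<Psi> \<omega>) \<partial>lborel) \<partial>M)
      = ennreal (X_dens x) * ennreal (\<Sum>m<Mn k. exp (- pi * g 0 (x\<^sup>2)) * exp_coeff (\<lambda>n. pi * g n (x\<^sup>2)) m)"
    proof (cases "0 < x")
      case True
      have "gamma_dens v * f ((x, v), \<Psi> \<omega>) = gamma_dens v * indicator {v. covered x v (intf x \<omega>)} v" for v \<omega>
        unfolding f_def prod.case ic_restrict by simp
      then show ?thesis
        unfolding conditional_coverage[OF True, symmetric] by (simp only:)
    qed simp
  qed
  finally show ?thesis .
qed

section \<open>Reduction to the integral formula\<close>

definition integrand :: "nat \<Rightarrow> nat \<Rightarrow> real \<Rightarrow> real" where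
  "integrand i m u = pi ^ (i + 1) / fact i
            * exp (- pi * g 0 u
                   - pi * (\<Sum>j=1..K. lam j * (Om j / Om k) powr (2 / \<alpha> j) * u powr ((2 / \<alpha> j) / (2 / \<alpha> k))))
            * ((toeplitz_lt (Mn k) (\<lambda>n. g n u)) ^\<^sub>m i) $$ (m, 0)"

lemma integrand_conv:
  assumes "m < Mn k"
  shows "integrand i m u = pi ^ (i + 1) / fact i
            * exp (- pi * g 0 u
                   - pi * (\<Sum>j=1..K. lam j * (Om j / Om k) powr (2 / \<alpha> j) * u powr ((2 / \<alpha> j) / (2 / \<alpha> k))))
            * conv_coeff (\<lambda>n. g n u) i m"
  using assms by (simp add: integrand_def toeplitz_lt_pow_index)

lemma integrand_nonneg: "m < Mn k \<Longrightarrow> 0 \<le> integrand i m u"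
  unfolding integrand_conv by (intro mult_nonneg_nonneg conv_coeff_nonneg g_nonneg) auto

lemma continuous_on_g: "continuous_on {0..} (g n)"
  unfolding gfun_def
  by (intro continuous_intros continuous_on_powr_const delta_ratio_pos k) auto

lemma continuous_on_conv_coeff: "continuous_on {0..} (\<lambda>u. conv_coeff (\<lambda>n. g n u) i m)"
  by (induction i arbitrary: m) (auto intro!: continuous_intros continuous_on_g)

lemma continuous_on_integrand:
  assumes "m < Mn k"
  shows "continuous_on {0..} (integrand i m)"
  unfolding integrand_conv[OF assms, abs_def]
  by (intro continuous_intros continuous_on_g continuous_on_conv_coeff continuous_on_powr_const delta_ratio_pos k) auto

text \<open>The factor \<open>2 * x\<close> is set aside as the Jacobian of the substitution
  \<open>u = x\<^sup>2\<close>. The factor \<open>pi\<close> of the density joins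
  \<open>pi ^ i\<close> from the coefficients to give \<open>pi ^ (i + 1)\<close>.\<close>

lemma X_dens_mult:
  assumes x: "0 < x" "x \<le> R"
  shows "X_dens x * (\<Sum>m<Mn k. exp (- pi * g 0 (x\<^sup>2)) * exp_coeff (\<lambda>n. pi * g n (x\<^sup>2)) m)
    = lam k / T * (2 * x * (\<Sum>i<Mn k. \<Sum>m<Mn k. integrand i m (x\<^sup>2)))"
proof -
  define s where "s = (\<Sum>j=1..K. lam j * (Om j / Om k) powr (2 / \<alpha> j) * (x\<^sup>2) powr ((2 / \<alpha> j) / (2 / \<alpha> k)))"
  have p: "x powr (2 * c) = (x\<^sup>2) powr c" for c
    using x by (simp add: powr_powr flip: powr_numeral)
  have d: "X_dens x = 2 * pi * lam k / T * x * exp (- pi * s)"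
    using x unfolding s_def p by simp
  \<comment> \<open>Powers with \<open>i > m\<close> contribute nothing, so all \<open>m\<close> can
    share the range \<open>i < Mn k\<close>.\<close>
  have ec: "exp_coeff (\<lambda>n. pi * g n (x\<^sup>2)) m = (\<Sum>i<Mn k. pi ^ i / fact i * conv_coeff (\<lambda>n. g n (x\<^sup>2)) i m)" if "m < Mn k" for m
  proof -
    have "exp_coeff (\<lambda>n. pi * g n (x\<^sup>2)) m = (\<Sum>i\<le>m. pi ^ i / fact i * conv_coeff (\<lambda>n. g n (x\<^sup>2)) i m)"
      by (simp add: exp_coeff_def conv_coeff_cmult)
    also have "\<dots> = (\<Sum>i<Mn k. pi ^ i / fact i * conv_coeff (\<lambda>n. g n (x\<^sup>2)) i m)"
      using that by (intro sum.mono_neutral_left) (auto simp: conv_coeff_eq_0)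
    finally show ?thesis .
  qed
  have "2 * pi * lam k / T * x * exp (- pi * s) * (exp (- pi * g 0 (x\<^sup>2)) * exp_coeff (\<lambda>n. pi * g n (x\<^sup>2)) m)
      = (\<Sum>i<Mn k. lam k / T * (2 * x) * integrand i m (x\<^sup>2))" if m: "m < Mn k" for m
  proof -
    have E: "exp (- pi * g 0 (x\<^sup>2) - pi * s) = exp (- pi * g 0 (x\<^sup>2)) * exp (- pi * s)"
      by (simp flip: exp_add)
    show ?thesis
      unfolding ec[OF m] integrand_conv[OF m] s_def[symmetric] E sum_distrib_left
      by (intro sum.cong refl) (simp add: mult_ac)
  qed
  then have "2 * pi * lam k / T * x * exp (- pi * s) * (\<Sum>m<Mn k. exp (- pi * g 0 (x\<^sup>2)) * exp_coeff (\<lambda>n. pi * g n (x\<^sup>2)) m)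
     = (\<Sum>m<Mn k. \<Sum>i<Mn k. lam k / T * (2 * x) * integrand i m (x\<^sup>2))"
    unfolding sum_distrib_left[of _ _ "{..<Mn k}"] by (intro sum.cong) auto
  also have "\<dots> = lam k / T * (2 * x * (\<Sum>m<Mn k. \<Sum>i<Mn k. integrand i m (x\<^sup>2)))"
    by (simp add: sum_distrib_left mult_ac)
  also have "(\<Sum>m<Mn k. \<Sum>i<Mn k. integrand i m (x\<^sup>2)) = (\<Sum>i<Mn k. \<Sum>m<Mn k. integrand i m (x\<^sup>2))"
    by (rule sum.swap)
  finally show ?thesis by (rule trans[OF arg_cong2[where f="(*)", OF d refl]])
qed

lemma emeasure_covered_eq:
  "emeasure M {\<omega> \<in> space M. covered (X \<omega>) (G \<omega>) (intf (X \<omega>) \<omega>)} =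
     ennreal (lam k / T * integral {0..R\<^sup>2} (\<lambda>u. \<Sum>i<Mn k. \<Sum>m<Mn k. integrand i m u))"
proof -
  define H where "H u = (\<Sum>i<Mn k. \<Sum>m<Mn k. integrand i m u)" for u
  have H0: "0 \<le> H u" for u unfolding H_def by (intro sum_nonneg integrand_nonneg) auto
  have contH: "continuous_on {0..R\<^sup>2} H"
    unfolding H_def
    by (intro continuous_on_sum continuous_on_subset[OF continuous_on_integrand]) auto
  have "((\<lambda>x. (2 * x) *\<^sub>R H (x\<^sup>2)) has_integral integral {0\<^sup>2..R\<^sup>2} H) {0..R}"
    using R_pos contH
    by (intro has_integral_substitution[where g="\<lambda>x. x\<^sup>2" and c=0 and d="R\<^sup>2"])
       (auto intro!: derivative_eq_intros power_mono)
  then have "((\<lambda>x. lam k / T * (2 * x * H (x\<^sup>2))) has_integral lam k / T * integral {0..R\<^sup>2} H) {0..R}"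
    by (intro has_integral_mult_right) simp
  then have "(\<integral>\<^sup>+x. ennreal (lam k / T * (2 * x * H (x\<^sup>2))) * indicator {0..R} x \<partial>lborel) = ennreal (lam k / T * integral {0..R\<^sup>2} H)"
    using H0 T_pos posD[OF k] by (intro nn_integral_has_integral_lebesgue') auto
  moreover have "(\<integral>\<^sup>+x. ennreal (X_dens x) * ennreal (\<Sum>m<Mn k. exp (- pi * g 0 (x\<^sup>2)) * exp_coeff (\<lambda>n. pi * g n (x\<^sup>2)) m) \<partial>lborel)
     = (\<integral>\<^sup>+x. ennreal (lam k / T * (2 * x * H (x\<^sup>2))) * indicator {0..R} x \<partial>lborel)"
  proof (intro nn_integral_cong)
    fix x :: real
    show "ennreal (X_dens x) * ennreal (\<Sum>m<Mn k. exp (- pi * g 0 (x\<^sup>2)) * exp_coeff (\<lambda>n. pi * g n (x\<^sup>2)) m)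
      = ennreal (lam k / T * (2 * x * H (x\<^sup>2))) * indicator {0..R} x"
    proof (cases "0 < x \<and> x \<le> R")
      case True
      then have "0 \<le> X_dens x" using T_pos posD[OF k] by simp
      then have "ennreal (X_dens x) * ennreal (\<Sum>m<Mn k. exp (- pi * g 0 (x\<^sup>2)) * exp_coeff (\<lambda>n. pi * g n (x\<^sup>2)) m)
        = ennreal (lam k / T * (2 * x * H (x\<^sup>2)))"
        unfolding H_def X_dens_mult[OF conjunct1[OF True] conjunct2[OF True], symmetric] by (rule ennreal_mult'[symmetric])
      then show ?thesis using True by (simp only:) simp
    next
      case False
      \<comment> \<open>The density excludes 0 while the indicator includes it, but there the factor
        \<open>2 * x\<close> is 0.\<close>
      then have "x \<notin> {0..R} \<or> x = 0" by auto
      then show ?thesis using False by auto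
    qed
  qed
  ultimately show ?thesis unfolding emeasure_covered H_def by simp
qed

lemma outage_eq:
  "measure M {\<omega> \<in> space M. P k * G \<omega> * X \<omega> powr (- \<alpha> k) / intf (X \<omega>) \<omega> < \<beta>}
    = 1 - lam k / T * (\<Sum>i<Mn k. \<Sum>m<Mn k. integral {0..R\<^sup>2} (integrand i m))"
proof -
  let ?C = "{\<omega> \<in> space M. covered (X \<omega>) (G \<omega>) (intf (X \<omega>) \<omega>)}"
  have int: "integrand i m integrable_on {0..R\<^sup>2}" if "m < Mn k" for i m
    by (intro integrable_continuous_interval continuous_on_subset[OF continuous_on_integrand[OF that]]) auto
  have "{\<omega> \<in> space M. P k * G \<omega> * X \<omega> powr (- \<alpha> k) / intf (X \<omega>) \<omega> < \<beta>} = space M - ?C" by auto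
  then have "measure M {\<omega> \<in> space M. P k * G \<omega> * X \<omega> powr (- \<alpha> k) / intf (X \<omega>) \<omega> < \<beta>} = 1 - measure M ?C"
    by (simp only: prob_compl[OF measurable_covered])
  also have "measure M ?C = lam k / T * integral {0..R\<^sup>2} (\<lambda>u. \<Sum>i<Mn k. \<Sum>m<Mn k. integrand i m u)"
  proof -
    have "0 \<le> integral {0..R\<^sup>2} (\<lambda>u. \<Sum>i<Mn k. \<Sum>m<Mn k. integrand i m u)"
      by (intro integral_nonneg integrable_sum int sum_nonneg integrand_nonneg) auto
    then show ?thesis
      unfolding measure_def emeasure_covered_eq using T_pos posD[OF k] by simp
  qed
  also have "integral {0..R\<^sup>2} (\<lambda>u. \<Sum>i<Mn k. \<Sum>m<Mn k. integrand i m u) = (\<Sum>i<Mn k. \<Sum>m<Mn k. integral {0..R\<^sup>2} (integrand i m))"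
    by (subst integral_sum; (intro sum.cong refl integral_sum integrable_sum int)?) auto
  finally show ?thesis .
qed

section \<open>Equal path-loss exponents\<close>

abbreviation "th \<equiv> theta K lam A Om (\<alpha> k) Mn Bs \<beta> k"
abbreviation "Z \<equiv> Zk K lam A Om (\<alpha> k) Mn Bs \<beta> k"

text \<open>All ratios of exponents are 1, so \<open>g n u = u * th n\<close>, and homogeneity of
  \<open>conv_coeff\<close> extracts \<open>u ^ i\<close>. What remains is the Erlang density of
  shape \<open>i + 1\<close> and rate \<open>pi * Z\<close>.\<close>

lemma integral_integrand_equal_exponents:
  assumes eq: "\<forall>j\<in>{1..K}. \<alpha> j = \<alpha> k" and m: "m < Mn k"
  shows "integral {0..R\<^sup>2} (integrand i m) = conv_coeff th i m / Z ^ (i + 1)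
     * (1 - (\<Sum>l\<le>i. (pi * Z * R\<^sup>2) ^ l / fact l * exp (- pi * Z * R\<^sup>2)))"
    and th_nonneg: "0 \<le> th n"
proof -
  have ratio: "(2 / \<alpha> j) / (2 / \<alpha> k) = 1" if "j \<in> {1..K}" for j
    using bspec[OF eq that] posD[OF k] by simp
  have g_lin: "g n u = u * th n" if "0 \<le> u" for n u
    unfolding gfun_def theta_def sum_distrib_left
  proof (rule sum.cong[OF refl])
    fix j assume j: "j \<in> {1..K}"
    show "A j * lam j * (Om j / Om k) powr (2 / \<alpha> j) * varphi (2 / \<alpha> j) (ta j) n * u powr ((2 / \<alpha> j) / (2 / \<alpha> k))
      = u * (A j * lam j * (Om j / Om k) powr (2 / \<alpha> k) * varphi (2 / \<alpha> k) (ta j) n)"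
      unfolding ratio[OF j] unfolding bspec[OF eq j] using that by simp
  qed
  show th0: "0 \<le> th n" for n
    using g_nonneg[of n 1] g_lin[of 1 n] by simp
  define L where "L = (\<Sum>j=1..K. lam j * (Om j / Om k) powr (2 / \<alpha> k))"
  have "L = bigLambda K lam Om (\<alpha> k) / Om k powr (2 / \<alpha> k)"
    unfolding L_def bigLambda_def sum_divide_distrib
    using posD posD[OF k] by (intro sum.cong refl) (simp add: powr_divide less_imp_le)
  then have Z: "Z = th 0 + L" by (simp add: Zk_def)
  have "0 < lam j * (Om j / Om k) powr (2 / \<alpha> k)" if "j \<in> {1..K}" for j
    using posD[OF that] posD[OF k] by simp
  then have "0 < L" unfolding L_def using k by (intro sum_pos) auto
  then have Zpos: "0 < Z" using th0[of 0] Z by linarith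
  have L_lin: "(\<Sum>j=1..K. lam j * (Om j / Om k) powr (2 / \<alpha> j) * u powr ((2 / \<alpha> j) / (2 / \<alpha> k))) = u * L" if "0 \<le> u" for u
    unfolding L_def sum_distrib_left
  proof (rule sum.cong[OF refl])
    fix j assume j: "j \<in> {1..K}"
    show "lam j * (Om j / Om k) powr (2 / \<alpha> j) * u powr ((2 / \<alpha> j) / (2 / \<alpha> k)) = u * (lam j * (Om j / Om k) powr (2 / \<alpha> k))"
      unfolding ratio[OF j] unfolding bspec[OF eq j] using that by simp
  qed
  have "integrand i m u = conv_coeff th i m / Z ^ (i + 1) * ((pi * Z) ^ Suc i * u ^ i * exp (- (pi * Z) * u) / fact i)" if u: "0 \<le> u" for u
  proof -
    \<comment> \<open>Supplies the power of \<open>Z\<close> that normalises the Erlang density and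
      divides it out again in front.\<close>
    have alg: "a / f * e * (v * c) = c / z * (a * z * v * e / f)" if "z \<noteq> 0" for a f e v c z :: real
      using that by simp
    have E: "exp (- pi * g 0 u - pi * (u * L)) = exp (- (pi * Z) * u)"
      unfolding g_lin[OF u] Z by (simp add: algebra_simps)
    have C: "conv_coeff (\<lambda>n. g n u) i m = u ^ i * conv_coeff th i m"
      unfolding g_lin[OF u] by (rule conv_coeff_cmult)
    have P: "(pi * Z) ^ Suc i = pi ^ (i + 1) * Z ^ (i + 1)"
      by (simp add: power_mult_distrib)
    show ?thesis
      unfolding integrand_conv[OF m] L_lin[OF u] E C P by (rule alg) (use Zpos in simp)
  qed
  then have "integral {0..R\<^sup>2} (integrand i m)
    = integral {0..R\<^sup>2} (\<lambda>u. conv_coeff th i m / Z ^ (i + 1) * ((pi * Z) ^ Suc i * u ^ i * exp (- (pi * Z) * u) / fact i))"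
    by (intro integral_cong) simp
  also have "\<dots> = conv_coeff th i m / Z ^ (i + 1) * integral {0..R\<^sup>2} (\<lambda>u. (pi * Z) ^ Suc i * u ^ i * exp (- (pi * Z) * u) / fact i)"
    by (rule integral_mult_right)
  also have "integral {0..R\<^sup>2} (\<lambda>u. (pi * Z) ^ Suc i * u ^ i * exp (- (pi * Z) * u) / fact i)
      = 1 - (\<Sum>l\<le>i. (pi * Z * R\<^sup>2) ^ l / fact l * exp (- (pi * Z) * R\<^sup>2))"
    using Zpos by (intro integral_erlang) auto
  finally show "integral {0..R\<^sup>2} (integrand i m) = conv_coeff th i m / Z ^ (i + 1)
     * (1 - (\<Sum>l\<le>i. (pi * Z * R\<^sup>2) ^ l / fact l * exp (- pi * Z * R\<^sup>2)))"
    unfolding mult_minus_left .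
qed

lemma outage_equal_exponents:
  assumes eq: "\<forall>j\<in>{1..K}. \<alpha> j = \<alpha> k"
  shows "measure M {\<omega> \<in> space M. P k * G \<omega> * X \<omega> powr (- \<alpha> k) / intf (X \<omega>) \<omega> < \<beta>}
    = 1 - lam k / T * (\<Sum>i<Mn k. mat_norm1 (toeplitz_lt (Mn k) th ^\<^sub>m i) / Z ^ (i + 1)
            * (1 - (\<Sum>l\<le>i. (pi * Z * R\<^sup>2) ^ l / fact l * exp (- pi * Z * R\<^sup>2))))"
proof -
  have "(\<Sum>m<Mn k. integral {0..R\<^sup>2} (integrand i m)) = mat_norm1 (toeplitz_lt (Mn k) th ^\<^sub>m i) / Z ^ (i + 1)
            * (1 - (\<Sum>l\<le>i. (pi * Z * R\<^sup>2) ^ l / fact l * exp (- pi * Z * R\<^sup>2)))" for i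
  proof -
    have "(\<Sum>m<Mn k. integral {0..R\<^sup>2} (integrand i m)) = (\<Sum>m<Mn k. conv_coeff th i m / Z ^ (i + 1)
     * (1 - (\<Sum>l\<le>i. (pi * Z * R\<^sup>2) ^ l / fact l * exp (- pi * Z * R\<^sup>2))))"
      by (intro sum.cong refl integral_integrand_equal_exponents(1)[OF eq]) simp
    also have "\<dots> = (\<Sum>m<Mn k. conv_coeff th i m) / Z ^ (i + 1)
     * (1 - (\<Sum>l\<le>i. (pi * Z * R\<^sup>2) ^ l / fact l * exp (- pi * Z * R\<^sup>2)))"
      unfolding sum_divide_distrib sum_distrib_right[symmetric] ..
    also have "(\<Sum>m<Mn k. conv_coeff th i m) = mat_norm1 (toeplitz_lt (Mn k) th ^\<^sub>m i)"
      using th_nonneg[OF eq posD(6)[OF k]] by (intro mat_norm1_toeplitz_lt_pow[symmetric] posD(6)[OF k])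
    finally show ?thesis .
  qed
  then show ?thesis unfolding outage_eq by (simp only:)
qed

end

theorem theorem2:
  fixes K k :: nat and lam P Bs \<alpha> :: "nat \<Rightarrow> real" and Mn :: "nat \<Rightarrow> nat"
    and lu \<epsilon> \<beta> :: real
    and M :: "'w measure" and X G :: "'w \<Rightarrow> real"
    and \<Phi> :: "nat \<Rightarrow> 'w \<Rightarrow> ((real \<times> real) \<times> real) set"
  defines "Om \<equiv> (\<lambda>j. P j * real (Mn j) * Bs j)"
  defines "A \<equiv> activ K lam lu Om \<alpha> \<epsilon>"
  defines "T \<equiv> assocT K lam Om \<alpha> \<epsilon> k"
  defines "R \<equiv> radius Om \<alpha> \<epsilon> k"
  assumes k: "k \<in> {1..K}"
    and pos: "\<forall>j\<in>{1..K}. lam j > 0 \<and> P j > 0 \<and> Bs j > 0 \<and> \<alpha> j > 2 \<and> Mn j \<ge> 1"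
    and lu: "lu > 0" and eps: "\<epsilon> > 0" and beta: "\<beta> > 0"
    and M: "prob_space M"
    and X: "distributed M lborel X (\<lambda>x. ennreal (if 0 < x \<and> x \<le> R then
              2 * pi * lam k / T * x * exp (- pi * (\<Sum>j=1..K. lam j * (Om j / Om k) powr (2 / \<alpha> j)
                 * x powr (2 * ((2 / \<alpha> j) / (2 / \<alpha> k))))) else 0))"
    and G: "distributed M lborel G (\<lambda>g. ennreal (if 0 < g then
              g ^ (Mn k - 1) * exp (- g) / fact (Mn k - 1) else 0))"
    and PPP: "\<forall>j\<in>{1..K}. poisson_pp M (marked_intensity (A j * lam j)) (\<Phi> j)"
    and ind1: "prob_space.indep_vars M (\<lambda>_. pp_space (borel :: ((real \<times> real) \<times> real) measure)) \<Phi> {1..K}"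
    and ind2: "(\<lambda>\<omega>. (X \<omega>, G \<omega>)) \<in> measurable M (borel \<Otimes>\<^sub>M borel)"
    and ind2': "(\<lambda>\<omega>. restrict (\<lambda>j. \<Phi> j \<omega>) {1..K})
                 \<in> measurable M (PiM {1..K} (\<lambda>_. pp_space (borel :: ((real \<times> real) \<times> real) measure)))"
    and ind2'': "prob_space.indep_set M
          {(\<lambda>\<omega>. (X \<omega>, G \<omega>)) -` S \<inter> space M | S. S \<in> sets (borel \<Otimes>\<^sub>M borel)}
          {(\<lambda>\<omega>. restrict (\<lambda>j. \<Phi> j \<omega>) {1..K}) -` S \<inter> space M | S.
             S \<in> sets (PiM {1..K} (\<lambda>_. pp_space (borel :: ((real \<times> real) \<times> real) measure)))}"
    and ind3: "prob_space.indep_var M borel X borel G"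
  shows
    "measure M {\<omega> \<in> space M. P k * G \<omega> * X \<omega> powr (- \<alpha> k)
         / interference K P Om \<alpha> k (\<lambda>j. \<Phi> j \<omega>) (X \<omega>) < \<beta>}
       = 1 - lam k / T * (\<Sum>i<Mn k. \<Sum>m<Mn k. integral {0..R\<^sup>2} (\<lambda>x.
            pi ^ (i + 1) / fact i
            * exp (- pi * gfun K lam A Om \<alpha> Mn Bs \<beta> k 0 x
                   - pi * (\<Sum>j=1..K. lam j * (Om j / Om k) powr (2 / \<alpha> j) * x powr ((2 / \<alpha> j) / (2 / \<alpha> k))))
            * ((toeplitz_lt (Mn k) (\<lambda>n. gfun K lam A Om \<alpha> Mn Bs \<beta> k n x)) ^\<^sub>m i) $$ (m, 0)))
     \<and> ((\<forall>j\<in>{1..K}. \<alpha> j = \<alpha> k) \<longrightarrow>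
        measure M {\<omega> \<in> space M. P k * G \<omega> * X \<omega> powr (- \<alpha> k)
         / interference K P Om \<alpha> k (\<lambda>j. \<Phi> j \<omega>) (X \<omega>) < \<beta>}
       = 1 - lam k / T * (\<Sum>i<Mn k.
            mat_norm1 ((toeplitz_lt (Mn k) (theta K lam A Om (\<alpha> k) Mn Bs \<beta> k)) ^\<^sub>m i)
            / (Zk K lam A Om (\<alpha> k) Mn Bs \<beta> k) ^ (i + 1)
            * (1 - (\<Sum>l\<le>i. (pi * Zk K lam A Om (\<alpha> k) Mn Bs \<beta> k * R\<^sup>2) ^ l / fact l
                 * exp (- pi * Zk K lam A Om (\<alpha> k) Mn Bs \<beta> k * R\<^sup>2)))))"
proof -
  interpret downlink_network M K k lam P Bs \<alpha> Mn lu \<epsilon> \<beta> X G \<Phi> Om A T R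
    by (rule downlink_network.intro[OF M], rule downlink_network_axioms.intro)
      (fact assms Om_def[THEN meta_eq_to_obj_eq] A_def[THEN meta_eq_to_obj_eq]
        T_def[THEN meta_eq_to_obj_eq] R_def[THEN meta_eq_to_obj_eq])+
  show ?thesis
    using outage_eq outage_equal_exponents unfolding integrand_def[abs_def] by blast
qed

end
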